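(* Let $n,m\ge 1$ be integers, let $l_1\le l_2\le\dots\le l_n$ be integers, let $R=\mathbb{Z}[t_{i,j}\,:\,i,j\ge 0]$, let $I\subset R$ be the ideal generated by the $t_{i,j}$ with $0\le i\le j$, and let $$D=(x\partial_x-l_1)\cdots(x\partial_x-l_n)+\sum_{0\le j\le m,\ i\ge 0}t_{i,j}x^i\partial_x^j,\qquad \partial_x=\frac{d}{dx}.$$ Then there exist an element $L(D)\in\hat R_I\hat\otimes_{\mathbb{Z}}\mathbb{Q}$ and a real constant $C>0$, both independent of $p$, such that for every prime $p$ $$Det_p(D)=L(D)\quad\text{modulo } p \text{ and } I^{\lceil Cp\rceil}.$$ That is, with $s=\lceil Cp\rceil$, the image of $L(D)$ in $(R/I^s)\otimes\mathbb{Q}$ lies in $(R/I^s)\otimes\mathbb{Z}_{(p)}$, and its reduction modulo $p$ in $R/(pR+I^s)$ equals the image of $Det_p(D)\in R/pR$.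
   Context: $\hat R_I\hat\otimes_{\mathbb{Z}}\mathbb{Q}:=\varprojlim_k\,(R/I^k)\otimes_{\mathbb{Z}}\mathbb{Q}$. $\mathbb{Z}_{(p)}\subset\mathbb{Q}$ is the ring of rational numbers with denominator prime to $p$; since $R/I^s$ is a free abelian group, $(R/I^s)\otimes\mathbb{Z}_{(p)}\subset(R/I^s)\otimes\mathbb{Q}$. Definition of $Det_p(D)$: let $D^{(p)}$ be the reduction of $D$ modulo the prime $p$, acting on (the completion, i.e. power series in $x$, of) the free $R/pR$-module $V$ with basis $1,x,x^2,\dots$. The (completed) submodule $V^{(p)}$ spanned by $x^p,x^{p+1},\dots$ is $D^{(p)}$-invariant, so $D^{(p)}$ acts on the free module $V/V^{(p)}$ with basis $1,x,\dots,x^{p-1}$, and $Det_p(D):=\det\big(D^{(p)}|_{V/V^{(p)}}\big)\in R/pR$. *)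

theory Defs
  imports
    Complex_Main
    "HOL-Library.Poly_Mapping"
    "HOL-Computational_Algebra.Formal_Power_Series"
    "HOL-Combinatorics.Permutations"
    "HOL-Number_Theory.Modular_Inverse"
    "HOL-Algebra.Free_Abelian_Groups"
    "HOL-Algebra.Generated_Groups"
    "HOL-Algebra.Ideal_Product"
    "HOL-Algebra.QuotRing"
    "HOL-Algebra.Algebraic_Closure_Type"
begin

hide_const (open) Divisibility.prime

subsection \<open>Tensor products of abelian groups\<close>

text \<open>Abelian groups are written multiplicatively here, as in \<open>HOL-Algebra\<close>; they are going
  to be additive groups \<open>add_monoid\<close> of rings. The group \<open>free_Abelian_group\<close>
  itself consists of finitely supported integer functions, with \<open>+\<close> as its operation.\<close>

definition tensor_relators ::
    "('a, 'm) monoid_scheme \<Rightarrow> ('b, 'n) monoid_scheme \<Rightarrow> ('a \<times> 'b \<Rightarrow>\<^sub>0 int) set" where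
  "tensor_relators A B =
     {frag_of (a \<otimes>\<^bsub>A\<^esub> a', b) - frag_of (a, b) - frag_of (a', b) | a a' b.
        a \<in> carrier A \<and> a' \<in> carrier A \<and> b \<in> carrier B} \<union>
     {frag_of (a, b \<otimes>\<^bsub>B\<^esub> b') - frag_of (a, b) - frag_of (a, b') | a b b'.
        a \<in> carrier A \<and> b \<in> carrier B \<and> b' \<in> carrier B}"

definition tensor_kernel ::
    "('a, 'm) monoid_scheme \<Rightarrow> ('b, 'n) monoid_scheme \<Rightarrow> ('a \<times> 'b \<Rightarrow>\<^sub>0 int) set" where
  "tensor_kernel A B =
     generate (free_Abelian_group (carrier A \<times> carrier B)) (tensor_relators A B)"

definition tensor ::
    "('a, 'm) monoid_scheme \<Rightarrow> ('b, 'n) monoid_scheme \<Rightarrow> ('a \<times> 'b \<Rightarrow>\<^sub>0 int) set monoid" where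
  "tensor A B = free_Abelian_group (carrier A \<times> carrier B) Mod tensor_kernel A B"

definition pure_tensor ::
    "('a, 'm) monoid_scheme \<Rightarrow> ('b, 'n) monoid_scheme \<Rightarrow> 'a \<Rightarrow> 'b \<Rightarrow> ('a \<times> 'b \<Rightarrow>\<^sub>0 int) set" where
  "pure_tensor A B a b =
     tensor_kernel A B #>\<^bsub>free_Abelian_group (carrier A \<times> carrier B)\<^esub> frag_of (a, b)"

text \<open>The homomorphism into \<open>G\<close> induced on a tensor product by a biadditive map \<open>h\<close>, sending
  the class of \<open>\<Sum>\<^sub>i n\<^sub>i (a\<^sub>i, b\<^sub>i)\<close> to \<open>\<Sum>\<^sub>i n\<^sub>i h(a\<^sub>i, b\<^sub>i)\<close>.
  For biadditive \<open>h\<close> the value does not depend on the representative (lemma \<open>tensor_lift_hom\<close>).\<close>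

definition tensor_lift ::
    "('g, 'k) monoid_scheme \<Rightarrow> ('a \<Rightarrow> 'b \<Rightarrow> 'g) \<Rightarrow> ('a \<times> 'b \<Rightarrow>\<^sub>0 int) set \<Rightarrow> 'g" where
  "tensor_lift G h U =
     the_elem ((\<lambda>c. finprod G (\<lambda>(a, b). h a b [^]\<^bsub>G\<^esub> Poly_Mapping.lookup c (a, b))
                  (Poly_Mapping.keys c)) ` U)"

lemma tensor_lift_hom:
  fixes A :: "('a, 'm) monoid_scheme" and B :: "('b, 'n) monoid_scheme"
    and G :: "('g, 'k) monoid_scheme"
  assumes "monoid A" "monoid B" "comm_group G"
    and closed: "\<And>a b. a \<in> carrier A \<Longrightarrow> b \<in> carrier B \<Longrightarrow> h a b \<in> carrier G"
    and left: "\<And>a a' b. a \<in> carrier A \<Longrightarrow> a' \<in> carrier A \<Longrightarrow> b \<in> carrier B \<Longrightarrow>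
      h (a \<otimes>\<^bsub>A\<^esub> a') b = h a b \<otimes>\<^bsub>G\<^esub> h a' b"
    and right: "\<And>a b b'. a \<in> carrier A \<Longrightarrow> b \<in> carrier B \<Longrightarrow> b' \<in> carrier B \<Longrightarrow>
      h a (b \<otimes>\<^bsub>B\<^esub> b') = h a b \<otimes>\<^bsub>G\<^esub> h a b'"
  shows "tensor_lift G h \<in> hom (tensor A B) G"
    and "\<And>a b. a \<in> carrier A \<Longrightarrow> b \<in> carrier B \<Longrightarrow>
      tensor_lift G h (pure_tensor A B a b) = h a b"
proof -
  interpret A: monoid A by fact
  interpret B: monoid B by fact
  interpret G: comm_group G by fact
  let ?S = "carrier A \<times> carrier B"
  let ?F = "free_Abelian_group ?S"
  let ?N = "tensor_kernel A B"
  let ?h = "\<lambda>x. h (fst x) (snd x)"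
  interpret F: comm_group ?F by (rule abelian_free_Abelian_group)
  define H where "H c = finprod G (\<lambda>(a, b). h a b [^]\<^bsub>G\<^esub> Poly_Mapping.lookup c (a, b))
    (Poly_Mapping.keys c)" for c :: "'a \<times> 'b \<Rightarrow>\<^sub>0 int"
  have hS: "?h x \<in> carrier G" if "x \<in> ?S" for x
    using that by (auto intro: closed)
  have H_eq: "H c = finprod G (\<lambda>x. ?h x [^]\<^bsub>G\<^esub> Poly_Mapping.lookup c x) T"
    if "Poly_Mapping.keys c \<subseteq> T" "finite T" "T \<subseteq> ?S" for c T
    unfolding H_def case_prod_unfold prod.collapse
  proof (rule G.finprod_mono_neutral_cong_left)
    show "(\<lambda>x. ?h x [^]\<^bsub>G\<^esub> Poly_Mapping.lookup c x) \<in> T \<rightarrow> carrier G"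
      using that(3) by (intro Pi_I G.int_pow_closed hS) blast
    show "?h x [^]\<^bsub>G\<^esub> Poly_Mapping.lookup c x = \<one>\<^bsub>G\<^esub>"
      if "x \<in> T - Poly_Mapping.keys c" for x
      using that by (simp add: in_keys_iff)
  qed (use that in simp_all)
  have Hhom: "H \<in> hom ?F G"
  proof (rule homI)
    fix c assume "c \<in> carrier ?F"
    then show "H c \<in> carrier G"
      unfolding H_def case_prod_unfold prod.collapse
      by (intro G.finprod_closed Pi_I G.int_pow_closed hS) auto
  next
    fix c d assume "c \<in> carrier ?F" "d \<in> carrier ?F"
    then have k: "Poly_Mapping.keys c \<subseteq> ?S" "Poly_Mapping.keys d \<subseteq> ?S" by simp_all
    define T where "T = Poly_Mapping.keys c \<union> Poly_Mapping.keys d"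
    have T: "finite T" "T \<subseteq> ?S" "Poly_Mapping.keys c \<subseteq> T" "Poly_Mapping.keys d \<subseteq> T"
      "Poly_Mapping.keys (c + d) \<subseteq> T"
      using k keys_add[of c d] by (auto simp: T_def)
    have hT: "?h x \<in> carrier G" if "x \<in> T" for x
      using that T(2) hS by blast
    have "H (c + d) = finprod G (\<lambda>x. ?h x [^]\<^bsub>G\<^esub> Poly_Mapping.lookup (c + d) x) T"
      by (rule H_eq) (use T in auto)
    also have "\<dots> = finprod G (\<lambda>x. ?h x [^]\<^bsub>G\<^esub> Poly_Mapping.lookup c x \<otimes>\<^bsub>G\<^esub>
        ?h x [^]\<^bsub>G\<^esub> Poly_Mapping.lookup d x) T"
      by (rule G.finprod_cong') (auto simp: lookup_add hT G.int_pow_mult)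
    also have "\<dots> = H c \<otimes>\<^bsub>G\<^esub> H d"
      by (subst G.finprod_multf) (auto simp: hT H_eq[OF T(3,1,2)] H_eq[OF T(4,1,2)])
    finally show "H (c \<otimes>\<^bsub>?F\<^esub> d) = H c \<otimes>\<^bsub>G\<^esub> H d" by simp
  qed
  interpret H: group_hom ?F G H
    by unfold_locales (rule Hhom)
  have H_of: "H (frag_of x) = ?h x" if "x \<in> ?S" for x
    using that closed by (subst H_eq[of _ "{x}"]) auto
  have H_diff: "H (u - v - w) = H u \<otimes>\<^bsub>G\<^esub> inv\<^bsub>G\<^esub> H v \<otimes>\<^bsub>G\<^esub> inv\<^bsub>G\<^esub> H w"
    if "u \<in> carrier ?F" "v \<in> carrier ?F" "w \<in> carrier ?F" for u v w
  proof -
    have "u - v - w = u \<otimes>\<^bsub>?F\<^esub> inv\<^bsub>?F\<^esub> v \<otimes>\<^bsub>?F\<^esub> inv\<^bsub>?F\<^esub> w"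
      using that by simp
    then show ?thesis
      using that by (simp only: H.hom_mult H.hom_inv F.m_closed F.inv_closed)
  qed
  have rel_sub: "tensor_relators A B \<subseteq> carrier ?F"
  proof -
    have "frag_of u - frag_of v - frag_of w \<in> carrier ?F"
      if "u \<in> ?S" "v \<in> ?S" "w \<in> ?S" for u v w
    proof -
      have "Poly_Mapping.keys (frag_of u - frag_of v - frag_of w) \<subseteq> {u, v, w}"
        using keys_diff[of "frag_of u - frag_of v" "frag_of w"]
          keys_diff[of "frag_of u" "frag_of v"] by auto
      then show ?thesis using that by auto
    qed
    then show ?thesis unfolding tensor_relators_def
      by (auto simp del: carrier_free_Abelian_group_iff)
  qed
  have comm: "x \<otimes>\<^bsub>G\<^esub> y \<otimes>\<^bsub>G\<^esub> inv\<^bsub>G\<^esub> x \<otimes>\<^bsub>G\<^esub> inv\<^bsub>G\<^esub> y = \<one>\<^bsub>G\<^esub>"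
    if "x \<in> carrier G" "y \<in> carrier G" for x y
  proof -
    have "x \<otimes>\<^bsub>G\<^esub> y \<otimes>\<^bsub>G\<^esub> inv\<^bsub>G\<^esub> x = y \<otimes>\<^bsub>G\<^esub> (x \<otimes>\<^bsub>G\<^esub> inv\<^bsub>G\<^esub> x)"
      using that by (subst G.m_comm[of x y]) (simp_all only: G.m_assoc G.inv_closed)
    then show ?thesis using that by simp
  qed
  have rel: "H c = \<one>\<^bsub>G\<^esub>" if "c \<in> tensor_relators A B" for c
    using that unfolding tensor_relators_def
  proof (elim UnE CollectE exE conjE)
    fix a a' b
    assume c: "c = frag_of (a \<otimes>\<^bsub>A\<^esub> a', b) - frag_of (a, b) - frag_of (a', b)"
      and in_carrier: "a \<in> carrier A" "a' \<in> carrier A" "b \<in> carrier B"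
    have "H c = H (frag_of (a \<otimes>\<^bsub>A\<^esub> a', b)) \<otimes>\<^bsub>G\<^esub> inv\<^bsub>G\<^esub> H (frag_of (a, b))
        \<otimes>\<^bsub>G\<^esub> inv\<^bsub>G\<^esub> H (frag_of (a', b))"
      unfolding c by (rule H_diff) (use in_carrier in simp_all)
    then show ?thesis
      using in_carrier by (simp add: H_of left comm closed)
  next
    fix a b b'
    assume c: "c = frag_of (a, b \<otimes>\<^bsub>B\<^esub> b') - frag_of (a, b) - frag_of (a, b')"
      and in_carrier: "a \<in> carrier A" "b \<in> carrier B" "b' \<in> carrier B"
    have "H c = H (frag_of (a, b \<otimes>\<^bsub>B\<^esub> b')) \<otimes>\<^bsub>G\<^esub> inv\<^bsub>G\<^esub> H (frag_of (a, b))
        \<otimes>\<^bsub>G\<^esub> inv\<^bsub>G\<^esub> H (frag_of (a, b'))"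
      unfolding c by (rule H_diff) (use in_carrier in simp_all)
    then show ?thesis
      using in_carrier by (simp add: H_of right comm closed)
  qed
  have ker: "H c = \<one>\<^bsub>G\<^esub>" if "c \<in> ?N" for c
  proof -
    have "tensor_relators A B \<subseteq> kernel ?F G H"
      using rel rel_sub by (auto simp: kernel_def simp del: carrier_free_Abelian_group_iff)
    then have "generate ?F (tensor_relators A B) \<subseteq> kernel ?F G H"
      by (intro F.generate_subgroup_incl H.subgroup_kernel)
    then show ?thesis using that by (auto simp: tensor_kernel_def kernel_def)
  qed
  have sub: "subgroup ?N ?F"
    unfolding tensor_kernel_def by (rule F.generate_is_subgroup[OF rel_sub])
  have nor: "?N \<lhd> ?F" by (rule F.subgroup_imp_normal[OF sub])
  have val: "tensor_lift G h (?N #>\<^bsub>?F\<^esub> c) = H c" if "c \<in> carrier ?F" for c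
  proof -
    have "H ` (?N #>\<^bsub>?F\<^esub> c) = {H c}"
    proof -
      have "H (n \<otimes>\<^bsub>?F\<^esub> c) = H c" if "n \<in> ?N" for n
        using \<open>c \<in> carrier ?F\<close> that ker subgroup.mem_carrier[OF sub that]
        by (simp del: mult_free_Abelian_group carrier_free_Abelian_group_iff)
      then show ?thesis
        using subgroup.one_closed[OF sub] unfolding r_coset_def image_UN by force
    qed
    then show ?thesis unfolding tensor_lift_def H_def[symmetric] by simp
  qed
  show "tensor_lift G h \<in> hom (tensor A B) G"
  proof (rule homI)
    fix U assume "U \<in> carrier (tensor A B)"
    then show "tensor_lift G h U \<in> carrier G"
      by (auto simp: tensor_def FactGroup_def RCOSETS_def val
          simp del: carrier_free_Abelian_group_iff)
  next
    fix U V assume "U \<in> carrier (tensor A B)" "V \<in> carrier (tensor A B)"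
    then obtain c d where "c \<in> carrier ?F" "d \<in> carrier ?F"
      "U = ?N #>\<^bsub>?F\<^esub> c" "V = ?N #>\<^bsub>?F\<^esub> d"
      by (auto simp: tensor_def FactGroup_def RCOSETS_def
          simp del: carrier_free_Abelian_group_iff)
    then show "tensor_lift G h (U \<otimes>\<^bsub>tensor A B\<^esub> V) =
        tensor_lift G h U \<otimes>\<^bsub>G\<^esub> tensor_lift G h V"
      by (simp add: tensor_def FactGroup_def normal.rcos_sum[OF nor] val
          del: mult_free_Abelian_group carrier_free_Abelian_group_iff)
  qed
  show "tensor_lift G h (pure_tensor A B a b) = h a b"
    if "a \<in> carrier A" "b \<in> carrier B" for a b
    using that by (simp add: pure_tensor_def val H_of)
qed

subsection \<open>The ring \<open>R = \<int>[t\<^sub>i\<^sub>j]\<close> and the ideal \<open>I\<close>\<close>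

text \<open>Monomials are finitely supported exponent functions on index pairs. The ring \<open>R\<close> is
  \<open>tring\<close> and the ideal \<open>I\<close> is \<open>tideal\<close>.\<close>

type_synonym tpoly = "(nat \<times> nat \<Rightarrow>\<^sub>0 nat) \<Rightarrow>\<^sub>0 int"

definition tvar :: "nat \<Rightarrow> nat \<Rightarrow> tpoly" where
  "tvar i j = Poly_Mapping.single (Poly_Mapping.single (i, j) 1) 1"

abbreviation tring :: "tpoly ring" where
  "tring \<equiv> ring_of_type_algebra"

definition tideal :: "tpoly set" where
  "tideal = Idl\<^bsub>tring\<^esub> {tvar i j | i j. i \<le> j}"

definition tideal_pow :: "nat \<Rightarrow> tpoly set" where
  "tideal_pow k = tideal [^]\<^bsub>ideals_set tring\<^esub> k"

text \<open>The canonical map \<open>R/J \<rightarrow> R/J'\<close> for ideals \<open>J \<subseteq> J'\<close>.\<close>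

definition quot_map :: "tpoly set \<Rightarrow> tpoly set \<Rightarrow> tpoly set" where
  "quot_map J' U = J' <+>\<^bsub>tring\<^esub> U"

subsection \<open>The completion\<close>

abbreviation Rmod :: "nat \<Rightarrow> tpoly set monoid" where
  "Rmod k \<equiv> add_monoid (tring Quot tideal_pow k)"

abbreviation QQ :: "rat monoid" where
  "QQ \<equiv> add_monoid (ring_of_type_algebra :: rat ring)"

text \<open>The inverse limit of the groups \<open>(R/I\<^sup>k) \<otimes> \<rat>\<close>, as a set of compatible families.\<close>

definition completion_Q :: "(nat \<Rightarrow> (tpoly set \<times> rat \<Rightarrow>\<^sub>0 int) set) set" where
  "completion_Q = {L. (\<forall>k. L k \<in> carrier (tensor (Rmod k) QQ)) \<and>
     (\<forall>j k. j \<le> k \<longrightarrow>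
        tensor_lift (tensor (Rmod j) QQ)
          (\<lambda>U q. pure_tensor (Rmod j) QQ (quot_map (tideal_pow j) U) q) (L k) = L j)}"

subsection \<open>\<open>p\<close>-integrality and reduction modulo \<open>p\<close>\<close>

definition Zloc :: "nat \<Rightarrow> rat monoid" where
  "Zloc p = QQ\<lparr>carrier := {q. coprime (snd (quotient_of q)) (int p)}\<rparr>"

text \<open>The map \<open>(R/I\<^sup>s) \<otimes> \<int>\<^sub>(\<^sub>p\<^sub>) \<rightarrow> (R/I\<^sup>s) \<otimes> \<rat>\<close> induced by the inclusion of coefficients;
  injective, since \<open>R/I\<^sup>s\<close> is free.\<close>

definition Zloc_incl ::
    "nat \<Rightarrow> (tpoly set \<times> rat \<Rightarrow>\<^sub>0 int) set \<Rightarrow> (tpoly set \<times> rat \<Rightarrow>\<^sub>0 int) set" where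
  "Zloc_incl s = tensor_lift (tensor (Rmod s) QQ) (pure_tensor (Rmod s) QQ)"

text \<open>An integer representing the residue class modulo \<open>p\<close> of a fraction in \<open>\<int>\<^sub>(\<^sub>p\<^sub>)\<close>.\<close>

definition Zloc_residue :: "nat \<Rightarrow> rat \<Rightarrow> int" where
  "Zloc_residue p q = fst (quotient_of q) * modular_inverse (int p) (snd (quotient_of q))"

definition p_ideal :: "nat \<Rightarrow> tpoly set" where
  "p_ideal p = PIdl\<^bsub>tring\<^esub> (of_nat p)"

definition p_tideal :: "nat \<Rightarrow> nat \<Rightarrow> tpoly set" where
  "p_tideal p s = p_ideal p <+>\<^bsub>tring\<^esub> tideal_pow s"

text \<open>The map \<open>(R/I\<^sup>s) \<otimes> \<int>\<^sub>(\<^sub>p\<^sub>) \<rightarrow> R/(pR + I\<^sup>s)\<close>,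
  \<open>a \<otimes> (u/v) \<mapsto> u v\<^sup>-\<^sup>1 a\<close>.\<close>

definition reduce_mod_p :: "nat \<Rightarrow> nat \<Rightarrow> (tpoly set \<times> rat \<Rightarrow>\<^sub>0 int) set \<Rightarrow> tpoly set" where
  "reduce_mod_p p s =
     tensor_lift (add_monoid (tring Quot p_tideal p s))
       (\<lambda>U q. [Zloc_residue p q] \<cdot>\<^bsub>tring Quot p_tideal p s\<^esub> quot_map (p_tideal p s) U)"

subsection \<open>The differential operator and its determinant modulo \<open>p\<close>\<close>

text \<open>\<open>D\<close> acts on power series over \<open>R\<close>; the sum of the \<open>t\<^sub>i\<^sub>j x\<^sup>i \<partial>\<^sup>j\<close> over all \<open>i\<close> is
  multiplication by a power series after \<open>\<partial>\<^sup>j\<close>. The function \<open>fps_XD\<close> is \<open>x\<partial>\<close>.\<close>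

definition diff_op :: "nat \<Rightarrow> nat \<Rightarrow> (nat \<Rightarrow> int) \<Rightarrow> tpoly fps \<Rightarrow> tpoly fps" where
  "diff_op n m l f =
     foldr (\<lambda>k g. fps_XD g - of_int (l k) * g) [1..<Suc n] f +
     (\<Sum>j\<le>m. Abs_fps (\<lambda>i. tvar i j) * (fps_deriv ^^ j) f)"

text \<open>The subspace of series whose first \<open>p\<close> coefficients vanish modulo \<open>p\<close> is invariant
  under \<open>D\<close>; so \<open>D\<close> acts on the quotient, which is the free \<open>R/pR\<close>-module on
  \<open>1, x, \<dots>, x\<^sup>p\<^sup>-\<^sup>1\<close>.\<close>

lemma diff_op_invariant:
  assumes "\<And>k. k < p \<Longrightarrow> of_nat p dvd fps_nth f k" "a < p"
  shows "of_nat p dvd fps_nth (diff_op n m l f) a"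
proof -
  define P :: "tpoly fps \<Rightarrow> bool" where "P f \<longleftrightarrow> (\<forall>k<p. of_nat p dvd fps_nth f k)" for f
  have deriv: "P (fps_deriv g)" if "P g" for g
    unfolding P_def
  proof (intro allI impI)
    fix k assume k: "k < p"
    show "of_nat p dvd fps_deriv g $ k"
    proof (cases "Suc k = p")
      case True
      then show ?thesis by (simp flip: of_nat_Suc)
    next
      case False
      then have "of_nat p dvd g $ Suc k" using that k by (simp add: P_def)
      then show ?thesis by simp
    qed
  qed
  have mult: "P (h * g)" if "P g" for g h
    using that unfolding P_def fps_mult_nth by (auto intro!: dvd_sum dvd_mult)
  have diff: "P (g - h)" if "P g" "P h" for g h
    using that by (simp add: P_def dvd_diff)
  have add: "P (g + h)" if "P g" "P h" for g h
    using that by (simp add: P_def)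
  have P0: "P 0" by (simp add: P_def)
  have f: "P f" using assms(1) by (simp add: P_def)
  have fold: "P (foldr (\<lambda>k g. fps_XD g - of_int (l k) * g) ks f)" for ks
    by (induction ks) (auto simp: f fps_XD_def intro!: diff mult deriv)
  have pow: "P ((fps_deriv ^^ j) f)" for j
    by (induction j) (auto simp: f deriv)
  have sum: "P (\<Sum>j\<in>J. Abs_fps (\<lambda>i. tvar i j) * (fps_deriv ^^ j) f)" for J :: "nat set"
    by (induction J rule: infinite_finite_induct) (auto simp: P0 intro!: add mult pow)
  have "P (diff_op n m l f)"
    unfolding diff_op_def by (intro add fold sum)
  then show ?thesis using assms(2) by (simp add: P_def)
qed

definition cring_det :: "('a, 'm) ring_scheme \<Rightarrow> nat \<Rightarrow> (nat \<Rightarrow> nat \<Rightarrow> 'a) \<Rightarrow> 'a" where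
  "cring_det S n M =
     (\<Oplus>\<^bsub>S\<^esub>\<sigma>\<in>{\<sigma>. \<sigma> permutes {..<n}}.
        [sign \<sigma>] \<cdot>\<^bsub>S\<^esub> (\<Otimes>\<^bsub>S\<^esub>a\<in>{..<n}. M a (\<sigma> a)))"

text \<open>Column \<open>b\<close> of the matrix lists the coefficients of \<open>D(x\<^sup>b)\<close> at
  \<open>1, x, \<dots>, x\<^sup>p\<^sup>-\<^sup>1\<close>, as elements of \<open>R/pR\<close>.\<close>

definition Det_p :: "nat \<Rightarrow> nat \<Rightarrow> (nat \<Rightarrow> int) \<Rightarrow> nat \<Rightarrow> tpoly set" where
  "Det_p n m l p =
     cring_det (tring Quot p_ideal p) p
       (\<lambda>a b. p_ideal p +>\<^bsub>tring\<^esub> fps_nth (diff_op n m l (fps_X ^ b)) a)"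

end

theory Submission
  imports
    Defs
    "HOL-Number_Theory.Residues"
    "HOL-Computational_Algebra.Polynomial_FPS"
    "Jordan_Normal_Form.Determinant"
begin

text \<open>Over \<open>\<int>\<close> the matrix of \<open>D\<close> is \<open>diag(P(b)) + T\<close> with \<open>P(b) = \<Prod>\<^sub>k (b - l\<^sub>k)\<close>. Let
  \<open>P\<^sup>*(b)\<close> be the product of those factors \<open>b - l\<^sub>k\<close> that are prime to \<open>p\<close>. By Wilson's theorem
  \<open>\<Prod>\<^sub>b P\<^sup>*(b) \<equiv> (-1)\<^sup>n\<close>, so that modulo \<open>p\<close> the determinant is \<open>(-1)\<^sup>n det(1 + X)\<close>, where
  \<open>X = T / P\<^sup>*\<close> minus the projection to the roots of \<open>P\<close>. The coefficients of \<open>det(1 + y X)\<close>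
  are, by Newton's identities, polynomials in the traces of the powers of \<open>X\<close>, and the
  coefficient of a monomial in such a trace is a sum over \<open>b \<in> \<int>/p\<close> of the values of a rational
  function with integral poles, altered at finitely many integral points. By partial fractions and
  the vanishing of small power sums modulo \<open>p\<close>, such a sum is the residue of a rational number
  that does not depend on \<open>p\<close>, provided that \<open>p\<close> exceeds the distances of the poles and the degrees.
  All contributing monomials have weight \<open>\<Sum> (i - j) = 0\<close> and \<open>j \<le> m\<close>; their degree and the
  weights of their divisors are therefore bounded by a multiple of the degree in the generators of
  \<open>I\<close>, and so is the bound on \<open>p\<close>.\<close>

subsection \<open>Residues of rational numbers\<close>

text \<open>The matrix has size p, so its determinant gets more and more terms as p grows, whereas a
  trace of a power of X is a single sum over b. The price of Newton's identities is a division by k,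
  which p must not divide.

  The range of k has to be bounded independently of p as well. Making the diagonal invertible costs
  a correction in at most n diagonal entries, so the coefficient of y^k at a monomial of degree d is
  zero for k > d + n.

  The matrix is cut off at 0 and p: a path of basis vectors may not leave this range and return. The
  cut-off destroys translation invariance; it is expressed by point masses at integers c of small
  absolute value, the upper end being represented by c = b - p.

  For a monomial of degree e >= 1 in the generators of I all bounds on p together have the form K e
  < p. With C = 1/K and s = ceil(p/K) they hold for every monomial with e < s. The monomial 1 has e
  = 0 and is treated apart: its coefficient is divisible by p because n >= 1, and L has no constant
  term.\<close>

text \<open>The integers \<open>x p\<close> are, for all primes \<open>p > N\<close>, the residues of the single fraction \<open>u / v\<close>.\<close>

definition uniform :: "nat \<Rightarrow> (nat \<Rightarrow> int) \<Rightarrow> bool" where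
  "uniform N x \<longleftrightarrow> (\<exists>u v::int. v \<noteq> 0 \<and>
     (\<forall>p. prime p \<longrightarrow> N < p \<longrightarrow> \<not> int p dvd v \<and> [v * x p = u] (mod int p)))"

lemma uniformI:
  assumes "v \<noteq> 0"
    and "\<And>p. prime p \<Longrightarrow> N < p \<Longrightarrow> \<not> int p dvd v \<and> [v * x p = u] (mod int p)"
  shows "uniform N x"
  using assms unfolding uniform_def by blast

lemma uniform_cong:
  assumes "uniform N x" and "\<And>p. prime p \<Longrightarrow> N < p \<Longrightarrow> [x p = y p] (mod int p)"
  shows "uniform N y"
proof -
  obtain u v where v: "v \<noteq> 0"
    and uv: "\<And>p. prime p \<Longrightarrow> N < p \<Longrightarrow> \<not> int p dvd v \<and> [v * x p = u] (mod int p)"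
    using assms(1) unfolding uniform_def by blast
  have "[v * y p = u] (mod int p)" if "prime p" "N < p" for p
    using cong_trans[OF cong_mult[OF cong_refl cong_sym[OF assms(2)[OF that]]]] uv[OF that] by blast
  then show ?thesis using v uv by (auto intro: uniformI)
qed

lemma uniform_const [simp, intro]: "uniform N (\<lambda>p. c)"
  by (rule uniformI[of 1 _ _ c]) (auto dest: prime_gt_1_nat)

lemma uniform_add [intro]:
  assumes "uniform N x" "uniform N y"
  shows "uniform N (\<lambda>p. x p + y p)"
proof -
  obtain u v where v: "v \<noteq> 0"
    and uv: "\<And>p. prime p \<Longrightarrow> N < p \<Longrightarrow> \<not> int p dvd v \<and> [v * x p = u] (mod int p)"
    using assms(1) unfolding uniform_def by blast
  obtain u' v' where v': "v' \<noteq> 0"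
    and uv': "\<And>p. prime p \<Longrightarrow> N < p \<Longrightarrow> \<not> int p dvd v' \<and> [v' * y p = u'] (mod int p)"
    using assms(2) unfolding uniform_def by blast
  show ?thesis
  proof (rule uniformI[of "v * v'" _ _ "u * v' + u' * v"])
    fix p :: nat assume p: "prime p" "N < p"
    have "[v' * (v * x p) + v * (v' * y p) = v' * u + v * u'] (mod int p)"
      using uv[OF p] uv'[OF p] by (intro cong_add cong_mult cong_refl) auto
    then show "\<not> int p dvd v * v' \<and> [v * v' * (x p + y p) = u * v' + u' * v] (mod int p)"
      using uv[OF p] uv'[OF p] p by (auto simp: algebra_simps prime_dvd_mult_iff)
  qed (use v v' in auto)
qed

lemma uniform_mult [intro]:
  assumes "uniform N x" "uniform N y"
  shows "uniform N (\<lambda>p. x p * y p)"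
proof -
  obtain u v where v: "v \<noteq> 0"
    and uv: "\<And>p. prime p \<Longrightarrow> N < p \<Longrightarrow> \<not> int p dvd v \<and> [v * x p = u] (mod int p)"
    using assms(1) unfolding uniform_def by blast
  obtain u' v' where v': "v' \<noteq> 0"
    and uv': "\<And>p. prime p \<Longrightarrow> N < p \<Longrightarrow> \<not> int p dvd v' \<and> [v' * y p = u'] (mod int p)"
    using assms(2) unfolding uniform_def by blast
  show ?thesis
  proof (rule uniformI[of "v * v'" _ _ "u * u'"])
    fix p :: nat assume p: "prime p" "N < p"
    have "[(v * x p) * (v' * y p) = u * u'] (mod int p)"
      using uv[OF p] uv'[OF p] by (intro cong_mult) auto
    then show "\<not> int p dvd v * v' \<and> [v * v' * (x p * y p) = u * u'] (mod int p)"
      using uv[OF p] uv'[OF p] p by (auto simp: algebra_simps prime_dvd_mult_iff)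
  qed (use v v' in auto)
qed

text \<open>The index set must be the same for all primes. Sums over b < p are out of its reach; for
  them there is \<open>rational_family_uniform_sum\<close>.\<close>

lemma uniform_sum [intro]:
  "(\<And>i. i \<in> S \<Longrightarrow> uniform N (x i)) \<Longrightarrow> uniform N (\<lambda>p. \<Sum>i\<in>S. x i p)"
  by (induction S rule: infinite_finite_induct) auto

lemma uniform_power: "uniform N x \<Longrightarrow> uniform N (\<lambda>p. x p ^ k)"
  by (induction k) auto

text \<open>The denominator \<open>v\<close> becomes \<open>v * k\<close>, still prime to every p >
  \<open>N\<close>. This serves the division by k in Newton's identities and the evaluation 1/(d -
  c) of a simple pole.\<close>

lemma uniform_divide:
  assumes "uniform N (\<lambda>p. k * x p)" and "k \<noteq> 0"
    and "\<And>p. prime p \<Longrightarrow> N < p \<Longrightarrow> \<not> int p dvd k"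
  shows "uniform N x"
proof -
  obtain u v where v: "v \<noteq> 0"
    and uv: "\<And>p. prime p \<Longrightarrow> N < p \<Longrightarrow> \<not> int p dvd v \<and> [v * (k * x p) = u] (mod int p)"
    using assms(1) unfolding uniform_def by blast
  show ?thesis
    using uv assms(2,3) v
    by (intro uniformI[of "v * k" _ _ u]) (auto simp: mult.assoc prime_dvd_mult_iff)
qed

lemma dvd_power_pos: "a dvd x \<Longrightarrow> 0 < k \<Longrightarrow> a dvd x ^ k" for a x :: int
  by (rule dvd_trans[OF _ dvd_power]) auto

lemma dvd_int_less:
  assumes "\<bar>k\<bar> < int p" "int p dvd k"
  shows "k = 0"
  using assms dvd_imp_le_int[of k "int p"] by linarith

subsection \<open>Power sums and partial fractions modulo a prime\<close>

definition mdelta :: "nat \<Rightarrow> int \<Rightarrow> int \<Rightarrow> int" where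
  "mdelta p c b = (if int p dvd b - c then 1 else 0)"

text \<open>The inverse of \<open>b - c\<close> modulo \<open>p\<close>, with value \<open>0\<close> at \<open>b \<equiv> c\<close> (if \<open>p > 2\<close>).\<close>

definition minv :: "nat \<Rightarrow> int \<Rightarrow> int \<Rightarrow> int" where
  "minv p c b = (b - c) ^ (p - 2)"

text \<open>Fermat's little theorem, as the product is \<open>(b - c) ^ (p - 1)\<close>; the term
  \<open>mdelta\<close> accounts for the class of c, where this power is 0.\<close>

lemma minv_mult:
  assumes "prime p" "2 < p"
  shows "[(b - c) * minv p c b = 1 - mdelta p c b] (mod int p)"
proof -
  have e: "(b - c) * minv p c b = (b - c) ^ (p - 1)"
    using assms by (simp add: minv_def flip: power_Suc) (simp add: numeral_2_eq_2 Suc_diff_Suc)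
  show ?thesis
  proof (cases "int p dvd b - c")
    case True
    then have "int p dvd (b - c) ^ (p - 1)"
      using assms by (intro dvd_power_pos) auto
    then show ?thesis using e True by (simp add: mdelta_def cong_0_iff)
  next
    case False
    have "[(b - c) ^ (p - 1) = 1] (mod int p)"
    proof -
      have "\<not> p dvd nat ((b - c) mod p)"
        using False assms by (simp add: dvd_nat_abs_iff dvd_mod_iff flip: int_dvd_int_iff)
      then have "[nat ((b - c) mod p) ^ (p - 1) = 1] (mod p)"
        using fermat_theorem assms by blast
      then have "[int (nat ((b - c) mod p)) ^ (p - 1) = 1] (mod int p)"
        by (metis cong_int_iff of_nat_1 of_nat_power)
      moreover have "int (nat ((b - c) mod p)) = (b - c) mod p"
        using assms by simp
      ultimately show ?thesis
        by (simp add: cong_def power_mod)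
    qed
    then show ?thesis using False e by (simp add: mdelta_def)
  qed
qed

lemma minv_zero:
  assumes "2 < p" "int p dvd b - c"
  shows "int p dvd minv p c b"
  using assms by (simp add: minv_def dvd_power_pos)

lemma mdelta_mult_diff: "[mdelta p c b * (b - c) = 0] (mod int p)"
  by (auto simp: mdelta_def cong_0_iff)

lemma cong_prime_cancel:
  assumes "prime p" and "\<not> int p dvd a" and "[a * x = a * y] (mod int p)"
  shows "[x = y] (mod int p)"
proof -
  have "coprime a (int p)"
    using assms(2) prime_imp_coprime[of "int p" a] assms(1) by (simp add: coprime_commute)
  then show ?thesis using assms(3) by (simp add: cong_mult_lcancel)
qed

text \<open>Away from c and d this is 1/((b-c)(b-d)) = u (1/(b-c) - 1/(b-d)), where u =
  \<open>minv p d c\<close> is the inverse of c - d. At b \<equiv> c and at b \<equiv> d the left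
  side is 0 and the difference contributes -u^2, which the point masses cancel.\<close>

lemma minv_partial_fractions:
  assumes p: "prime p" "2 < p" and cc: "\<not> int p dvd c - d"
  shows "[minv p c b * minv p d b =
    minv p d c * (minv p c b - minv p d b) + (minv p d c)^2 * (mdelta p c b + mdelta p d b)] (mod int p)"
proof -
  define u where "u = minv p d c"
  have u: "[(c - d) * u = 1] (mod int p)"
    using minv_mult[OF p, of c d] cc by (simp add: u_def mdelta_def)
  let ?i = "minv p c b" and ?j = "minv p d b" and ?x = "mdelta p c b" and ?y = "mdelta p d b"
  consider "int p dvd b - c" | "int p dvd b - d" | "\<not> int p dvd b - c" "\<not> int p dvd b - d" by blast
  then show ?thesis
  proof cases
    case 1
    have nd: "\<not> int p dvd b - d"
    proof
      assume "int p dvd b - d"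
      then have "int p dvd (b - d) - (b - c)" using 1 by (rule dvd_diff)
      moreover have "(b - d) - (b - c) = c - d" by simp
      ultimately show False using cc by metis
    qed
    have i: "[?i = 0] (mod int p)" using minv_zero[OF p(2) 1] by (simp add: cong_0_iff)
    have j: "[?j = u] (mod int p)"
      unfolding u_def minv_def using 1 by (intro cong_pow) (simp add: cong_iff_dvd_diff)
    have "[?i * ?j = 0 * u] (mod int p)" using i j by (rule cong_mult)
    moreover have "[u * (?i - ?j) + u^2 * (?x + ?y) = u * (0 - u) + u^2 * (1 + 0)] (mod int p)"
      using i j 1 nd by (intro cong_add cong_mult cong_diff cong_refl) (simp_all add: mdelta_def)
    ultimately show ?thesis unfolding u_def[symmetric]
      by (simp add: power2_eq_square cong_def)
  next
    case 2
    have nd: "\<not> int p dvd b - c"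
    proof
      assume "int p dvd b - c"
      with 2 have "int p dvd (b - d) - (b - c)" by (rule dvd_diff)
      moreover have "(b - d) - (b - c) = c - d" by simp
      ultimately show False using cc by metis
    qed
    have j: "[?j = 0] (mod int p)" using minv_zero[OF p(2) 2] by (simp add: cong_0_iff)
    have "[(d - c) * ?i = (b - c) * ?i] (mod int p)"
      using 2 by (intro cong_mult cong_refl) (simp add: cong_iff_dvd_diff dvd_diff_commute)
    moreover have "[(b - c) * ?i = 1] (mod int p)"
      using minv_mult[OF p, of b c] nd by (simp add: mdelta_def)
    moreover have "[1 = (d - c) * (- u)] (mod int p)"
      using u by (metis cong_sym minus_diff_eq minus_mult_minus)
    ultimately have "[(d - c) * ?i = (d - c) * (- u)] (mod int p)"
      using cong_trans by blast
    then have i: "[?i = - u] (mod int p)"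
      using cc cong_prime_cancel[OF p(1), of "d - c" "?i" "- u"] by (simp add: dvd_diff_commute)
    have "[?i * ?j = (-u) * 0] (mod int p)" using i j by (rule cong_mult)
    moreover have "[u * (?i - ?j) + u^2 * (?x + ?y) = u * (- u - 0) + u^2 * (0 + 1)] (mod int p)"
      using i j 2 nd by (intro cong_add cong_mult cong_diff cong_refl) (simp_all add: mdelta_def)
    ultimately show ?thesis unfolding u_def[symmetric]
      by (simp add: power2_eq_square cong_def)
  next
    case 3
    have i: "[(b - c) * ?i = 1] (mod int p)" using minv_mult[OF p, of b c] 3 by (simp add: mdelta_def)
    have j: "[(b - d) * ?j = 1] (mod int p)" using minv_mult[OF p, of b d] 3 by (simp add: mdelta_def)
    have "[((b - c) * ?i) * ((b - d) * ?j) = 1 * 1] (mod int p)" using i j by (rule cong_mult)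
    moreover have "[u * ((b - d) * ((b - c) * ?i) - (b - c) * ((b - d) * ?j)) = u * ((b - d) * 1 - (b - c) * 1)] (mod int p)"
      using i j by (intro cong_mult cong_diff cong_refl)
    moreover have "u * ((b - d) * 1 - (b - c) * 1) = (c - d) * u" by (simp add: algebra_simps)
    ultimately have "[((b - c) * ?i) * ((b - d) * ?j) = u * ((b - d) * ((b - c) * ?i) - (b - c) * ((b - d) * ?j))] (mod int p)"
      using u by (metis cong_sym cong_trans mult_1)
    moreover have "((b - c) * ?i) * ((b - d) * ?j) = ((b - c) * (b - d)) * (?i * ?j)" by (simp add: algebra_simps)
    moreover have "u * ((b - d) * ((b - c) * ?i) - (b - c) * ((b - d) * ?j)) = ((b - c) * (b - d)) * (u * (?i - ?j))"
      by (simp add: algebra_simps)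
    ultimately have "[((b - c) * (b - d)) * (?i * ?j) = ((b - c) * (b - d)) * (u * (?i - ?j))] (mod int p)"
      by simp
    moreover have "\<not> int p dvd (b - c) * (b - d)"
      using 3 p by (simp add: prime_dvd_mult_iff)
    ultimately have "[?i * ?j = u * (?i - ?j)] (mod int p)"
      by (rule cong_prime_cancel[OF p(1), rotated])
    then show ?thesis using 3 by (simp add: mdelta_def u_def)
  qed
qed

section \<open>Vanishing of power sums over a complete residue system\<close>

text \<open>Summing (b+1)^(k+1) - b^(k+1) over b < p telescopes to p^(k+1). By the binomial theorem
  the same sum is k+1 times the k-th power sum plus multiples of lower ones, and k+1 < p is
  invertible modulo p.\<close>

lemma power_sum_dvd:
  assumes "prime p" "k + 1 < p"
  shows "int p dvd (\<Sum>b<p. (int b) ^ k)"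
  using assms(2)
proof (induction k rule: less_induct)
  case (less k)
  have "(\<Sum>b<p. (int b + 1) ^ (k+1) - (int b) ^ (k+1)) = int p ^ (k+1)"
    using sum_lessThan_telescope[of "\<lambda>b. int b ^ (k+1)" p] by (simp add: add.commute)
  moreover have "(int b + 1) ^ (k+1) - (int b) ^ (k+1) = (\<Sum>i\<le>k. of_nat ((k+1) choose i) * int b ^ i)" for b
    by (subst binomial_ring) simp
  ultimately have "int p ^ (k+1) = (\<Sum>b<p. \<Sum>i\<le>k. of_nat ((k+1) choose i) * int b ^ i)" by simp
  also have "\<dots> = (\<Sum>i\<le>k. of_nat ((k+1) choose i) * (\<Sum>b<p. int b ^ i))"
    by (subst sum.swap) (simp add: sum_distrib_left)
  also have "\<dots> = (\<Sum>i<k. of_nat ((k+1) choose i) * (\<Sum>b<p. int b ^ i)) + int (k+1) * (\<Sum>b<p. int b ^ k)"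
    by (simp add: lessThan_Suc_atMost[symmetric])
  finally have e: "int (k+1) * (\<Sum>b<p. int b ^ k) = int p ^ (k+1) - (\<Sum>i<k. of_nat ((k+1) choose i) * (\<Sum>b<p. int b ^ i))"
    by simp
  have "int p dvd (\<Sum>i<k. of_nat ((k+1) choose i) * (\<Sum>b<p. int b ^ i))"
    using less by (intro dvd_sum[OF dvd_mult]) auto
  then have "int p dvd int (k+1) * (\<Sum>b<p. int b ^ k)"
    unfolding e by (intro dvd_diff) auto
  moreover have "\<not> int p dvd int (k+1)"
    using less.prems by (metis int_dvd_int_iff nat_dvd_not_less zero_less_Suc Suc_eq_plus1)
  ultimately show ?case using assms(1) by (auto simp: prime_dvd_mult_iff)
qed

lemma shifted_power_sum_dvd:
  assumes "prime p" "k + 1 < p"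
  shows "int p dvd (\<Sum>b<p. (int b - c) ^ k)"
proof -
  have "(\<Sum>b<p. (int b - c) ^ k) = (\<Sum>b<p. \<Sum>i\<le>k. of_nat (k choose i) * int b ^ i * (- c) ^ (k - i))"
    by (simp add: binomial_ring flip: add_uminus_conv_diff)
  also have "\<dots> = (\<Sum>i\<le>k. (of_nat (k choose i) * (- c) ^ (k - i)) * (\<Sum>b<p. int b ^ i))"
    by (subst sum.swap) (simp add: sum_distrib_left algebra_simps)
  finally show ?thesis
    using power_sum_dvd[OF assms(1)] assms(2) by (auto intro!: dvd_sum[OF dvd_mult])
qed

text \<open>By Fermat the summand is congruent to (b-c)^(p-1-k). The bounds on k put this exponent
  between 1 and p-2: positive, so that both sides vanish at b \<equiv> c, and small enough for the
  power sum to vanish.\<close>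

lemma minv_power_sum_dvd:
  assumes p: "prime p" and k: "1 \<le> k" "k + 1 < p"
  shows "int p dvd (\<Sum>b<p. minv p c (int b) ^ k)"
proof -
  have "[minv p c b ^ k = (b - c) ^ (p - 1 - k)] (mod int p)" for b
  proof (cases "int p dvd b - c")
    case True
    then have "int p dvd minv p c b ^ k"
      using k minv_zero[of p b c] by (intro dvd_power_pos) auto
    moreover have "int p dvd (b - c) ^ (p - 1 - k)" using True k by (intro dvd_power_pos) auto
    ultimately show ?thesis by (simp add: cong_iff_dvd_diff)
  next
    case False
    have p2: "2 < p" using k by simp
    have m: "[(b - c) * minv p c b = 1] (mod int p)"
      using minv_mult[OF p p2, of b c] False by (simp add: mdelta_def)
    have "[((b - c) * minv p c b) ^ k = 1 ^ k] (mod int p)" using m by (rule cong_pow)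
    then have 1: "[(b - c) ^ k * minv p c b ^ k = 1] (mod int p)" by (simp add: power_mult_distrib)
    have "(b - c) ^ k * (b - c) ^ (p - 1 - k) = (b - c) * minv p c b"
      using k by (simp add: minv_def flip: power_add power_Suc) (simp add: numeral_2_eq_2 Suc_diff_Suc)
    then have "[(b - c) ^ k * minv p c b ^ k = (b - c) ^ k * (b - c) ^ (p - 1 - k)] (mod int p)"
      using 1 m by (metis cong_sym cong_trans)
    moreover have "\<not> int p dvd (b - c) ^ k" using False p prime_dvd_power[of "int p"] by auto
    ultimately show ?thesis using cong_prime_cancel[OF p] by blast
  qed
  then have "[(\<Sum>b<p. minv p c (int b) ^ k) = (\<Sum>b<p. (int b - c) ^ (p - 1 - k))] (mod int p)"
    by (intro cong_sum)
  moreover have "int p dvd (\<Sum>b<p. (int b - c) ^ (p - 1 - k))"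
    using k p by (intro shifted_power_sum_dvd) auto
  ultimately show ?thesis by (simp add: cong_dvd_iff)
qed

lemma mdelta_sum:
  assumes "p > 0"
  shows "(\<Sum>b<p. mdelta p c (int b)) = 1"
proof -
  have "mdelta p c (int b) = (if b = nat (c mod p) then 1 else 0)" if "b < p" for b
  proof -
    have "int p dvd int b - c \<longleftrightarrow> int b mod int p = c mod int p"
      by (rule mod_eq_dvd_iff[symmetric])
    also have "int b mod int p = int b" using that by simp
    also have "int b = c mod int p \<longleftrightarrow> b = nat (c mod int p)"
      using assms by (metis nat_int nat_0_le pos_mod_sign of_nat_0_less_iff)
    finally show ?thesis by (simp add: mdelta_def)
  qed
  then have "(\<Sum>b<p. mdelta p c (int b)) = (\<Sum>b<p. if b = nat (c mod p) then 1 else 0)"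
    by (intro sum.cong) auto
  also have "\<dots> = 1" using assms by (simp add: nat_less_iff)
  finally show ?thesis .
qed

subsection \<open>Families of rational functions\<close>

text \<open>The generators are the terms of a partial fraction decomposition, with coefficients that
  are \<open>uniform\<close> in p, so that sums over b can be read off; closure under products is
  then a theorem. \<open>r\<close> bounds the poles and exceptional points, \<open>s\<close> the
  degrees and pole orders. The rule \<open>cong\<close> makes membership a matter of residues modulo
  the primes above \<open>N\<close> only.\<close>

inductive rational_family :: "nat \<Rightarrow> nat \<Rightarrow> nat \<Rightarrow> (nat \<Rightarrow> int \<Rightarrow> int) \<Rightarrow> bool"
  for N r s where
  monomial: "uniform N x \<Longrightarrow> k \<le> s \<Longrightarrow> rational_family N r s (\<lambda>p b. x p * b ^ k)"
| pole: "uniform N x \<Longrightarrow> 1 \<le> k \<Longrightarrow> k \<le> s \<Longrightarrow> \<bar>c\<bar> \<le> int r \<Longrightarrow>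
    rational_family N r s (\<lambda>p b. x p * minv p c b ^ k)"
| point: "uniform N x \<Longrightarrow> \<bar>c\<bar> \<le> int r \<Longrightarrow> rational_family N r s (\<lambda>p b. x p * mdelta p c b)"
| add: "rational_family N r s f \<Longrightarrow> rational_family N r s g \<Longrightarrow>
    rational_family N r s (\<lambda>p b. f p b + g p b)"
| cong: "rational_family N r s f \<Longrightarrow>
    (\<And>p b. prime p \<Longrightarrow> N < p \<Longrightarrow> [f p b = g p b] (mod int p)) \<Longrightarrow> rational_family N r s g"

lemma rational_family_mono:
  assumes "rational_family N r s f" "s \<le> s'" "r \<le> r'"
  shows "rational_family N r' s' f"
  using assms
proof (induction rule: rational_family.induct)
  case (cong f g) then show ?case using rational_family.cong by blast
next
  case (add f g) then show ?case using rational_family.add by blast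
qed (auto intro!: rational_family.monomial rational_family.pole rational_family.point)

lemma rational_family_scale:
  assumes "rational_family N r s f" "uniform N y"
  shows "rational_family N r s (\<lambda>p b. y p * f p b)"
  using assms
proof (induction rule: rational_family.induct)
  case (monomial x k)
  then show ?case using rational_family.monomial[of N "\<lambda>p. y p * x p" k] by (simp add: uniform_mult mult.assoc)
next
  case (pole x k c)
  then show ?case using rational_family.pole[of N "\<lambda>p. y p * x p" k] by (simp add: uniform_mult mult.assoc)
next
  case (point x c)
  then show ?case using rational_family.point[of N "\<lambda>p. y p * x p" c] by (simp add: uniform_mult mult.assoc)
next
  case (add f g)
  then show ?case using rational_family.add by (simp add: distrib_left)
next
  case (cong f g)
  show ?case
    by (rule rational_family.cong[OF cong.IH[OF cong.prems]]) (use cong.hyps in \<open>auto intro: cong_mult\<close>)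
qed

lemma rational_family_const: "uniform N x \<Longrightarrow> rational_family N r s (\<lambda>p b. x p)"
  using rational_family.monomial[of N x 0 s r] by simp

lemma rational_family_zero: "rational_family N r s (\<lambda>p b. 0)"
  by (rule rational_family_const) simp

lemma rational_family_id: "1 \<le> s \<Longrightarrow> rational_family N r s (\<lambda>p b. b)"
  using rational_family.monomial[of N "\<lambda>p. 1" 1 s r] by simp

lemma rational_family_minv:
  "1 \<le> s \<Longrightarrow> \<bar>c\<bar> \<le> int r \<Longrightarrow> rational_family N r s (\<lambda>p. minv p c)"
  using rational_family.pole[of N "\<lambda>p. 1" 1 s c r] by simp

lemma rational_family_mdelta:
  "\<bar>c\<bar> \<le> int r \<Longrightarrow> rational_family N r s (\<lambda>p. mdelta p c)"
  using rational_family.point[of N "\<lambda>p. 1" c r s] by simp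

lemma rational_family_sum:
  "(\<And>i. i \<in> S \<Longrightarrow> rational_family N r s (f i)) \<Longrightarrow> rational_family N r s (\<lambda>p b. \<Sum>i\<in>S. f i p b)"
  by (induction S rule: infinite_finite_induct) (auto intro: rational_family_zero rational_family.add)

lemma rational_family_diff:
  "rational_family N r s f \<Longrightarrow> rational_family N r s g \<Longrightarrow> rational_family N r s (\<lambda>p b. f p b - g p b)"
  using rational_family.add[OF _ rational_family_scale[of N r s g "\<lambda>p. -1"]] by simp

lemma rational_family_periodic:
  assumes "rational_family N r s f" "prime p" "N < p" "[b = b'] (mod int p)"
  shows "[f p b = f p b'] (mod int p)"
  using assms
proof (induction rule: rational_family.induct)
  case (point x c)
  have "int p dvd b - c \<longleftrightarrow> int p dvd b' - c"
    using point.prems(3) by (meson cong_diff cong_dvd_iff cong_refl)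
  then show ?case by (simp add: mdelta_def)
next
  case (cong f g)
  then show ?case by (meson cong_sym cong_trans)
qed (auto simp: minv_def intro!: cong_add cong_mult cong_pow cong_diff)

section \<open>Products of rational families and their sums over residues\<close>

context
  fixes N r :: nat
  assumes N: "2 * r \<le> N" "2 \<le> N"
begin

text \<open>This is the purpose of \<open>2 * r \<le> N\<close>: distinct integers in the range from
  -r to r stay distinct modulo every p > N.\<close>

lemma not_dvd_diff:
  assumes "N < p" "\<bar>c\<bar> \<le> int r" "\<bar>d\<bar> \<le> int r" "c \<noteq> d"
  shows "\<not> int p dvd c - d"
proof -
  have "\<bar>c - d\<bar> < int p" using assms N by linarith
  then show ?thesis using assms dvd_int_less[of "c - d" p] by auto
qed

lemma uniform_minv:
  assumes "\<bar>c\<bar> \<le> int r" "\<bar>d\<bar> \<le> int r"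
  shows "uniform N (\<lambda>p. minv p c d)"
proof (cases "c = d")
  case True
  show ?thesis
    by (rule uniform_cong[of _ "\<lambda>p. 0"]) (use N True minv_zero[of _ d c] in \<open>auto simp: cong_0_iff cong_sym_eq[of 0]\<close>)
next
  case False
  have "uniform N (\<lambda>p. (d - c) * minv p c d)"
  proof (rule uniform_cong[of _ "\<lambda>p. 1"])
    fix p :: nat assume p: "prime p" "N < p"
    show "[1 = (d - c) * minv p c d] (mod int p)"
      using minv_mult[of p d c] p N not_dvd_diff[OF p(2) assms(2,1)] False
      by (simp add: mdelta_def cong_sym_eq)
  qed simp
  then show ?thesis
    by (rule uniform_divide) (use False not_dvd_diff[OF _ assms(2,1)] in auto)
qed

lemma uniform_mdelta:
  assumes "\<bar>c\<bar> \<le> int r" "\<bar>d\<bar> \<le> int r"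
  shows "uniform N (\<lambda>p. mdelta p c d)"
  by (rule uniform_cong[of _ "\<lambda>p. if c = d then 1 else 0"])
    (use not_dvd_diff[OF _ assms(2,1)] in \<open>auto simp: mdelta_def\<close>)

lemma rational_family_eval:
  assumes "rational_family N r s f" "\<bar>c\<bar> \<le> int r"
  shows "uniform N (\<lambda>p. f p c)"
  using assms
proof (induction rule: rational_family.induct)
  case (cong f g) then show ?case by (auto intro: uniform_cong)
qed (auto intro!: uniform_mult uniform_add uniform_power uniform_minv uniform_mdelta)

text \<open>By periodicity \<open>f p b\<close> may be replaced by \<open>f p c\<close> on the class
  of c. The product is again a point mass, which has no degree; hence \<open>s'\<close> is
  arbitrary.\<close>

lemma rational_family_mult_mdelta:
  assumes "rational_family N r s f" "\<bar>c\<bar> \<le> int r"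
  shows "rational_family N r s' (\<lambda>p b. mdelta p c b * f p b)"
proof (rule rational_family.cong[OF rational_family.point[OF rational_family_eval[OF assms] assms(2)]])
  fix p :: nat and b :: int assume p: "prime p" "N < p"
  show "[f p c * mdelta p c b = mdelta p c b * f p b] (mod int p)"
    using rational_family_periodic[OF assms(1) p, of c b]
    by (auto simp: mdelta_def cong_iff_dvd_diff dvd_diff_commute)
qed

text \<open>A pole is treated by b/(b-c)^k = c/(b-c)^k + 1/(b-c)^(k-1). For k = 1 the last term is
  the constant 1, although the left side is 0 at b \<equiv> c; the point mass subtracted in the
  proof repairs this.\<close>

lemma rational_family_mult_id:
  assumes "rational_family N r s f"
  shows "rational_family N r (Suc s) (\<lambda>p b. b * f p b)"
  using assms
proof (induction rule: rational_family.induct)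
  case (monomial x k)
  then show ?case using rational_family.monomial[of N x "Suc k" "Suc s" r] by (simp add: mult.left_commute)
next
  case (pole x k c)
  obtain j where k: "k = Suc j" using pole by (cases k) auto
  have j: "rational_family N r (Suc s) (\<lambda>p b. x p * minv p c b ^ j)"
    using pole k rational_family_const[of N x r "Suc s"] rational_family.pole[of N x j "Suc s" c r]
    by (cases j) (auto simp del: power_Suc)
  have d: "rational_family N r (Suc s) (\<lambda>p b. x p * minv p c b ^ j - mdelta p c b * (x p * minv p c b ^ j))"
    by (rule rational_family_diff[OF j rational_family_mult_mdelta[OF j pole(4)]])
  have e: "rational_family N r (Suc s) (\<lambda>p b. (c * x p) * minv p c b ^ k)"
    using pole by (intro rational_family.pole uniform_mult) auto
  show ?case
  proof (rule rational_family.cong[OF rational_family.add[OF e d]])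
    fix p :: nat and b :: int assume p: "prime p" "N < p"
    have "[(b - c) * minv p c b = 1 - mdelta p c b] (mod int p)"
      using minv_mult p N by auto
    then have "[(x p * minv p c b ^ j) * (1 - mdelta p c b) = (x p * minv p c b ^ j) * ((b - c) * minv p c b)] (mod int p)"
      by (intro cong_mult cong_refl) (simp add: cong_sym_eq)
    then have "[(c * x p) * minv p c b ^ k + (x p * minv p c b ^ j) * (1 - mdelta p c b) =
       (c * x p) * minv p c b ^ k + (x p * minv p c b ^ j) * ((b - c) * minv p c b)] (mod int p)"
      by (intro cong_add cong_refl)
    then show "[c * x p * minv p c b ^ k + (x p * minv p c b ^ j - mdelta p c b * (x p * minv p c b ^ j)) =
       b * (x p * minv p c b ^ k)] (mod int p)"
      by (simp add: k algebra_simps)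
  qed
next
  case (point x c)
  show ?case
    by (rule rational_family.cong[OF rational_family.point[of N "\<lambda>p. c * x p" c]])
      (use point mdelta_mult_diff[of _ c] in \<open>auto simp: mdelta_def cong_iff_dvd_diff dvd_diff_commute
        simp flip: left_diff_distrib intro!: dvd_mult2 uniform_mult\<close>)
next
  case (add f g)
  then show ?case using rational_family.add by (simp add: distrib_left)
next
  case (cong f g)
  show ?case
    by (rule rational_family.cong[OF cong.IH]) (use cong.hyps in \<open>auto intro: cong_mult\<close>)
qed

text \<open>For c = d this is a pole of order k+1. Otherwise one partial fraction step reduces the
  exponent k+1 at d to k: the product becomes a combination of the product with exponent k, a pole
  at d alone, and point masses.\<close>

lemma rational_family_minv_minv:
  assumes "\<bar>c\<bar> \<le> int r" "\<bar>d\<bar> \<le> int r"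
  shows "rational_family N r (Suc k) (\<lambda>p b. minv p c b * minv p d b ^ k)"
proof (cases "c = d")
  case True
  then show ?thesis using rational_family.pole[of N "\<lambda>p. 1" "Suc k" "Suc k" d r] assms by simp
next
  case False
  show ?thesis
  proof (induction k)
    case 0
    then show ?case using rational_family_minv assms by simp
  next
    case (Suc k)
    have u: "uniform N (\<lambda>p. minv p d c)" using assms by (rule uniform_minv[rotated])
    have 1: "rational_family N r (Suc (Suc k)) (\<lambda>p b. minv p d c * (minv p c b * minv p d b ^ k))"
      by (rule rational_family_scale[OF rational_family_mono[OF Suc] u]) auto
    have 2: "rational_family N r (Suc (Suc k)) (\<lambda>p b. minv p d c * minv p d b ^ Suc k)"
      by (rule rational_family.pole) (use u assms in auto)
    have 3: "rational_family N r (Suc (Suc k)) (\<lambda>p b. minv p d b ^ k)"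
      using rational_family.pole[of N "\<lambda>p. 1" k "Suc (Suc k)" d r] rational_family_const[of N "\<lambda>p. 1"] assms
      by (cases k) auto
    have 4: "rational_family N r (Suc (Suc k)) (\<lambda>p b. (minv p d c)^2 * (mdelta p c b * minv p d b ^ k + mdelta p d b * minv p d b ^ k))"
      by (intro rational_family_scale rational_family.add rational_family_mult_mdelta[OF 3] assms uniform_power u)
    show ?case
    proof (rule rational_family.cong[OF rational_family.add[OF rational_family_diff[OF 1 2] 4]])
      fix p :: nat and b :: int assume p: "prime p" "N < p"
      have "[minv p d b ^ k * (minv p c b * minv p d b) = minv p d b ^ k *
        (minv p d c * (minv p c b - minv p d b) + (minv p d c)^2 * (mdelta p c b + mdelta p d b))] (mod int p)"
        using p N not_dvd_diff[OF p(2) assms False] by (intro cong_mult cong_refl minv_partial_fractions) auto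
      then show "[minv p d c * (minv p c b * minv p d b ^ k) - minv p d c * minv p d b ^ Suc k +
          (minv p d c)^2 * (mdelta p c b * minv p d b ^ k + mdelta p d b * minv p d b ^ k) =
          minv p c b * minv p d b ^ Suc k] (mod int p)"
        by (simp add: algebra_simps cong_sym_eq)
    qed
  qed
qed

lemma rational_family_mult_minv:
  assumes "rational_family N r s f" "\<bar>c\<bar> \<le> int r"
  shows "rational_family N r (Suc s) (\<lambda>p b. minv p c b * f p b)"
  using assms(1)
proof (induction rule: rational_family.induct)
  case (monomial x k)
  have "rational_family N r (Suc k) (\<lambda>p b. minv p c b * b ^ k)"
  proof (induction k)
    case 0
    then show ?case using rational_family_minv assms by simp
  next
    case (Suc k)
    from rational_family_mult_id[OF this] show ?case by (simp add: algebra_simps)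
  qed
  from rational_family_scale[OF rational_family_mono[OF this] monomial(1), of "Suc s" r]
  show ?case using monomial(2) by (simp add: algebra_simps)
next
  case (pole x k d)
  from rational_family_scale[OF rational_family_mono[OF rational_family_minv_minv[OF assms(2) pole(4)]] pole(1), of k "Suc s" r]
  show ?case using pole by (simp add: algebra_simps)
next
  case (point x d)
  from rational_family_scale[OF rational_family_mult_mdelta[OF rational_family_minv[OF _ assms(2)] point(2)] point(1), of "Suc s"]
  show ?case by (simp add: algebra_simps)
next
  case (add f g)
  then show ?case using rational_family.add by (simp add: distrib_left)
next
  case (cong f g)
  show ?case
    by (rule rational_family.cong[OF cong.IH]) (use cong.hyps in \<open>auto intro: cong_mult\<close>)
qed

lemma rational_family_mult:
  assumes "rational_family N r s f" "rational_family N r s' g"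
  shows "rational_family N r (s + s') (\<lambda>p b. f p b * g p b)"
  using assms(1)
proof (induction rule: rational_family.induct)
  case (monomial x k)
  have "rational_family N r (k + s') (\<lambda>p b. b ^ k * g p b)"
  proof (induction k)
    case 0
    then show ?case using assms by simp
  next
    case (Suc k)
    from rational_family_mult_id[OF this] show ?case by (simp add: algebra_simps)
  qed
  from rational_family_scale[OF rational_family_mono[OF this] monomial(1), of "s + s'" r]
  show ?case using monomial(2) by (simp add: algebra_simps)
next
  case (pole x k d)
  have "rational_family N r (k + s') (\<lambda>p b. minv p d b ^ k * g p b)"
  proof (induction k)
    case 0
    then show ?case using assms by simp
  next
    case (Suc k)
    from rational_family_mult_minv[OF this pole(4)] show ?case by (simp add: algebra_simps)
  qed
  from rational_family_scale[OF rational_family_mono[OF this] pole(1), of "s + s'" r]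
  show ?case using pole by (simp add: algebra_simps)
next
  case (point x d)
  from rational_family_scale[OF rational_family_mult_mdelta[OF assms(2) point(2)] point(1), of "s + s'"]
  show ?case by (simp add: algebra_simps)
next
  case (add f g)
  then show ?case using rational_family.add by (simp add: distrib_right)
next
  case (cong f g)
  show ?case
    by (rule rational_family.cong[OF cong.IH]) (use cong.hyps in \<open>auto intro: cong_mult\<close>)
qed

lemma rational_family_prod:
  "finite S \<Longrightarrow> (\<And>i. i \<in> S \<Longrightarrow> rational_family N r s (f i)) \<Longrightarrow> rational_family N r (card S * s) (\<lambda>p b. \<Prod>i\<in>S. f i p b)"
proof (induction S rule: finite_induct)
  case empty then show ?case using rational_family_const[of N "\<lambda>p. 1"] by simp
next
  case (insert i S)
  then show ?case using rational_family_mult[of s "f i" "card S * s"] by simp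
qed

text \<open>Only point masses contribute, each with its coefficient. Powers of b and of
  \<open>minv\<close> have exponent at most s, and s + 2 \<le> N < p makes their power sums vanish
  modulo p.\<close>

lemma rational_family_uniform_sum:
  assumes "rational_family N r s f" "s + 2 \<le> N"
  shows "uniform N (\<lambda>p. \<Sum>b<p. f p (int b))"
  using assms(1)
proof (induction rule: rational_family.induct)
  case (monomial x k)
  show ?case
    by (rule uniform_cong[of _ "\<lambda>p. 0"])
      (use monomial assms(2) in \<open>auto simp: cong_sym_eq[of 0] cong_0_iff power_sum_dvd simp flip: sum_distrib_left intro!: dvd_mult\<close>)
next
  case (pole x k c)
  show ?case
    by (rule uniform_cong[of _ "\<lambda>p. 0"])
      (use pole assms(2) in \<open>auto simp: cong_sym_eq[of 0] cong_0_iff minv_power_sum_dvd simp flip: sum_distrib_left intro!: dvd_mult\<close>)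
next
  case (point x c)
  show ?case
    by (rule uniform_cong[OF point(1)]) (auto simp: mdelta_sum simp flip: sum_distrib_left)
next
  case (add f g)
  then show ?case by (simp add: sum.distrib uniform_add)
next
  case (cong f g)
  show ?case
    by (rule uniform_cong[OF cong.IH]) (use cong.hyps in \<open>auto intro: cong_sum\<close>)
qed

end

text \<open>Translation by w moves poles and points by -w, whence the new radius; powers of b + w
  are expanded by closure under products.\<close>

lemma rational_family_shift:
  assumes "rational_family N r s f" and N: "2 * (r + nat \<bar>w\<bar>) \<le> N" "2 \<le> N"
  shows "rational_family N (r + nat \<bar>w\<bar>) s (\<lambda>p b. f p (b + w))"
  using assms(1)
proof (induction rule: rational_family.induct)
  case (monomial x k)
  have "rational_family N (r + nat \<bar>w\<bar>) k (\<lambda>p b. (b + w) ^ k)"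
  proof (induction k)
    case 0 show ?case using rational_family_const[of N "\<lambda>p. 1"] by simp
  next
    case (Suc k)
    have "rational_family N (r + nat \<bar>w\<bar>) 1 (\<lambda>p b. b + w)"
      by (intro rational_family.add rational_family_id rational_family_const) auto
    from rational_family_mult[OF N this Suc] show ?case by simp
  qed
  from rational_family_scale[OF rational_family_mono[OF this] monomial(1), of s]
  show ?case using monomial(2) by simp
next
  case (pole x k c)
  then show ?case
    using rational_family.pole[of N x k s "c - w" "r + nat \<bar>w\<bar>"] by (simp add: minv_def algebra_simps)
next
  case (point x c)
  then show ?case
    using rational_family.point[of N x "c - w" "r + nat \<bar>w\<bar>" s] by (simp add: mdelta_def algebra_simps)
next
  case (add f g)
  then show ?case by (intro rational_family.add)
next
  case (cong f g)
  show ?case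
    by (rule rational_family.cong[OF cong.IH]) (use cong.hyps in auto)
qed

subsection \<open>Newton's identities\<close>

text \<open>The Leibniz sum for matrices given as functions, in the same shape as
  \<open>cring_det\<close>. The library's \<open>det\<close> enters only through the Laplace
  expansion, the adjugate and the identity matrix.\<close>

definition mdet :: "nat \<Rightarrow> (nat \<Rightarrow> nat \<Rightarrow> 'a::comm_ring_1) \<Rightarrow> 'a" where
  "mdet n A = (\<Sum>\<sigma> | \<sigma> permutes {..<n}. of_int (sign \<sigma>) * (\<Prod>i<n. A i (\<sigma> i)))"

lemma det_mat_eq_mdet: "det (mat n n (\<lambda>(i, j). A i j)) = mdet n A"
  unfolding mdet_def det_def
  by (auto simp: atLeast0LessThan permutes_in_image intro!: sum.cong prod.cong arg_cong2[of _ _ _ _ "(*)"])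

fun mpow :: "nat \<Rightarrow> (nat \<Rightarrow> nat \<Rightarrow> 'a::comm_ring_1) \<Rightarrow> nat \<Rightarrow> nat \<Rightarrow> nat \<Rightarrow> 'a" where
  "mpow n A 0 = (\<lambda>i j. if i = j then 1 else 0)"
| "mpow n A (Suc k) = (\<lambda>i j. \<Sum>l<n. A i l * mpow n A k l j)"

lemma mpow_Suc_right:
  "i < n \<Longrightarrow> j < n \<Longrightarrow> mpow n A (Suc k) i j = (\<Sum>l<n. mpow n A k i l * A l j)"
proof (induction k arbitrary: i)
  case 0
  have "(\<Sum>l<n. A i l * (if l = j then 1 else 0)) = A i j"
    using 0 by (subst sum.remove[of _ j]) auto
  moreover have "(\<Sum>l<n. (if i = l then 1 else 0) * A l j) = A i j"
    using 0 by (subst sum.remove[of _ i]) auto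
  ultimately show ?case by simp
next
  case (Suc k)
  have "mpow n A (Suc (Suc k)) i j = (\<Sum>l<n. A i l * (\<Sum>l'<n. mpow n A k l l' * A l' j))"
    using Suc.IH Suc.prems by simp
  also have "\<dots> = (\<Sum>l'<n. \<Sum>l<n. A i l * mpow n A k l l' * A l' j)"
    by (subst sum.swap) (simp add: sum_distrib_left mult.assoc)
  finally show ?case by (simp add: sum_distrib_right)
qed

text \<open>The coefficient of y^k in det(1 + y A), that is, the k-th elementary symmetric function
  of the eigenvalues, without a sign.\<close>

definition echar :: "nat \<Rightarrow> (nat \<Rightarrow> nat \<Rightarrow> 'a::comm_ring_1) \<Rightarrow> nat \<Rightarrow> 'a" where
  "echar n A k = coeff (mdet n (\<lambda>i j. [:if i = j then 1 else 0, A i j:])) k"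

lemma fps_deriv_prod:
  fixes f :: "'b \<Rightarrow> 'a::comm_ring_1 fps"
  assumes "finite S"
  shows "fps_deriv (\<Prod>i\<in>S. f i) = (\<Sum>i\<in>S. fps_deriv (f i) * (\<Prod>l\<in>S - {i}. f l))"
  using assms
proof (induction S rule: finite_induct)
  case (insert x S)
  have "(\<Prod>l\<in>insert x S - {i}. f l) = f x * (\<Prod>l\<in>S - {i}. f l)" if "i \<in> S" for i
  proof -
    have "insert x S - {i} = insert x (S - {i})" using insert that by auto
    then show ?thesis using insert by simp
  qed
  moreover have "insert x S - {x} = S" using insert by auto
  ultimately show ?case
    using insert by (simp add: sum_distrib_left mult.left_commute mult.commute[of "fps_deriv (f x)"])
qed simp

text \<open>Jacobi's formula. The product rule differentiates one row at a time; \<open>C i\<close>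
  is B with row i differentiated. Expanding along that row uses only cofactors that do not see the
  change.\<close>

lemma fps_deriv_mdet:
  fixes B :: "nat \<Rightarrow> nat \<Rightarrow> 'a::comm_ring_1 fps"
  shows "fps_deriv (mdet n B) =
    (\<Sum>i<n. \<Sum>j<n. fps_deriv (B i j) * adj_mat (mat n n (\<lambda>(i, j). B i j)) $$ (j, i))"
proof -
  define C where "C i l j = (if l = i then fps_deriv (B i j) else B l j)" for i l j
  have "fps_deriv (of_int (sign \<sigma>) * (\<Prod>l<n. B l (\<sigma> l))) =
      (\<Sum>i<n. of_int (sign \<sigma>) * (\<Prod>l<n. C i l (\<sigma> l)))" for \<sigma> :: "nat \<Rightarrow> nat"
  proof -
    have "(\<Prod>l<n. C i l (\<sigma> l)) = fps_deriv (B i (\<sigma> i)) * (\<Prod>l\<in>{..<n} - {i}. B l (\<sigma> l))" if "i < n" for i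
      using that by (subst prod.remove[of _ i]) (auto simp: C_def intro!: prod.cong)
    moreover have "fps_deriv (of_int k * g) = of_int k * fps_deriv g" for k and g :: "'a fps"
      by (simp flip: fps_of_int)
    ultimately show ?thesis by (simp add: fps_deriv_prod sum_distrib_left)
  qed
  then have "fps_deriv (mdet n B) = (\<Sum>i<n. mdet n (C i))"
    unfolding mdet_def fps_deriv_sum by (simp add: sum.swap[of _ "{..<n}"])
  also have "\<dots> = (\<Sum>i<n. \<Sum>j<n. fps_deriv (B i j) * adj_mat (mat n n (\<lambda>(i, j). B i j)) $$ (j, i))"
  proof (rule sum.cong)
    fix i assume i: "i \<in> {..<n}"
    have "mdet n (C i) = (\<Sum>j<n. mat n n (\<lambda>(l, j). C i l j) $$ (i, j) * cofactor (mat n n (\<lambda>(l, j). C i l j)) i j)"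
      unfolding det_mat_eq_mdet[symmetric] using i by (intro laplace_expansion_row) auto
    moreover have "cofactor (mat n n (\<lambda>(l, j). C i l j)) i j = cofactor (mat n n (\<lambda>(i, j). B i j)) i j" if "j < n" for j
    proof -
      have "mat_delete (mat n n (\<lambda>(l, j). C i l j)) i j = mat_delete (mat n n (\<lambda>(i, j). B i j)) i j"
        unfolding mat_delete_def by (rule eq_matI) (use i that in \<open>auto simp: C_def\<close>)
      then show ?thesis by (simp add: cofactor_def)
    qed
    ultimately show "mdet n (C i) = (\<Sum>j<n. fps_deriv (B i j) * adj_mat (mat n n (\<lambda>(i, j). B i j)) $$ (j, i))"
      using i by (simp add: C_def adj_mat_def)
  qed simp
  finally show ?thesis .
qed

lemma fps_of_poly_mdet:
  fixes A :: "nat \<Rightarrow> nat \<Rightarrow> 'a::comm_ring_1 poly"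
  shows "fps_of_poly (mdet n A) = mdet n (\<lambda>i j. fps_of_poly (A i j))"
proof -
  have "fps_of_poly (of_int k :: 'a poly) = of_int k" for k
    by (simp add: of_int_poly fps_of_poly_const fps_of_int)
  then show ?thesis
    unfolding mdet_def by (simp add: fps_of_poly_sum fps_of_poly_mult fps_of_poly_prod)
qed

text \<open>Newton's identities over any commutative ring, without eigenvalues. Let F = det(1 + y A)
  and G = adj(1 + y A). Comparing coefficients in G (1 + y A) = F gives G_k as the sum of (-1)^q
  F_(k-q) A^q over q \<le> k, and Jacobi's formula reads F' = tr(A G).\<close>

lemma newton_echar:
  "of_nat (Suc k) * echar n A (Suc k) =
    (\<Sum>i\<le>k. (- 1) ^ i * echar n A (k - i) * (\<Sum>j<n. mpow n A (Suc i) j j))"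
proof -
  define B where "B i j = fps_of_poly [:if i = j then 1 else 0, A i j:]" for i j
  define F where "F = mdet n B"
  define G where "G = adj_mat (mat n n (\<lambda>(i, j). B i j))"
  have FG: "F $ k = echar n A k" for k
    unfolding F_def B_def echar_def by (subst fps_of_poly_mdet[symmetric]) simp
  have B: "B i j = (if i = j then 1 else 0) + fps_X * fps_const (A i j)" for i j
    unfolding B_def by (simp add: fps_of_poly_pCons fps_of_poly_const)
  have carrier: "mat n n (\<lambda>(i, j). B i j) \<in> carrier_mat n n" by simp
  have GB: "(\<Sum>l<n. G $$ (i, l) * B l j) = (if i = j then F else 0)" if "i < n" "j < n" for i j
  proof -
    have "G * mat n n (\<lambda>(i, j). B i j) = F \<cdot>\<^sub>m 1\<^sub>m n"
      unfolding G_def F_def det_mat_eq_mdet[symmetric] using carrier by (rule adj_mat)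
    then have "(G * mat n n (\<lambda>(i, j). B i j)) $$ (i, j) = (F \<cdot>\<^sub>m 1\<^sub>m n) $$ (i, j)" by simp
    moreover have "G \<in> carrier_mat n n" unfolding G_def using carrier by (rule adj_mat)
    ultimately show ?thesis using that
      by (auto simp: scalar_prod_def atLeast0LessThan)
  qed
  have rec: "G $$ (i, j) + fps_X * (\<Sum>l<n. G $$ (i, l) * fps_const (A l j)) = (if i = j then F else 0)"
    if "i < n" "j < n" for i j
  proof -
    have "(\<Sum>l<n. G $$ (i, l) * (if l = j then 1 else 0)) = G $$ (i, j)"
      using that by (subst sum.remove[of _ j]) auto
    then show ?thesis
      using GB[OF that] by (simp add: B algebra_simps sum.distrib sum_distrib_left)
  qed
  have G: "G $$ (i, j) $ k = (\<Sum>q\<le>k. (- 1) ^ q * F $ (k - q) * mpow n A q i j)" if "i < n" "j < n" for i j k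
    using that
  proof (induction k arbitrary: j)
    case 0
    have "(G $$ (i, j) + fps_X * (\<Sum>l<n. G $$ (i, l) * fps_const (A l j))) $ 0 = (if i = j then F else 0) $ 0"
      using rec[OF 0] by simp
    then show ?case by simp
  next
    case (Suc k)
    have "(G $$ (i, j) + fps_X * (\<Sum>l<n. G $$ (i, l) * fps_const (A l j))) $ Suc k = (if i = j then F else 0) $ Suc k"
      using rec[OF Suc.prems] by simp
    then have "G $$ (i, j) $ Suc k = (if i = j then F $ Suc k else 0) - (\<Sum>l<n. G $$ (i, l) $ k * A l j)"
      by (auto simp: fps_sum_nth algebra_simps)
    also have "(\<Sum>l<n. G $$ (i, l) $ k * A l j) = (\<Sum>l<n. \<Sum>q\<le>k. (- 1) ^ q * F $ (k - q) * (mpow n A q i l * A l j))"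
      using Suc by (simp add: sum_distrib_right mult.assoc)
    also have "\<dots> = (\<Sum>q\<le>k. (- 1) ^ q * F $ (k - q) * (\<Sum>l<n. mpow n A q i l * A l j))"
      by (subst sum.swap) (simp add: sum_distrib_left)
    also have "\<dots> = (\<Sum>q\<le>k. (- 1) ^ q * F $ (k - q) * mpow n A (Suc q) i j)"
      using mpow_Suc_right[OF Suc.prems, of A] by simp
    also have "(if i = j then F $ Suc k else 0) - \<dots> =
        (\<Sum>q\<le>Suc k. (- 1) ^ q * F $ (Suc k - q) * mpow n A q i j)"
      by (simp only: sum.atMost_Suc_shift[where n = k]) (auto simp: sum_negf simp del: mpow.simps(2))
    finally show ?case .
  qed
  have "of_nat (Suc k) * F $ Suc k = fps_deriv F $ k" by simp
  also have "\<dots> = (\<Sum>i<n. \<Sum>j<n. A i j * G $$ (j, i) $ k)"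
  proof -
    have "fps_deriv (B i j) = fps_const (A i j)" for i j
      by (cases "i = j") (simp_all add: B)
    then show ?thesis
      unfolding F_def fps_deriv_mdet G_def[symmetric] by (simp add: fps_sum_nth)
  qed
  also have "\<dots> = (\<Sum>i<n. \<Sum>j<n. \<Sum>q\<le>k. (- 1) ^ q * F $ (k - q) * (A i j * mpow n A q j i))"
    by (simp add: G sum_distrib_left algebra_simps)
  also have "\<dots> = (\<Sum>i<n. \<Sum>q\<le>k. \<Sum>j<n. (- 1) ^ q * F $ (k - q) * (A i j * mpow n A q j i))"
    by (subst sum.swap) simp
  also have "\<dots> = (\<Sum>q\<le>k. \<Sum>i<n. \<Sum>j<n. (- 1) ^ q * F $ (k - q) * (A i j * mpow n A q j i))"
    by (rule sum.swap)
  finally show ?thesis by (simp add: FG sum_distrib_left)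
qed

lemma echar_zero: "echar n A 0 = 1"
proof -
  have "poly (mdet n (\<lambda>i j. [:if i = j then 1 else 0, A i j:])) 0 = mdet n (\<lambda>i j. if i = j then 1 else 0)"
    unfolding mdet_def by (simp add: poly_sum poly_prod)
  also have "\<dots> = det (1\<^sub>m n)"
    unfolding det_mat_eq_mdet[symmetric] by (rule arg_cong[of _ _ det]) auto
  finally show ?thesis by (simp add: echar_def poly_0_coeff_0)
qed

lemma mdet_one_plus:
  "mdet n (\<lambda>i j. (if i = j then 1 else 0) + A i j) =
    (\<Sum>k\<le>degree (mdet n (\<lambda>i j. [:if i = j then 1 else 0, A i j:])). echar n A k)"
proof -
  have "poly (mdet n (\<lambda>i j. [:if i = j then 1 else 0, A i j:])) 1 =
      mdet n (\<lambda>i j. (if i = j then 1 else 0) + A i j)"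
    unfolding mdet_def by (simp add: poly_sum poly_prod)
  then show ?thesis by (simp add: poly_altdef echar_def)
qed

subsection \<open>Coefficients of polynomials and determinants\<close>

lemma finite_poly_mapping_summands:
  fixes \<alpha> :: "'b \<Rightarrow>\<^sub>0 nat"
  shows "finite {(\<beta>, \<gamma>). \<beta> + \<gamma> = \<alpha>}"
proof -
  let ?S = "{\<beta>. \<exists>\<gamma>. \<beta> + \<gamma> = \<alpha>}"
  have le: "Poly_Mapping.lookup \<beta> x \<le> Poly_Mapping.lookup \<alpha> x" if "\<beta> \<in> ?S" for \<beta> x
    using that by (auto simp: lookup_add)
  have "inj_on (\<lambda>\<beta>. restrict (Poly_Mapping.lookup \<beta>) (Poly_Mapping.keys \<alpha>)) ?S"
  proof (rule inj_onI, rule poly_mapping_eqI)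
    fix \<beta> \<gamma> x
    assume *: "\<beta> \<in> ?S" "\<gamma> \<in> ?S" "restrict (Poly_Mapping.lookup \<beta>) (Poly_Mapping.keys \<alpha>) = restrict (Poly_Mapping.lookup \<gamma>) (Poly_Mapping.keys \<alpha>)"
    show "Poly_Mapping.lookup \<beta> x = Poly_Mapping.lookup \<gamma> x"
    proof (cases "x \<in> Poly_Mapping.keys \<alpha>")
      case True
      then show ?thesis using fun_cong[OF *(3), of x] by simp
    next
      case False
      then show ?thesis using le[OF *(1), of x] le[OF *(2), of x] by (simp add: in_keys_iff)
    qed
  qed
  moreover have "(\<lambda>\<beta>. restrict (Poly_Mapping.lookup \<beta>) (Poly_Mapping.keys \<alpha>)) ` ?S \<subseteq> PiE (Poly_Mapping.keys \<alpha>) (\<lambda>x. {..Poly_Mapping.lookup \<alpha> x})"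
    using le by auto
  moreover have "finite (PiE (Poly_Mapping.keys \<alpha>) (\<lambda>x. {..Poly_Mapping.lookup \<alpha> x}))"
    by (intro finite_PiE) auto
  ultimately have "finite ?S" by (rule inj_on_finite)
  moreover have "{(\<beta>, \<gamma>). \<beta> + \<gamma> = \<alpha>} \<subseteq> (\<lambda>\<beta>. (\<beta>, \<alpha> - \<beta>)) ` ?S"
    by auto
  ultimately show ?thesis by (rule finite_surj)
qed

text \<open>The sum runs over the factorisations of the monomial \<alpha>, a finite set that does
  not depend on the factors. With coefficients varying with p it is therefore within the scope of
  \<open>uniform_sum\<close>.\<close>

lemma lookup_mult_summands:
  fixes f g :: "('b \<Rightarrow>\<^sub>0 nat) \<Rightarrow>\<^sub>0 'a::comm_semiring_1"
  shows "Poly_Mapping.lookup (f * g) \<alpha> = (\<Sum>(\<beta>, \<gamma>)\<in>{(\<beta>, \<gamma>). \<beta> + \<gamma> = \<alpha>}. Poly_Mapping.lookup f \<beta> * Poly_Mapping.lookup g \<gamma>)"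
proof -
  have "Poly_Mapping.lookup (f * g) \<alpha> = prod_fun (Poly_Mapping.lookup f) (Poly_Mapping.lookup g) \<alpha>"
    by (simp add: times_poly_mapping.rep_eq)
  also have "\<dots> = (\<Sum>(\<beta>, \<gamma>). Poly_Mapping.lookup f \<beta> * Poly_Mapping.lookup g \<gamma> when \<alpha> = \<beta> + \<gamma>)"
    by (rule prod_fun_unfold_prod) (simp_all add: finite_lookup)
  also have "\<dots> = (\<Sum>(\<beta>, \<gamma>)\<in>{(\<beta>, \<gamma>). \<beta> + \<gamma> = \<alpha>}. Poly_Mapping.lookup f \<beta> * Poly_Mapping.lookup g \<gamma> when \<alpha> = \<beta> + \<gamma>)"
    by (rule Sum_any.expand_superset) (auto simp: finite_poly_mapping_summands when_def split: if_splits)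
  also have "\<dots> = (\<Sum>(\<beta>, \<gamma>)\<in>{(\<beta>, \<gamma>). \<beta> + \<gamma> = \<alpha>}. Poly_Mapping.lookup f \<beta> * Poly_Mapping.lookup g \<gamma>)"
    by (rule sum.cong) auto
  finally show ?thesis .
qed

lemma lookup_sum: "Poly_Mapping.lookup (\<Sum>i\<in>S. f i) \<alpha> = (\<Sum>i\<in>S. Poly_Mapping.lookup (f i) \<alpha>)"
  by (induction S rule: infinite_finite_induct) (auto simp: lookup_add)

lemma lookup_of_int: "Poly_Mapping.lookup (of_int k :: 'b::monoid_add \<Rightarrow>\<^sub>0 'a::ring_1) \<alpha> = (if \<alpha> = 0 then of_int k else 0)"
proof -
  have "Poly_Mapping.lookup (of_nat k :: 'b \<Rightarrow>\<^sub>0 'a) \<alpha> = (if \<alpha> = 0 then of_nat k else 0)" for k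
    by (induction k) (auto simp: lookup_add lookup_one)
  then show ?thesis by (cases k rule: int_cases2) simp_all
qed

lemma lookup_of_int_mult:
  fixes f :: "('b \<Rightarrow>\<^sub>0 nat) \<Rightarrow>\<^sub>0 int"
  shows "Poly_Mapping.lookup (of_int k * f) \<alpha> = k * Poly_Mapping.lookup f \<alpha>"
proof -
  have "Poly_Mapping.lookup (of_int k * f) \<alpha> = (\<Sum>(\<beta>, \<gamma>)\<in>{(\<beta>, \<gamma>). \<beta> + \<gamma> = \<alpha>}. if (\<beta>, \<gamma>) = (0, \<alpha>) then k * Poly_Mapping.lookup f \<alpha> else 0)"
    unfolding lookup_mult_summands by (rule sum.cong) (auto simp: lookup_of_int)
  also have "\<dots> = k * Poly_Mapping.lookup f \<alpha>"
    by (subst sum.mono_neutral_right[of _ "{(0, \<alpha>)}"])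
      (auto simp: finite_poly_mapping_summands split: if_splits)
  finally show ?thesis .
qed

definition supported :: "(('b \<Rightarrow>\<^sub>0 nat) \<Rightarrow> bool) \<Rightarrow> (('b \<Rightarrow>\<^sub>0 nat) \<Rightarrow>\<^sub>0 'a::comm_ring_1) \<Rightarrow> bool" where
  "supported Q f \<longleftrightarrow> (\<forall>\<beta>. Poly_Mapping.lookup f \<beta> \<noteq> 0 \<longrightarrow> Q \<beta>)"

lemma supported_sum: "(\<And>i. i \<in> S \<Longrightarrow> supported Q (f i)) \<Longrightarrow> supported Q (\<Sum>i\<in>S. f i)"
  unfolding supported_def lookup_sum by (meson sum.not_neutral_contains_not_neutral)

lemma supported_mult:
  assumes "supported Q f" "supported Q' g" "\<And>\<beta> \<gamma>. Q \<beta> \<Longrightarrow> Q' \<gamma> \<Longrightarrow> Q'' (\<beta> + \<gamma>)"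
  shows "supported Q'' (f * g)"
  unfolding supported_def
proof (intro allI impI)
  fix \<alpha> assume "Poly_Mapping.lookup (f * g) \<alpha> \<noteq> 0"
  then obtain \<beta> \<gamma> where "\<beta> + \<gamma> = \<alpha>" "Poly_Mapping.lookup f \<beta> * Poly_Mapping.lookup g \<gamma> \<noteq> 0"
    unfolding lookup_mult_summands by (force elim: sum.not_neutral_contains_not_neutral)
  then have "\<beta> + \<gamma> = \<alpha>" "Poly_Mapping.lookup f \<beta> \<noteq> 0" "Poly_Mapping.lookup g \<gamma> \<noteq> 0" by auto
  then show "Q'' \<alpha>" using assms unfolding supported_def by blast
qed

section \<open>Weights and degrees of monomials\<close>

text \<open>The additive extension to monomials of a weight on the variables. The weight 1 gives the
  total degree; the weight i - j and the degree in the generators of I are further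
  instances.\<close>

definition wsum :: "('b \<Rightarrow> int) \<Rightarrow> ('b \<Rightarrow>\<^sub>0 nat) \<Rightarrow> int" where
  "wsum w \<alpha> = (\<Sum>x\<in>Poly_Mapping.keys \<alpha>. w x * int (Poly_Mapping.lookup \<alpha> x))"

lemma wsum_superset:
  "finite S \<Longrightarrow> Poly_Mapping.keys \<alpha> \<subseteq> S \<Longrightarrow> wsum w \<alpha> = (\<Sum>x\<in>S. w x * int (Poly_Mapping.lookup \<alpha> x))"
  unfolding wsum_def by (rule sum.mono_neutral_left) (auto simp: in_keys_iff)

lemma wsum_zero [simp]: "wsum w 0 = 0"
  by (simp add: wsum_def)

lemma wsum_single [simp]: "wsum w (Poly_Mapping.single x k) = w x * int k"
  by (cases "k = 0") (simp_all add: wsum_def)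

lemma wsum_add: "wsum w (\<alpha> + \<beta>) = wsum w \<alpha> + wsum w \<beta>"
proof -
  let ?S = "Poly_Mapping.keys \<alpha> \<union> Poly_Mapping.keys \<beta>"
  have "Poly_Mapping.keys (\<alpha> + \<beta>) \<subseteq> ?S" by (rule keys_add)
  then show ?thesis
    by (simp add: wsum_superset[of ?S] lookup_add algebra_simps sum.distrib)
qed

lemma wsum_nonneg: "(\<And>x. 0 \<le> w x) \<Longrightarrow> 0 \<le> wsum w \<alpha>"
  unfolding wsum_def by (intro sum_nonneg mult_nonneg_nonneg) auto

lemma wsum_mono: "(\<And>x. x \<in> Poly_Mapping.keys \<alpha> \<Longrightarrow> w x \<le> w' x) \<Longrightarrow> wsum w \<alpha> \<le> wsum w' \<alpha>"
  unfolding wsum_def by (intro sum_mono mult_right_mono) auto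

lemma wsum_cmult: "wsum (\<lambda>x. c * w x) \<alpha> = c * wsum w \<alpha>"
  unfolding wsum_def by (simp add: sum_distrib_left mult.assoc)

lemma wsum_plus: "wsum (\<lambda>x. w x + w' x) \<alpha> = wsum w \<alpha> + wsum w' \<alpha>"
  unfolding wsum_def by (simp add: sum.distrib algebra_simps)

lemma lookup_le_degree: "int (Poly_Mapping.lookup \<alpha> x) \<le> wsum (\<lambda>_. 1) \<alpha>"
proof (cases "x \<in> Poly_Mapping.keys \<alpha>")
  case True
  then show ?thesis
    unfolding wsum_def by (simp flip: of_nat_sum) (intro member_le_sum, auto)
next
  case False
  then show ?thesis by (simp add: in_keys_iff wsum_nonneg)
qed

lemma degree_pos:
  assumes "\<alpha> \<noteq> 0"
  shows "1 \<le> wsum (\<lambda>_. 1) \<alpha>"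
proof -
  obtain x where "x \<in> Poly_Mapping.keys \<alpha>" using assms by (metis keys_eq_empty ex_in_conv)
  then have "1 \<le> int (Poly_Mapping.lookup \<alpha> x)" by (simp add: in_keys_iff)
  then show ?thesis using lookup_le_degree[of \<alpha> x] by linarith
qed

definition pmcong :: "nat \<Rightarrow> (('b \<Rightarrow>\<^sub>0 nat) \<Rightarrow>\<^sub>0 int) \<Rightarrow> (('b \<Rightarrow>\<^sub>0 nat) \<Rightarrow>\<^sub>0 int) \<Rightarrow> bool" where
  "pmcong p f g \<longleftrightarrow> (\<forall>\<beta>. [Poly_Mapping.lookup f \<beta> = Poly_Mapping.lookup g \<beta>] (mod int p))"

lemma pmcong_refl [simp]: "pmcong p f f"
  by (simp add: pmcong_def)

lemma pmcong_trans [trans]: "pmcong p f g \<Longrightarrow> pmcong p g h \<Longrightarrow> pmcong p f h"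
  unfolding pmcong_def using cong_trans by blast

lemma pmcong_add: "pmcong p f g \<Longrightarrow> pmcong p f' g' \<Longrightarrow> pmcong p (f + f') (g + g')"
  by (simp add: pmcong_def lookup_add cong_add)

lemma pmcong_mult: "pmcong p f g \<Longrightarrow> pmcong p f' g' \<Longrightarrow> pmcong p (f * f') (g * g')"
  unfolding pmcong_def lookup_mult_summands by (auto intro!: cong_sum cong_mult)

lemma pmcong_sum: "(\<And>i. i \<in> S \<Longrightarrow> pmcong p (f i) (g i)) \<Longrightarrow> pmcong p (sum f S) (sum g S)"
  by (induction S rule: infinite_finite_induct) (auto intro: pmcong_add)

lemma pmcong_prod: "(\<And>i. i \<in> S \<Longrightarrow> pmcong p (f i) (g i)) \<Longrightarrow> pmcong p (prod f S) (prod g S)"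
  by (induction S rule: infinite_finite_induct) (auto intro: pmcong_mult)

lemma pmcong_of_int: "[a = b] (mod int p) \<Longrightarrow> pmcong p (of_int a) (of_int b)"
  by (simp add: pmcong_def lookup_of_int)

lemma pmcong_mdet:
  "(\<And>i j. i < n \<Longrightarrow> j < n \<Longrightarrow> pmcong p (A i j) (B i j)) \<Longrightarrow> pmcong p (mdet n A) (mdet n B)"
  unfolding mdet_def
  by (intro pmcong_sum pmcong_mult pmcong_prod pmcong_refl)
    (metis lessThan_iff mem_Collect_eq permutes_in_image)

lemma mdet_scale_columns:
  "mdet n (\<lambda>i j. c j * A i j) = (\<Prod>j<n. c j) * mdet n A"
proof -
  have "(\<Prod>i<n. c (\<sigma> i)) = (\<Prod>j<n. c j)" if "\<sigma> permutes {..<n}" for \<sigma>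
    using prod.permute[OF that, of c] by (simp add: comp_def)
  then show ?thesis
    unfolding mdet_def sum_distrib_left
    by (intro sum.cong) (auto simp: prod.distrib algebra_simps)
qed

lemma supported_of_int: "(Q 0) \<Longrightarrow> supported Q (of_int k)"
  by (simp add: supported_def lookup_of_int)

text \<open>For a permutation the differences i - \<sigma> i add up to 0. The second weight v is
  carried along to exclude the variables with j > m.\<close>

lemma supported_mdet_weight:
  assumes "\<And>i j. i < n \<Longrightarrow> j < n \<Longrightarrow>
    supported (\<lambda>\<beta>. wsum w \<beta> = int i - int j \<and> wsum v \<beta> = 0) (A i j)"
  shows "supported (\<lambda>\<beta>. wsum w \<beta> = 0 \<and> wsum v \<beta> = 0) (mdet n A)"
  unfolding mdet_def
proof (rule supported_sum)
  fix \<sigma> assume "\<sigma> \<in> {\<sigma>. \<sigma> permutes {..<n}}"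
  then have \<sigma>: "\<sigma> permutes {..<n}" by simp
  have *: "supported (\<lambda>\<beta>. wsum w \<beta> = (\<Sum>i\<in>S. int i - int (\<sigma> i)) \<and> wsum v \<beta> = 0) (\<Prod>i\<in>S. A i (\<sigma> i))"
    if "finite S" "S \<subseteq> {..<n}" for S
    using that
  proof (induction S rule: finite_induct)
    case empty
    show ?case by (simp add: supported_def lookup_one when_def)
  next
    case (insert x S)
    have "\<sigma> x < n" using permutes_in_image[OF \<sigma>, of x] insert by simp
    then have "supported (\<lambda>\<beta>. wsum w \<beta> = int x - int (\<sigma> x) \<and> wsum v \<beta> = 0) (A x (\<sigma> x))"
      using insert by (intro assms) auto
    moreover have "supported (\<lambda>\<beta>. wsum w \<beta> = (\<Sum>i\<in>S. int i - int (\<sigma> i)) \<and> wsum v \<beta> = 0) (\<Prod>i\<in>S. A i (\<sigma> i))"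
      using insert by auto
    ultimately show ?case
      using insert by (simp, elim supported_mult) (auto simp: wsum_add)
  qed
  have "(\<Sum>i<n. int i - int (\<sigma> i)) = 0"
    using sum.permute[OF \<sigma>, of int] by (simp add: sum_subtractf comp_def)
  then have "supported (\<lambda>\<beta>. wsum w \<beta> = 0 \<and> wsum v \<beta> = 0) (\<Prod>i<n. A i (\<sigma> i))"
    using *[of "{..<n}"] by simp
  then show "supported (\<lambda>\<beta>. wsum w \<beta> = 0 \<and> wsum v \<beta> = 0) (of_int (sign \<sigma>) * (\<Prod>i<n. A i (\<sigma> i)))"
    by (intro supported_mult[OF supported_of_int[where Q = "\<lambda>\<beta>. \<beta> = 0"]]) auto
qed

text \<open>Every factor y in the expansion of det(1 + y A) comes with an entry of A, whose
  monomials have positive degree unless the row has an allowance z i \<ge> 1. For X only the rows at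
  roots of P need an allowance.\<close>

lemma echar_degree_bound:
  fixes A :: "nat \<Rightarrow> nat \<Rightarrow> ('b \<Rightarrow>\<^sub>0 nat) \<Rightarrow>\<^sub>0 int"
  assumes A: "\<And>i j \<beta>. i < n \<Longrightarrow> j < n \<Longrightarrow> Poly_Mapping.lookup (A i j) \<beta> \<noteq> 0 \<Longrightarrow> 1 \<le> wsum (\<lambda>_. 1) \<beta> + z i"
    and z: "\<And>i. 0 \<le> z i"
    and nz: "Poly_Mapping.lookup (echar n A k) \<beta> \<noteq> 0"
  shows "int k \<le> wsum (\<lambda>_. 1) \<beta> + (\<Sum>i<n. z i)"
proof -
  \<comment> \<open>A filtration in which r measures the deficit: the coefficient of y^k lives in
    degrees at least k - r. Deficits add under multiplication.\<close>
  define V where "V r P \<longleftrightarrow> (\<forall>k. supported (\<lambda>\<beta>. int k \<le> wsum (\<lambda>_. 1) \<beta> + r) (coeff P k))"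
    for r and P :: "(('b \<Rightarrow>\<^sub>0 nat) \<Rightarrow>\<^sub>0 int) poly"
  have deg0: "0 \<le> wsum (\<lambda>_. 1) \<beta>" for \<beta> :: "'b \<Rightarrow>\<^sub>0 nat" by (rule wsum_nonneg) simp
  have Vmult: "V (r + r') (P * P')" if "V r P" "V r' P'" for r r' P P'
    unfolding V_def coeff_mult
  proof (intro allI supported_sum)
    fix k i :: nat assume "i \<in> {..k}"
    then show "supported (\<lambda>\<beta>. int k \<le> wsum (\<lambda>_. 1) \<beta> + (r + r')) (coeff P i * coeff P' (k - i))"
      by (intro supported_mult[OF spec[OF that(1)[unfolded V_def], of i] spec[OF that(2)[unfolded V_def], of "k - i"]])
        (auto simp: wsum_add)
  qed
  have Vint: "V 0 (of_int c)" for c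
    unfolding V_def by (auto simp: of_int_poly coeff_pCons deg0 split: nat.split intro!: supported_of_int)
      (simp_all add: supported_def)
  have entry: "V (z i) [:if i = j then 1 else 0, A i j:]" if "i < n" "j < n" for i j
    unfolding V_def
  proof
    fix k :: nat
    consider "k = (0::nat)" | "k = 1" | "2 \<le> k" by linarith
    then show "supported (\<lambda>\<beta>. int k \<le> wsum (\<lambda>_. 1) \<beta> + z i) (coeff [:if i = j then 1 else 0, A i j:] k)"
      using A[OF that] deg0 z[of i]
      by cases (auto simp: supported_def coeff_pCons numeral_2_eq_2 split: nat.split intro: add_nonneg_nonneg)
  qed
  have prod: "V (\<Sum>i\<in>S. z i) (\<Prod>i\<in>S. [:if i = \<sigma> i then 1 else 0, A i (\<sigma> i):])"
    if "finite S" "S \<subseteq> {..<n}" "\<sigma> permutes {..<n}" for S \<sigma>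
    using that
  proof (induction S rule: finite_induct)
    case empty
    then show ?case using Vint[of 1] by simp
  next
    case (insert x S)
    then have "\<sigma> x < n" using permutes_in_image[of \<sigma> _ x] by auto
    then show ?case
      using insert Vmult[OF entry[of x "\<sigma> x"]] by (simp del: mult_pCons_left mult_pCons_right)
  qed
  have "V (\<Sum>i<n. z i) (mdet n (\<lambda>i j. [:if i = j then 1 else 0, A i j:]))"
    unfolding mdet_def V_def coeff_sum
  proof (intro allI supported_sum)
    fix k \<sigma> assume "\<sigma> \<in> {\<sigma>. \<sigma> permutes {..<n}}"
    then have "V (0 + (\<Sum>i<n. z i)) (of_int (sign \<sigma>) * (\<Prod>i<n. [:if i = \<sigma> i then 1 else 0, A i (\<sigma> i):]))"
      by (intro Vmult Vint prod) auto
    then show "supported (\<lambda>\<beta>. int k \<le> wsum (\<lambda>_. 1) \<beta> + (\<Sum>i<n. z i))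
       (coeff (of_int (sign \<sigma>) * (\<Prod>i<n. [:if i = \<sigma> i then 1 else 0, A i (\<sigma> i):])) k)"
      unfolding V_def by simp
  qed
  then show ?thesis using nz unfolding V_def supported_def echar_def by blast
qed

subsection \<open>The matrix of the differential operator\<close>

text \<open>The falling factorial as a polynomial in an integer variable, since it is also evaluated
  at shifted arguments; the j-th derivative of x^b has it as coefficient.\<close>

definition ffac :: "nat \<Rightarrow> int \<Rightarrow> int" where
  "ffac j b = (\<Prod>u<j. b - int u)"

text \<open>The perturbation without the Euler part: x^i times the j-th derivative sends x^b to a
  multiple of x^(b-j+i), so that exponent a requires i = a + j - b. The condition
  \<open>b \<le> a + j\<close> keeps the natural subtraction exact.\<close>

definition op_entry :: "nat \<Rightarrow> nat \<Rightarrow> nat \<Rightarrow> tpoly" where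
  "op_entry m a b = (\<Sum>j\<le>m. if b \<le> a + j then of_int (ffac j (int b)) * tvar (a + j - b) j else 0)"

lemma fps_deriv_pow_X_nth:
  "fps_nth ((fps_deriv ^^ j) (fps_X ^ b :: 'a::comm_ring_1 fps)) k = (if k + j = b then of_int (ffac j (int b)) else 0)"
proof (induction j arbitrary: k)
  case 0
  then show ?case by (simp add: ffac_def fps_X_power_nth)
next
  case (Suc j)
  have "int b - int j = int (Suc k)" if "Suc k + j = b" using that by auto
  then show ?case using Suc[of "Suc k"] by (auto simp: ffac_def)
qed

lemma foldr_euler_X_power:
  "foldr (\<lambda>k g. fps_XD g - of_int (l k) * g) ks (fps_X ^ b :: 'a::comm_ring_1 fps) =
    of_int (\<Prod>k\<leftarrow>ks. int b - l k) * fps_X ^ b"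
proof (induction ks)
  case (Cons k ks)
  have X: "fps_X * fps_deriv (fps_X ^ b :: 'a fps) = of_nat b * fps_X ^ b"
    by (rule fps_ext) (auto simp: fps_X_power_nth simp flip: fps_of_nat)
  have deriv: "fps_deriv (of_int c * g) = of_int c * fps_deriv g" for c and g :: "'a fps"
    by (simp flip: fps_of_int)
  then have "fps_XD (of_int c * fps_X ^ b :: 'a fps) = of_int c * (of_nat b * fps_X ^ b)" for c
    by (simp only: fps_XD_def comp_apply deriv mult.left_commute[of fps_X "of_int c"] X)
  then show ?case using Cons by (simp add: left_diff_distrib mult.assoc mult.left_commute[of "of_nat b"])
qed simp

lemma diff_op_nth:
  "fps_nth (diff_op n m l (fps_X ^ b)) a =
    (if a = b then of_int (\<Prod>k=1..n. int b - l k) else 0) + op_entry m a b"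
proof -
  have "set [1..<Suc n] = {1..n}" by auto
  then have "(\<Prod>k\<leftarrow>[1..<Suc n]. int b - l k) = (\<Prod>k=1..n. int b - l k)"
    using prod.distinct_set_conv_list[of "[1..<Suc n]" "\<lambda>k. int b - l k"] by simp
  then have "fps_nth (foldr (\<lambda>k g. fps_XD g - of_int (l k) * g) [1..<Suc n] (fps_X ^ b :: tpoly fps)) a =
      (if a = b then of_int (\<Prod>k=1..n. int b - l k) else 0)"
    unfolding foldr_euler_X_power by (simp add: fps_X_power_nth flip: fps_of_int)
  moreover have "fps_nth (Abs_fps (\<lambda>i. tvar i j) * (fps_deriv ^^ j) (fps_X ^ b)) a =
      (if b \<le> a + j then of_int (ffac j (int b)) * tvar (a + j - b) j else 0)" for j
  proof -
    have "fps_nth (Abs_fps (\<lambda>i. tvar i j) * (fps_deriv ^^ j) (fps_X ^ b)) a =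
      (\<Sum>i=0..a. if i = a + j - b \<and> b \<le> a + j then of_int (ffac j (int b)) * tvar (a + j - b) j else 0)"
      unfolding fps_mult_nth fps_deriv_pow_X_nth by (rule sum.cong) (auto simp: mult.commute)
    also have "\<dots> = (if b \<le> a + j \<and> a + j - b \<le> a then of_int (ffac j (int b)) * tvar (a + j - b) j else 0)"
      by (auto simp: sum.delta)
    \<comment> \<open>The range i \<le> a forces j \<le> b. For j > b nothing is lost, because the
      falling factorial contains the factor b - b.\<close>
    also have "\<dots> = (if b \<le> a + j then of_int (ffac j (int b)) * tvar (a + j - b) j else 0)"
    proof (cases "j \<le> b")
      case False
      then have "ffac j (int b) = 0" by (auto simp: ffac_def)
      then show ?thesis by simp
    qed auto
    finally show ?thesis .
  qed
  ultimately show ?thesis by (simp add: diff_op_def op_entry_def fps_sum_nth)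
qed

abbreviation op_det :: "nat \<Rightarrow> nat \<Rightarrow> (nat \<Rightarrow> int) \<Rightarrow> nat \<Rightarrow> tpoly" where
  "op_det n m l p \<equiv> mdet p (\<lambda>a b. fps_nth (diff_op n m l (fps_X ^ b)) a)"

text \<open>Modulo \<open>p\<close>, \<open>op_unit\<close> is the product \<open>P\<^sup>*\<close> of the nonzero factors \<open>b - l\<^sub>k\<close>, \<open>op_inv\<close> its
  inverse, \<open>op_root\<close> the indicator function of the roots of \<open>P\<close>, and \<open>op_red\<close> the matrix \<open>X\<close>.\<close>

definition op_inv :: "nat \<Rightarrow> (nat \<Rightarrow> int) \<Rightarrow> nat \<Rightarrow> int \<Rightarrow> int" where
  "op_inv n l p b = (\<Prod>k=1..n. minv p (l k) b + mdelta p (l k) b)"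

definition op_unit :: "nat \<Rightarrow> (nat \<Rightarrow> int) \<Rightarrow> nat \<Rightarrow> int \<Rightarrow> int" where
  "op_unit n l p b = (\<Prod>k=1..n. (b - l k) + mdelta p (l k) b)"

definition op_root :: "nat \<Rightarrow> (nat \<Rightarrow> int) \<Rightarrow> nat \<Rightarrow> int \<Rightarrow> int" where
  "op_root n l p b = 1 - (\<Prod>k=1..n. 1 - mdelta p (l k) b)"

definition op_red :: "nat \<Rightarrow> nat \<Rightarrow> (nat \<Rightarrow> int) \<Rightarrow> nat \<Rightarrow> nat \<Rightarrow> nat \<Rightarrow> tpoly" where
  "op_red n m l p a b = of_int (op_inv n l p (int b)) * op_entry m a b -
     (if a = b then of_int (op_root n l p (int b)) else 0)"

section \<open>Reduction of the determinant to that of 1 + X\<close>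

lemma prod_shift_cong:
  fixes g :: "int \<Rightarrow> int"
  assumes "p > 0" and g: "\<And>x y. [x = y] (mod int p) \<Longrightarrow> [g x = g y] (mod int p)"
  shows "[(\<Prod>b<p. g (int b - c)) = (\<Prod>b<p. g (int b))] (mod int p)"
proof -
  let ?h = "\<lambda>b. nat ((int b - c) mod int p)"
  have h: "int (?h b) = (int b - c) mod int p" for b
    using assms(1) by simp
  have inj: "inj_on ?h {..<p}"
  proof (rule inj_onI)
    fix x y assume *: "x \<in> {..<p}" "y \<in> {..<p}" "?h x = ?h y"
    then have "(int x - c) mod int p = (int y - c) mod int p" using h by metis
    then have "[int x - c = int y - c] (mod int p)" by (simp add: cong_def)
    then have "[int x - c + c = int y - c + c] (mod int p)" by (intro cong_add cong_refl)
    then show "x = y" using * by (simp add: cong_def)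
  qed
  moreover have "?h ` {..<p} \<subseteq> {..<p}" using assms(1) by (auto simp: nat_less_iff)
  ultimately have bij: "bij_betw ?h {..<p} {..<p}"
    by (simp add: bij_betw_def endo_inj_surj)
  have "[(\<Prod>b<p. g (int b - c)) = (\<Prod>b<p. g (int (?h b)))] (mod int p)"
    by (intro cong_prod g) (simp only: h, simp add: cong_def)
  also have "(\<Prod>b<p. g (int (?h b))) = (\<Prod>b<p. g (int b))"
    by (rule prod.reindex_bij_betw[OF bij])
  finally show ?thesis .
qed

text \<open>Each k contributes separately: after translation by \<open>l k\<close> the factors over
  b < p are the nonzero residues, with 1 in place of 0, and their product is (p-1)!.\<close>

lemma prod_op_unit:
  assumes "prime p"
  shows "[(\<Prod>b<p. op_unit n l p (int b)) = (- 1) ^ n] (mod int p)"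
proof -
  have p: "p > 0" using assms prime_gt_0_nat by blast
  have factor: "[(\<Prod>b<p. (int b - c) + mdelta p c (int b)) = - 1] (mod int p)" for c
  proof -
    let ?g = "\<lambda>x. x + mdelta p 0 x"
    have "[(\<Prod>b<p. ?g (int b - c)) = (\<Prod>b<p. ?g (int b))] (mod int p)"
      using p by (rule prod_shift_cong) (auto simp: mdelta_def cong_dvd_iff intro: cong_add)
    moreover have "(\<Prod>b<p. ?g (int b)) = fact (p - 1)"
    proof -
      have "{..<p} = insert 0 {1..p - 1}" using p by auto
      then have "(\<Prod>b<p. ?g (int b)) = (\<Prod>b\<in>{1..p - 1}. ?g (int b))"
        by (simp add: mdelta_def)
      also have "\<dots> = (\<Prod>b\<in>{1..p - 1}. int b)"
        by (rule prod.cong) (auto simp: mdelta_def dest!: dvd_imp_le)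
      also have "\<dots> = fact (p - 1)" by (simp add: fact_prod)
      finally show ?thesis .
    qed
    ultimately show ?thesis
      using wilson_theorem[OF assms] cong_trans by (simp add: mdelta_def) blast
  qed
  have "(\<Prod>b<p. op_unit n l p (int b)) = (\<Prod>k=1..n. \<Prod>b<p. (int b - l k) + mdelta p (l k) (int b))"
    unfolding op_unit_def by (rule prod.swap)
  also have "[\<dots> = (\<Prod>k=1..n. - 1)] (mod int p)"
    by (intro cong_prod factor)
  finally show ?thesis by simp
qed

text \<open>Column b of D is \<open>op_unit\<close> times column b of 1 + X: away from the roots of
  P modulo p \<open>op_unit\<close> is P and the diagonal of 1 + X starts with 1, at a root this 1
  is removed and P(b) vanishes modulo p. The column factors are then pulled out of the
  determinant.\<close>

lemma mdet_diff_op_cong: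
  assumes p: "prime p" "2 < p"
  shows "pmcong p (op_det n m l p)
    (of_int ((- 1) ^ n) * mdet p (\<lambda>a b. (if a = b then 1 else 0) + op_red n m l p a b))"
proof -
  have inv: "[op_unit n l p b * op_inv n l p b = 1] (mod int p)" for b
  proof -
    have "[((b - c) + mdelta p c b) * (minv p c b + mdelta p c b) = 1] (mod int p)" for c
    proof (cases "int p dvd b - c")
      case True
      then have "[((b - c) + mdelta p c b) * (minv p c b + mdelta p c b) = (0 + 1) * (0 + 1)] (mod int p)"
        using minv_zero[OF p(2) True] by (intro cong_mult cong_add) (auto simp: mdelta_def cong_0_iff)
      then show ?thesis by simp
    next
      case False
      then show ?thesis using minv_mult[OF p, of b c] by (simp add: mdelta_def)
    qed
    then have "[(\<Prod>k=1..n. ((b - l k) + mdelta p (l k) b) * (minv p (l k) b + mdelta p (l k) b)) = (\<Prod>k=1..n. 1)] (mod int p)"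
      by (intro cong_prod)
    then show ?thesis by (simp add: op_unit_def op_inv_def prod.distrib)
  qed
  have root: "[op_unit n l p b * (1 - op_root n l p b) = (\<Prod>k=1..n. b - l k)] (mod int p)" for b
  proof -
    have "[((b - c) + mdelta p c b) * (1 - mdelta p c b) = b - c] (mod int p)" for c
      by (auto simp: mdelta_def cong_0_iff cong_sym_eq[of 0])
    then have "[(\<Prod>k=1..n. ((b - l k) + mdelta p (l k) b) * (1 - mdelta p (l k) b)) = (\<Prod>k=1..n. b - l k)] (mod int p)"
      by (intro cong_prod)
    then show ?thesis by (simp add: op_unit_def op_root_def prod.distrib)
  qed
  let ?A = "\<lambda>a b. (if a = b then 1 else 0) + op_red n m l p a b"
  have "pmcong p (fps_nth (diff_op n m l (fps_X ^ b)) a) (of_int (op_unit n l p (int b)) * ?A a b)" for a b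
  proof -
    have "of_int (op_unit n l p (int b)) * ?A a b =
       (if a = b then of_int (op_unit n l p (int b) * (1 - op_root n l p (int b))) else 0) +
       of_int (op_unit n l p (int b) * op_inv n l p (int b)) * op_entry m a b"
      by (simp add: op_red_def algebra_simps)
    moreover have "pmcong p (if a = b then of_int (\<Prod>k=1..n. int b - l k) else 0)
       (if a = b then of_int (op_unit n l p (int b) * (1 - op_root n l p (int b))) else 0 :: tpoly)"
      using pmcong_of_int[OF cong_sym[OF root]] by (cases "a = b") (simp_all only: if_True if_False pmcong_refl refl)
    moreover have "pmcong p (op_entry m a b) (of_int (op_unit n l p (int b) * op_inv n l p (int b)) * op_entry m a b)"
      using pmcong_mult[OF pmcong_of_int[OF cong_sym[OF inv[of "int b"]]] pmcong_refl[of p "op_entry m a b"]] by simp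
    ultimately show ?thesis unfolding diff_op_nth by (simp add: pmcong_add)
  qed
  then have "pmcong p (op_det n m l p)
     (mdet p (\<lambda>a b. of_int (op_unit n l p (int b)) * ?A a b))"
    by (intro pmcong_mdet)
  also have "mdet p (\<lambda>a b. of_int (op_unit n l p (int b)) * ?A a b) = of_int (\<Prod>b<p. op_unit n l p (int b)) * mdet p ?A"
    by (subst mdet_scale_columns) simp
  also have "pmcong p \<dots> (of_int ((- 1) ^ n) * mdet p ?A)"
    by (intro pmcong_mult pmcong_of_int pmcong_refl prod_op_unit p)
  finally show ?thesis .
qed

section \<open>Powers of X as sums over paths\<close>

text \<open>The weight i - j of t_ij is the amount by which its term of D shifts the exponent of
  x.\<close>

definition twt :: "(nat \<times> nat \<Rightarrow>\<^sub>0 nat) \<Rightarrow> int" where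
  "twt = wsum (\<lambda>(i, j). int i - int j)"

text \<open>On \<open>0 \<le> b < p\<close> this is the indicator function of \<open>0 \<le> b + w < p\<close> (lemma \<open>window_eq\<close>), written in a
  \<open>p\<close>-periodic form with finitely many exceptional points independent of \<open>p\<close>.\<close>

definition window :: "nat \<Rightarrow> int \<Rightarrow> int \<Rightarrow> int" where
  "window p w b = 1 - (\<Sum>c\<in>{0..<- w} \<union> {- w..<0}. mdelta p c b)"

text \<open>For w < 0 the excluded b are 0, ..., -w-1. For w > 0 they are p-w, ..., p-1, represented
  by c = b - p between -w and -1, a range free of p. Since b - c lies strictly between -p and 2p, no
  other c is congruent to b.\<close>

lemma window_eq:
  assumes b: "0 \<le> b" "b < int p" and w: "\<bar>w\<bar> \<le> int p"
  shows "window p w b = (if 0 \<le> b + w \<and> b + w < int p then 1 else 0)"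
proof -
  let ?E = "{0..<- w} \<union> {- w..<0}"
  have "mdelta p c b = (if c = b then 1 else 0) + (if c = b - int p then 1 else 0)" if "c \<in> ?E" for c
  proof (cases "int p dvd b - c")
    case True
    then obtain k where k: "b - c = int p * k" by (elim dvdE)
    have "- int p < b - c" "b - c < int p * 2" using b w that by auto
    then have "int p * (- 1) < int p * k" "int p * k < int p * 2" using k by auto
    then have "- 1 < k" "k < 2" by (auto intro: mult_left_less_imp_less[of "int p"] simp del: mult_minus_right)
    then have "k = 0 \<or> k = 1" by auto
    then show ?thesis using True k b by (auto simp: mdelta_def)
  next
    case False
    then have "c \<noteq> b" "c \<noteq> b - int p" by auto
    then show ?thesis using False by (simp add: mdelta_def)
  qed
  then have "(\<Sum>c\<in>?E. mdelta p c b) = (\<Sum>c\<in>?E. (if c = b then 1 else 0) + (if c = b - int p then 1 else 0))"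
    by (intro sum.cong) auto
  also have "\<dots> = (if b \<in> ?E then 1 else 0) + (if b - int p \<in> ?E then 1 else 0)"
    by (simp add: sum.distrib)
  finally show ?thesis using b w by (auto simp: window_def)
qed

text \<open>Coefficient \<open>\<beta>\<close> of \<open>X\<close> vanishes off the diagonal \<open>a - b = twt \<beta>\<close>, on which it is
  \<open>step_fun \<beta>\<close>, a function of \<open>b\<close>; likewise \<open>path_fun k \<beta>\<close> for the power \<open>X\<^sup>k\<close>.\<close>

definition step_fun :: "nat \<Rightarrow> nat \<Rightarrow> (nat \<Rightarrow> int) \<Rightarrow> (nat \<times> nat \<Rightarrow>\<^sub>0 nat) \<Rightarrow> nat \<Rightarrow> int \<Rightarrow> int" where
  "step_fun n m l \<beta> p b =
    (if \<beta> = 0 then - op_root n l p b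
     else if \<exists>i j. j \<le> m \<and> \<beta> = Poly_Mapping.single (i, j) 1
       then ffac (snd (the_elem (Poly_Mapping.keys \<beta>))) b * op_inv n l p b * window p (twt \<beta>) b
     else 0)"

lemma single_one_neq_zero [simp]: "Poly_Mapping.single x (Suc 0) \<noteq> 0" "0 \<noteq> Poly_Mapping.single x (Suc 0)"
  by (metis lookup_single_eq lookup_zero nat.distinct(1))+

lemma single_one_inject: "Poly_Mapping.single x (Suc 0) = Poly_Mapping.single y (Suc 0) \<longleftrightarrow> x = y"
  by (metis lookup_single_eq lookup_single_not_eq nat.distinct(1))

lemma lookup_op_entry:
  "Poly_Mapping.lookup (op_entry m a b) (Poly_Mapping.single (i, j) 1) =
    (if j \<le> m \<and> int a - int b = int i - int j then ffac j (int b) else 0)"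
proof -
  have "Poly_Mapping.lookup (op_entry m a b) (Poly_Mapping.single (i, j) 1) =
    (\<Sum>j'\<le>m. if j' = j \<and> int a - int b = int i - int j then ffac j (int b) else 0)"
    unfolding op_entry_def lookup_sum
  proof (rule sum.cong)
    fix j' assume "j' \<in> {..m}"
    show "Poly_Mapping.lookup (if b \<le> a + j' then of_int (ffac j' (int b)) * tvar (a + j' - b) j' else 0)
        (Poly_Mapping.single (i, j) 1) = (if j' = j \<and> int a - int b = int i - int j then ffac j (int b) else 0)"
      unfolding tvar_def by (auto simp: lookup_of_int_mult lookup_single when_def single_one_inject)
  qed simp
  then show ?thesis by (auto simp: sum.delta)
qed

lemma lookup_op_entry_zero:
  assumes "\<nexists>i j. j \<le> m \<and> \<beta> = Poly_Mapping.single (i, j) 1"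
  shows "Poly_Mapping.lookup (op_entry m a b) \<beta> = 0"
  using assms unfolding op_entry_def lookup_sum tvar_def
  by (intro sum.neutral) (auto simp: lookup_of_int_mult lookup_single when_def)

lemma twt_single: "twt (Poly_Mapping.single (i, j) (Suc 0)) = int i - int j"
  by (simp add: twt_def)

text \<open>On the diagonal the target b + twt \<beta> is the row a < p, so the window is 1 there.
  Its value matters only at those b for which no such row exists.\<close>

lemma lookup_op_red:
  assumes "a < p" "b < p" "\<bar>twt \<beta>\<bar> \<le> int p"
  shows "Poly_Mapping.lookup (op_red n m l p a b) \<beta> =
    (if int a - int b = twt \<beta> then step_fun n m l \<beta> p (int b) else 0)"
proof -
  consider "\<beta> = 0" | i j where "j \<le> m" "\<beta> = Poly_Mapping.single (i, j) 1"
    | "\<beta> \<noteq> 0" "\<nexists>i j. j \<le> m \<and> \<beta> = Poly_Mapping.single (i, j) 1" by blast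
  then show ?thesis
  proof cases
    case 1
    have "Poly_Mapping.lookup (op_entry m a b) 0 = 0" by (rule lookup_op_entry_zero) auto
    with 1 show ?thesis
      by (auto simp: op_red_def lookup_minus lookup_of_int_mult lookup_of_int step_fun_def twt_def lookup_op_entry_zero)
  next
    case (2 i j)
    have "window p (twt \<beta>) (int b) = 1" if "int a - int b = twt \<beta>"
      using assms that by (subst window_eq) auto
    then show ?thesis using 2
      by (auto simp: op_red_def lookup_minus lookup_of_int_mult lookup_of_int lookup_op_entry[unfolded One_nat_def]
          step_fun_def twt_single mult.commute[of "op_inv n l p (int b)"] single_one_inject)
  next
    case 3
    then show ?thesis
      by (auto simp: op_red_def lookup_minus lookup_of_int_mult lookup_of_int step_fun_def lookup_op_entry_zero)
  qed
qed

lemma step_fun_window: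
  assumes "0 \<le> b" "b < int p" "\<bar>twt \<beta>\<bar> \<le> int p" "\<not> (0 \<le> b + twt \<beta> \<and> b + twt \<beta> < int p)"
  shows "step_fun n m l \<beta> p b = 0"
  using assms window_eq[OF assms(1-3)] by (auto simp: step_fun_def twt_def)

fun path_fun :: "nat \<Rightarrow> nat \<Rightarrow> (nat \<Rightarrow> int) \<Rightarrow> nat \<Rightarrow> (nat \<times> nat \<Rightarrow>\<^sub>0 nat) \<Rightarrow> nat \<Rightarrow> int \<Rightarrow> int" where
  "path_fun n m l 0 \<beta> p b = (if \<beta> = 0 then 1 else 0)"
| "path_fun n m l (Suc k) \<beta> p b =
    (\<Sum>(\<gamma>, \<delta>)\<in>{(\<gamma>, \<delta>). \<gamma> + \<delta> = \<beta>}. step_fun n m l \<gamma> p (b + twt \<delta>) * path_fun n m l k \<delta> p b)"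

lemma twt_add: "twt (\<alpha> + \<beta>) = twt \<alpha> + twt \<beta>"
  by (simp add: twt_def wsum_add)

text \<open>Bounds the weights of all divisors of \<beta>, hence of all partial products along a
  path with total monomial \<beta>: such a path never strays further than W from its starting
  point.\<close>

definition narrow :: "nat \<Rightarrow> (nat \<times> nat \<Rightarrow>\<^sub>0 nat) \<Rightarrow> bool" where
  "narrow W \<beta> \<longleftrightarrow> (\<forall>\<gamma> \<delta>. \<gamma> + \<delta> = \<beta> \<longrightarrow> \<bar>twt \<gamma>\<bar> \<le> int W)"

lemma narrow_weight: "narrow W \<beta> \<Longrightarrow> \<bar>twt \<beta>\<bar> \<le> int W"
  unfolding narrow_def by (metis add.right_neutral)

lemma narrow_summands: "narrow W (\<gamma> + \<delta>) \<Longrightarrow> narrow W \<gamma> \<and> narrow W \<delta>"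
proof -
  assume *: "narrow W (\<gamma> + \<delta>)"
  have "\<bar>twt \<alpha>\<bar> \<le> int W" if "\<gamma> = \<alpha> + \<beta>" for \<alpha> \<beta>
    using *[unfolded narrow_def, rule_format, of \<alpha> "\<beta> + \<delta>"] that by (simp add: add.assoc)
  moreover have "\<bar>twt \<alpha>\<bar> \<le> int W" if "\<delta> = \<alpha> + \<beta>" for \<alpha> \<beta>
    using *[unfolded narrow_def, rule_format, of \<alpha> "\<beta> + \<gamma>"] that by (simp add: ac_simps)
  ultimately show ?thesis unfolding narrow_def by blast
qed

lemma narrow_mono: "narrow W \<beta> \<Longrightarrow> W \<le> W' \<Longrightarrow> narrow W' \<beta>"
  unfolding narrow_def by fastforce

text \<open>If the path is already outside before its last step, the shorter path gives 0 by
  induction; if it leaves with the last step, the window in \<open>step_fun\<close> gives 0.\<close>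

lemma path_fun_window:
  assumes "0 \<le> b" "b < int p" "narrow p \<beta>" "\<not> (0 \<le> b + twt \<beta> \<and> b + twt \<beta> < int p)"
  shows "path_fun n m l k \<beta> p b = 0"
  using assms(3,4)
proof (induction k arbitrary: \<beta>)
  case 0
  then show ?case using assms by (auto simp: twt_def)
next
  case (Suc k)
  have "step_fun n m l \<gamma> p (b + twt \<delta>) * path_fun n m l k \<delta> p b = 0" if \<beta>: "\<beta> = \<gamma> + \<delta>" for \<gamma> \<delta>
  proof (cases "0 \<le> b + twt \<delta> \<and> b + twt \<delta> < int p")
    case True
    then show ?thesis
      using Suc.prems narrow_weight[of p \<gamma>] narrow_summands[of p \<gamma> \<delta>] unfolding \<beta>
      by (subst step_fun_window) (auto simp: twt_add algebra_simps)
  next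
    case False
    then show ?thesis using Suc.IH[of \<delta>] Suc.prems narrow_summands[of p \<gamma> \<delta>] unfolding \<beta> by auto
  qed
  then show ?case by (auto intro!: sum.neutral)
qed

text \<open>For a factorisation of \<beta> into \<gamma> and \<delta> the inner index of the matrix
  product is forced to be b + twt \<delta>. The sum over p inner indices thus collapses, and only
  the sum over factorisations remains.\<close>

lemma lookup_mpow_op_red:
  assumes "a < p" "b < p" "narrow p \<beta>"
  shows "Poly_Mapping.lookup (mpow p (op_red n m l p) k a b) \<beta> =
    (if int a - int b = twt \<beta> then path_fun n m l k \<beta> p (int b) else 0)"
  using assms(1,3)
proof (induction k arbitrary: a \<beta>)
  case 0
  then show ?case by (auto simp: lookup_one when_def twt_def)
next
  case (Suc k)
  let ?S = "{(\<gamma>, \<delta>). \<gamma> + \<delta> = \<beta>}"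
  have "Poly_Mapping.lookup (mpow p (op_red n m l p) (Suc k) a b) \<beta> =
      (\<Sum>(\<gamma>, \<delta>)\<in>?S. \<Sum>c<p. Poly_Mapping.lookup (op_red n m l p a c) \<gamma> *
         Poly_Mapping.lookup (mpow p (op_red n m l p) k c b) \<delta>)"
    by (simp add: lookup_sum lookup_mult_summands case_prod_unfold sum.swap[of _ _ "{..<p}"])
  also have "\<dots> = (\<Sum>(\<gamma>, \<delta>)\<in>?S. if int a - int b = twt \<beta> then
      step_fun n m l \<gamma> p (int b + twt \<delta>) * path_fun n m l k \<delta> p (int b) else 0)"
  proof (rule sum.cong, simp, clarify)
    fix \<gamma> \<delta> assume \<beta>: "\<beta> = \<gamma> + \<delta>"
    have nar: "narrow p \<gamma>" "narrow p \<delta>" using narrow_summands[of p \<gamma> \<delta>] Suc.prems \<beta> by auto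
    have "(\<Sum>c<p. Poly_Mapping.lookup (op_red n m l p a c) \<gamma> *
         Poly_Mapping.lookup (mpow p (op_red n m l p) k c b) \<delta>) =
       (\<Sum>c<p. if int c = int b + twt \<delta> then (if int a - int b = twt \<beta> then
         step_fun n m l \<gamma> p (int b + twt \<delta>) * path_fun n m l k \<delta> p (int b) else 0) else 0)"
    proof (rule sum.cong)
      fix c assume c: "c \<in> {..<p}"
      show "Poly_Mapping.lookup (op_red n m l p a c) \<gamma> * Poly_Mapping.lookup (mpow p (op_red n m l p) k c b) \<delta> =
        (if int c = int b + twt \<delta> then (if int a - int b = twt \<beta> then
         step_fun n m l \<gamma> p (int b + twt \<delta>) * path_fun n m l k \<delta> p (int b) else 0) else 0)"
        using c Suc.prems Suc.IH[of c \<delta>] nar narrow_weight[of p \<gamma>] lookup_op_red[of a p c \<gamma> n m l]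
        by (auto simp: \<beta> twt_add)
    qed simp
    also have "\<dots> = (if int a - int b = twt \<beta> then
         step_fun n m l \<gamma> p (int b + twt \<delta>) * path_fun n m l k \<delta> p (int b) else 0)"
    proof (cases "0 \<le> int b + twt \<delta> \<and> int b + twt \<delta> < int p")
      case True
      then have "int c = int b + twt \<delta> \<longleftrightarrow> c = nat (int b + twt \<delta>)" for c by auto
      then show ?thesis using True by (simp add: nat_less_iff)
    next
      \<comment> \<open>Then no c < p equals b + twt \<delta>, and on the other side the factor
        \<open>path_fun\<close> is zero.\<close>
      case False
      then show ?thesis using path_fun_window[OF _ _ nar(2), of "int b"] assms by (auto intro!: sum.neutral)
    qed
    finally show "(\<Sum>c<p. Poly_Mapping.lookup (op_red n m l p a c) \<gamma> *
         Poly_Mapping.lookup (mpow p (op_red n m l p) k c b) \<delta>) = (if int a - int b = twt (\<gamma> + \<delta>) then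
         step_fun n m l \<gamma> p (int b + twt \<delta>) * path_fun n m l k \<delta> p (int b) else 0)"
      by (simp only: \<beta>)
  qed
  finally show ?case by (auto simp: case_prod_unfold)
qed

subsection \<open>Coefficients of the determinant\<close>

text \<open>The falling factorial contributes degree at most m, the n simple poles contribute n.
  Root indicator and window are built from constants and point masses and add nothing to the degree;
  their points are the reason for both bounds by r.\<close>

lemma rational_family_step_fun:
  assumes N: "2 * r \<le> N" "2 \<le> N"
    and l: "\<And>k. k \<in> {1..n} \<Longrightarrow> \<bar>l k\<bar> \<le> int r" and \<beta>: "\<bar>twt \<beta>\<bar> \<le> int r"
  shows "rational_family N r (m + n) (step_fun n m l \<beta>)"
proof -
  have one: "rational_family N r s (\<lambda>p b. 1)" for s
    by (rule rational_family_const) simp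
  have "rational_family N r (card {1..n} * 0) (\<lambda>p b. \<Prod>k=1..n. 1 - mdelta p (l k) b)"
    by (intro rational_family_prod N rational_family_diff one rational_family_mdelta l) auto
  from rational_family_diff[OF this one]
  have "rational_family N r 0 (\<lambda>p b. - op_root n l p b)"
    by (simp add: op_root_def)
  then have root: "rational_family N r (m + n) (\<lambda>p b. - op_root n l p b)"
    by (rule rational_family_mono) auto
  have "rational_family N r (card {1..n} * 1) (\<lambda>p b. \<Prod>k=1..n. minv p (l k) b + mdelta p (l k) b)"
    by (intro rational_family_prod N rational_family.add rational_family_minv rational_family_mdelta l) auto
  then have inv: "rational_family N r n (\<lambda>p b. op_inv n l p b)"
    by (simp add: op_inv_def)
  have "rational_family N r (card {..<j} * 1) (\<lambda>p b. \<Prod>u<j. b - int u)" for j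
    by (intro rational_family_prod N rational_family_diff rational_family_id rational_family_const) auto
  then have ffac: "rational_family N r j (\<lambda>p b. ffac j b)" for j
    by (simp add: ffac_def)
  have win: "rational_family N r 0 (\<lambda>p b. window p (twt \<beta>) b)"
    unfolding window_def
    by (intro rational_family_diff rational_family_sum one rational_family_mdelta) (use \<beta> in auto)
  have "rational_family N r (m + n) (\<lambda>p b. ffac j b * op_inv n l p b * window p (twt \<beta>) b)" if "j \<le> m" for j
    by (rule rational_family_mono[OF rational_family_mult[OF N rational_family_mult[OF N ffac inv] win]])
      (use that in auto)
  note step = this
  consider "\<beta> = 0" | i j where "\<beta> \<noteq> 0" "j \<le> m" "\<beta> = Poly_Mapping.single (i, j) 1"
    | "\<beta> \<noteq> 0" "\<nexists>i j. j \<le> m \<and> \<beta> = Poly_Mapping.single (i, j) 1" by blast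
  then show ?thesis
  proof cases
    case 1
    then have "step_fun n m l \<beta> = (\<lambda>p b. - op_root n l p b)" by (intro ext) (simp add: step_fun_def)
    then show ?thesis using root by simp
  next
    case (2 i j)
    then have "\<exists>i j. j \<le> m \<and> \<beta> = Poly_Mapping.single (i, j) 1" "snd (the_elem (Poly_Mapping.keys \<beta>)) = j" by auto
    then have "step_fun n m l \<beta> = (\<lambda>p b. ffac j b * op_inv n l p b * window p (twt \<beta>) b)"
      using \<open>\<beta> \<noteq> 0\<close> by (intro ext) (simp only: step_fun_def if_True if_False)
    then show ?thesis using step[OF 2(2)] by simp
  next
    case 3
    then have "step_fun n m l \<beta> = (\<lambda>p b. 0)" by (intro ext) (simp only: step_fun_def if_False)
    then show ?thesis by (simp add: rational_family_zero)
  qed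
qed

context
  fixes n m :: nat and l :: "nat \<Rightarrow> int" and N r W K :: nat
  assumes r: "\<And>k. k \<in> {1..n} \<Longrightarrow> \<bar>l k\<bar> \<le> int r" "W \<le> r"
    and N: "2 * (r + W) \<le> N" "2 \<le> N" "K \<le> N" "K * (m + n) + 2 \<le> N"
begin

text \<open>Each step adds m + n to the degree. It is evaluated at b + twt \<delta>, with a shift of
  at most W, so the poles stay within r + W for every k.\<close>

lemma rational_family_path_fun:
  "narrow W \<beta> \<Longrightarrow> rational_family N (r + W) (k * (m + n)) (path_fun n m l k \<beta>)"
proof (induction k arbitrary: \<beta>)
  case 0
  have "path_fun n m l 0 \<beta> = (\<lambda>p b. if \<beta> = 0 then 1 else 0)" by (intro ext) simp
  then show ?case by (auto intro!: rational_family_const)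
next
  case (Suc k)
  have "rational_family N (r + W) (Suc k * (m + n))
      (\<lambda>p b. step_fun n m l \<gamma> p (b + twt \<delta>) * path_fun n m l k \<delta> p b)" if \<beta>: "\<gamma> + \<delta> = \<beta>" for \<gamma> \<delta>
  proof -
    have nar: "narrow W \<gamma>" "narrow W \<delta>" using narrow_summands[of W \<gamma> \<delta>] Suc.prems \<beta> by auto
    have "rational_family N r (m + n) (step_fun n m l \<gamma>)"
      using narrow_weight[OF nar(1)] r N by (intro rational_family_step_fun) auto
    from rational_family_shift[OF this, of "twt \<delta>"]
    have "rational_family N (r + nat \<bar>twt \<delta>\<bar>) (m + n) (\<lambda>p b. step_fun n m l \<gamma> p (b + twt \<delta>))"
      using narrow_weight[OF nar(2)] N by auto
    then have "rational_family N (r + W) (m + n) (\<lambda>p b. step_fun n m l \<gamma> p (b + twt \<delta>))"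
      by (rule rational_family_mono) (use narrow_weight[OF nar(2)] in auto)
    from rational_family_mult[OF N(1,2) this Suc.IH[OF nar(2)]] show ?thesis by simp
  qed
  then have "rational_family N (r + W) (Suc k * (m + n))
    (\<lambda>p b. \<Sum>x\<in>{(\<gamma>, \<delta>). \<gamma> + \<delta> = \<beta>}. step_fun n m l (fst x) p (b + twt (snd x)) * path_fun n m l k (snd x) p b)"
    by (intro rational_family_sum) auto
  moreover have "path_fun n m l (Suc k) \<beta> = (\<lambda>p b. \<Sum>x\<in>{(\<gamma>, \<delta>). \<gamma> + \<delta> = \<beta>}.
      step_fun n m l (fst x) p (b + twt (snd x)) * path_fun n m l k (snd x) p b)"
    by (intro ext) (simp add: case_prod_unfold)
  ultimately show ?case by simp
qed

text \<open>Diagonal entries only see monomials of weight 0, and there the trace is the sum of a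
  rational family over b < p. The bound \<open>K * (m + n) + 2 \<le> N\<close> is what the vanishing
  of its power sums needs.\<close>

lemma uniform_trace:
  assumes "narrow W \<beta>" "k \<le> K"
  shows "uniform N (\<lambda>p. Poly_Mapping.lookup (\<Sum>j<p. mpow p (op_red n m l p) k j j) \<beta>)"
proof (rule uniform_cong)
  have "k * (m + n) \<le> K * (m + n)" using assms(2) by (rule mult_right_mono) simp
  then have "k * (m + n) + 2 \<le> N" using N by linarith
  then have "uniform N (\<lambda>p. \<Sum>j<p. path_fun n m l k \<beta> p (int j))"
    by (rule rational_family_uniform_sum[OF N(1,2) rational_family_path_fun[OF assms(1)]])
  then show "uniform N (\<lambda>p. if twt \<beta> = 0 then (\<Sum>j<p. path_fun n m l k \<beta> p (int j)) else 0)"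
    by (cases "twt \<beta> = 0") simp_all
next
  fix p :: nat assume "prime p" "N < p"
  then have "narrow p \<beta>" using assms(1) N r by (auto intro: narrow_mono)
  then have "Poly_Mapping.lookup (\<Sum>j<p. mpow p (op_red n m l p) k j j) \<beta> =
      (if twt \<beta> = 0 then (\<Sum>j<p. path_fun n m l k \<beta> p (int j)) else 0)"
    by (simp add: lookup_sum lookup_mpow_op_red)
  then show "[if twt \<beta> = 0 then (\<Sum>j<p. path_fun n m l k \<beta> p (int j)) else 0 =
      Poly_Mapping.lookup (\<Sum>j<p. mpow p (op_red n m l p) k j j) \<beta>] (mod int p)"
    by simp
qed

text \<open>Strong induction along Newton's identities; all factorisations of a narrow monomial are
  narrow. The final division by k is allowed because k \<le> K \<le> N < p.\<close>

lemma uniform_echar: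
  "narrow W \<beta> \<Longrightarrow> k \<le> K \<Longrightarrow> uniform N (\<lambda>p. Poly_Mapping.lookup (echar p (op_red n m l p) k) \<beta>)"
proof (induction k arbitrary: \<beta> rule: less_induct)
  case (less k)
  show ?case
  proof (cases k)
    case 0
    then show ?thesis by (simp add: echar_zero lookup_one)
  next
    case (Suc k')
    have "uniform N (\<lambda>p. Poly_Mapping.lookup ((- 1) ^ i * echar p (op_red n m l p) (k' - i) *
        (\<Sum>j<p. mpow p (op_red n m l p) (Suc i) j j)) \<beta>)" if "i \<le> k'" for i
    proof -
      have "(- 1) ^ i * x * y = of_int ((- 1) ^ i) * (x * y)" for x y :: tpoly
        by (simp add: mult.assoc)
      moreover have "uniform N (\<lambda>p. (- 1) ^ i * (\<Sum>z\<in>{(\<gamma>, \<delta>). \<gamma> + \<delta> = \<beta>}.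
          Poly_Mapping.lookup (echar p (op_red n m l p) (k' - i)) (fst z) *
          Poly_Mapping.lookup (\<Sum>j<p. mpow p (op_red n m l p) (Suc i) j j) (snd z)))"
      proof (rule uniform_mult[OF uniform_const uniform_sum])
        fix z assume "z \<in> {(\<gamma>, \<delta>). \<gamma> + \<delta> = \<beta>}"
        then have "narrow W (fst z)" "narrow W (snd z)"
          using narrow_summands[of W "fst z" "snd z"] less.prems by auto
        then show "uniform N (\<lambda>p. Poly_Mapping.lookup (echar p (op_red n m l p) (k' - i)) (fst z) *
            Poly_Mapping.lookup (\<Sum>j<p. mpow p (op_red n m l p) (Suc i) j j) (snd z))"
          using less.prems that Suc by (intro uniform_mult[OF less.IH uniform_trace]) auto
      qed
      ultimately show ?thesis
        by (simp only: lookup_of_int_mult) (simp only: lookup_mult_summands case_prod_unfold)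
    qed
    then have "uniform N (\<lambda>p. Poly_Mapping.lookup (of_int (int k) * echar p (op_red n m l p) k) \<beta>)"
      unfolding Suc of_int_of_nat_eq newton_echar lookup_sum by (intro uniform_sum) auto
    then have "uniform N (\<lambda>p. int k * Poly_Mapping.lookup (echar p (op_red n m l p) k) \<beta>)"
      by (simp only: lookup_of_int_mult)
    then show ?thesis
    proof (rule uniform_divide)
      show "\<not> int p dvd int k" if "prime p" "N < p" for p
        using that less.prems N Suc dvd_int_less[of "int k" p] by auto
    qed (use Suc in auto)
  qed
qed

text \<open>Setting y = 1 in det(1 + y X) leaves a sum over k whose length varies with p. The degree
  bound shows that at \<beta> only k \<le> K contribute, which is a fixed finite sum of uniform
  terms.\<close>

lemma uniform_lookup_mdet:
  assumes "narrow W \<beta>" and K: "wsum (\<lambda>_. 1) \<beta> + int n \<le> int K"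
  shows "uniform N (\<lambda>p. Poly_Mapping.lookup (op_det n m l p) \<beta>)"
proof (rule uniform_cong)
  show "uniform N (\<lambda>p. (- 1) ^ n * (\<Sum>k\<le>K. Poly_Mapping.lookup (echar p (op_red n m l p) k) \<beta>))"
    by (intro uniform_mult uniform_const uniform_sum uniform_echar assms) auto
next
  fix p :: nat assume p: "prime p" "N < p"
  let ?P = "mdet p (\<lambda>i j. [:if i = j then 1 else 0, op_red n m l p i j:])"
  have zero: "Poly_Mapping.lookup (echar p (op_red n m l p) k) \<beta> = 0" if "K < k" for k
  proof (rule ccontr)
    assume nz: "Poly_Mapping.lookup (echar p (op_red n m l p) k) \<beta> \<noteq> 0"
    \<comment> \<open>Row i of X has constant terms only if i is congruent to some
      \<open>l k\<close>; the allowance counts these k. Each of the n roots is met by exactly one i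
      < p, so the total is n.\<close>
    have "int k \<le> wsum (\<lambda>_. 1) \<beta> + (\<Sum>i<p. \<Sum>k=1..n. mdelta p (l k) (int i))"
    proof (rule echar_degree_bound[OF _ _ nz])
      show nonneg: "0 \<le> (\<Sum>k=1..n. mdelta p (l k) (int i))" for i
        by (intro sum_nonneg) (simp add: mdelta_def)
      fix i j \<gamma> assume ij: "i < p" "j < p" and *: "Poly_Mapping.lookup (op_red n m l p i j) \<gamma> \<noteq> 0"
      show "1 \<le> wsum (\<lambda>_. 1) \<gamma> + (\<Sum>k=1..n. mdelta p (l k) (int i))"
      proof (cases "\<gamma> = 0")
        case True
        have "twt \<gamma> = 0" using True by (simp add: twt_def)
        then have "i = j" "op_root n l p (int i) \<noteq> 0"
          using * lookup_op_red[OF ij, of \<gamma> n m l] True by (auto simp: step_fun_def split: if_splits)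
        then obtain k where k: "k \<in> {1..n}" "mdelta p (l k) (int i) \<noteq> 0"
          unfolding op_root_def by (metis (no_types, lifting) diff_0_right diff_self prod.neutral)
        then have "1 \<le> mdelta p (l k) (int i)" by (simp add: mdelta_def split: if_splits)
        also have "\<dots> \<le> (\<Sum>k=1..n. mdelta p (l k) (int i))"
          using k by (intro member_le_sum) (auto simp: mdelta_def)
        finally show ?thesis using True by simp
      next
        case False
        then show ?thesis using degree_pos[of \<gamma>] nonneg[of i] by linarith
      qed
    qed
    also have "(\<Sum>i<p. \<Sum>k=1..n. mdelta p (l k) (int i)) = int n"
      using p by (subst sum.swap) (simp add: mdelta_sum)
    finally show False using K that by simp
  qed
  have "Poly_Mapping.lookup (mdet p (\<lambda>a b. (if a = b then 1 else 0) + op_red n m l p a b)) \<beta> =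
      (\<Sum>k\<le>degree ?P. Poly_Mapping.lookup (echar p (op_red n m l p) k) \<beta>)"
    by (simp add: mdet_one_plus lookup_sum)
  \<comment> \<open>The degree of \<open>?P\<close> varies with p and may lie on either side of
    K.\<close>
  also have "\<dots> = (\<Sum>k\<le>max K (degree ?P). Poly_Mapping.lookup (echar p (op_red n m l p) k) \<beta>)"
    by (rule sum.mono_neutral_left) (auto simp: echar_def coeff_eq_0)
  also have "\<dots> = (\<Sum>k\<le>K. Poly_Mapping.lookup (echar p (op_red n m l p) k) \<beta>)"
    by (rule sum.mono_neutral_right) (auto simp: zero)
  finally have e: "Poly_Mapping.lookup (mdet p (\<lambda>a b. (if a = b then 1 else 0) + op_red n m l p a b)) \<beta> =
      (\<Sum>k\<le>K. Poly_Mapping.lookup (echar p (op_red n m l p) k) \<beta>)" .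
  have "2 < p" using p N by simp
  from mdet_diff_op_cong[OF p(1) this, of n m l, unfolded pmcong_def, rule_format, of \<beta>]
  show "[(- 1) ^ n * (\<Sum>k\<le>K. Poly_Mapping.lookup (echar p (op_red n m l p) k) \<beta>) =
      Poly_Mapping.lookup (op_det n m l p) \<beta>] (mod int p)"
    unfolding lookup_of_int_mult e by (rule cong_sym)
qed

end

section \<open>Bounds by the degree in the generators of I\<close>

definition idegree :: "(nat \<times> nat \<Rightarrow>\<^sub>0 nat) \<Rightarrow> int" where
  "idegree = wsum (\<lambda>(i, j). if i \<le> j then 1 else 0)"

text \<open>The conditions that every monomial of the determinant satisfies. The second one, stated
  as a weight, says that no variable with j > m occurs.\<close>

definition admissible :: "nat \<Rightarrow> (nat \<times> nat \<Rightarrow>\<^sub>0 nat) \<Rightarrow> bool" where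
  "admissible m \<alpha> \<longleftrightarrow> twt \<alpha> = 0 \<and> wsum (\<lambda>(i, j). if m < j then 1 else 0) \<alpha> = 0"

lemma idegree_nonneg: "0 \<le> idegree \<alpha>"
  unfolding idegree_def by (rule wsum_nonneg) auto

lemma admissible_keys:
  assumes "admissible m \<alpha>" "(i, j) \<in> Poly_Mapping.keys \<alpha>"
  shows "j \<le> m"
proof (rule ccontr)
  assume "\<not> j \<le> m"
  have "(case x of (i, j) \<Rightarrow> if m < j then 1 else 0) * int (Poly_Mapping.lookup \<alpha> x) = 0"
    if "x \<in> Poly_Mapping.keys \<alpha>" for x
    using assms(1) that unfolding admissible_def wsum_def
    by (subst (asm) sum_nonneg_eq_0_iff) auto
  from this[OF assms(2)] show False using assms(2) \<open>\<not> j \<le> m\<close> by (simp add: in_keys_iff)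
qed

text \<open>The positive and negative parts of the weight are kept apart: they are monotone under
  divisibility, while a divisor of a monomial of weight 0 may have any weight in between.\<close>

definition up_weight :: "(nat \<times> nat \<Rightarrow>\<^sub>0 nat) \<Rightarrow> int" where
  "up_weight = wsum (\<lambda>(i, j). if j < i then int i - int j else 0)"

definition down_weight :: "(nat \<times> nat \<Rightarrow>\<^sub>0 nat) \<Rightarrow> int" where
  "down_weight = wsum (\<lambda>(i, j). if i \<le> j then int j - int i else 0)"

lemma twt_up_down: "twt \<alpha> = up_weight \<alpha> - down_weight \<alpha>"
  unfolding twt_def up_weight_def down_weight_def wsum_def sum_subtractf[symmetric]
  by (rule sum.cong) (auto simp: algebra_simps)

text \<open>Weight 0 means that upward and downward weight agree, and a generator of I with j \<le>
  m contributes at most m downwards.\<close>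

lemma admissible_up_weight:
  assumes "admissible m \<alpha>"
  shows "up_weight \<alpha> \<le> int m * idegree \<alpha>"
proof -
  have "down_weight \<alpha> \<le> wsum (\<lambda>x. int m * (case x of (i, j) \<Rightarrow> if i \<le> j then 1 else 0)) \<alpha>"
    unfolding down_weight_def using admissible_keys[OF assms] by (intro wsum_mono) force
  then show ?thesis
    using assms unfolding admissible_def twt_up_down idegree_def by (simp add: wsum_cmult)
qed

lemma admissible_narrow:
  assumes "admissible m \<alpha>"
  shows "narrow (m * nat (idegree \<alpha>)) \<alpha>"
  unfolding narrow_def
proof (intro allI impI)
  fix \<beta> \<gamma> assume \<alpha>: "\<beta> + \<gamma> = \<alpha>"
  have "0 \<le> up_weight x" "0 \<le> down_weight x" for x
    unfolding up_weight_def down_weight_def by (auto intro!: wsum_nonneg)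
  from this(1)[of \<beta>] this(1)[of \<gamma>] this(2)[of \<beta>] this(2)[of \<gamma>]
  have "\<bar>twt \<beta>\<bar> \<le> max (up_weight \<alpha>) (down_weight \<alpha>)"
    unfolding twt_up_down \<alpha>[symmetric] up_weight_def down_weight_def wsum_add by auto
  also have "\<dots> = up_weight \<alpha>" using assms unfolding admissible_def twt_up_down by simp
  also have "\<dots> \<le> int (m * nat (idegree \<alpha>))"
    using admissible_up_weight[OF assms] idegree_nonneg[of \<alpha>] by simp
  finally show "\<bar>twt \<beta>\<bar> \<le> int (m * nat (idegree \<alpha>))" .
qed

text \<open>Each variable is either a generator of I, counted by \<open>idegree\<close>, or has i >
  j and upward weight at least 1.\<close>

lemma admissible_degree:
  assumes "admissible m \<alpha>"
  shows "wsum (\<lambda>_. 1) \<alpha> \<le> (int m + 1) * idegree \<alpha>"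
proof -
  have "wsum (\<lambda>_. 1) \<alpha> \<le> wsum (\<lambda>x. (case x of (i, j) \<Rightarrow> if j < i then int i - int j else 0) +
      (case x of (i, j) \<Rightarrow> if i \<le> j then 1 else 0)) \<alpha>"
    by (rule wsum_mono) auto
  also have "\<dots> = up_weight \<alpha> + idegree \<alpha>"
    unfolding up_weight_def idegree_def by (rule wsum_plus)
  finally show ?thesis using admissible_up_weight[OF assms] by (simp add: algebra_simps)
qed

lemma admissible_idegree_zero:
  assumes "admissible m \<alpha>" "idegree \<alpha> = 0"
  shows "\<alpha> = 0"
  using admissible_degree[OF assms(1)] degree_pos[of \<alpha>] assms(2) by fastforce

text \<open>R has infinitely many variables, but the upward weight also bounds the index i.
  Finiteness makes each component of L a finite sum.\<close>

lemma finite_admissible: "finite {\<alpha>. admissible m \<alpha> \<and> idegree \<alpha> < int k}"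
proof -
  let ?J = "{..m * k + m} \<times> {..m}" and ?D = "(m + 1) * k"
  let ?S = "{\<alpha>. admissible m \<alpha> \<and> idegree \<alpha> < int k}"
  have bounds: "Poly_Mapping.keys \<alpha> \<subseteq> ?J \<and> (\<forall>x. Poly_Mapping.lookup \<alpha> x \<le> ?D)" if "\<alpha> \<in> ?S" for \<alpha>
  proof -
    have adm: "admissible m \<alpha>" and k: "idegree \<alpha> \<le> int k" using that by auto
    have deg: "wsum (\<lambda>_. 1) \<alpha> \<le> int ?D"
    proof -
      have "(int m + 1) * idegree \<alpha> \<le> (int m + 1) * int k" using k by (intro mult_left_mono) auto
      then show ?thesis using admissible_degree[OF adm] by (simp add: algebra_simps)
    qed
    have up: "up_weight \<alpha> \<le> int (m * k)"
    proof -
      have "int m * idegree \<alpha> \<le> int m * int k" using k by (intro mult_left_mono) auto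
      then show ?thesis using admissible_up_weight[OF adm] by simp
    qed
    have "i \<le> m * k + m" "j \<le> m" if x: "(i, j) \<in> Poly_Mapping.keys \<alpha>" for i j
    proof -
      show j: "j \<le> m" using admissible_keys[OF adm x] .
      have pos: "1 \<le> int (Poly_Mapping.lookup \<alpha> (i, j))" using x by (simp add: in_keys_iff)
      have "int i - int j \<le> (case (i, j) of (i, j) \<Rightarrow> if j < i then int i - int j else 0) * int (Poly_Mapping.lookup \<alpha> (i, j))"
        using pos mult_left_mono[of 1 "int (Poly_Mapping.lookup \<alpha> (i, j))" "int i - int j"] by auto
      also have "\<dots> \<le> up_weight \<alpha>"
        unfolding up_weight_def wsum_def using x by (intro member_le_sum) auto
      finally show "i \<le> m * k + m" using up j by linarith
    qed
    moreover have "Poly_Mapping.lookup \<alpha> x \<le> ?D" for x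
      using lookup_le_degree[of \<alpha> x] deg by linarith
    ultimately show ?thesis by auto
  qed
  have "inj_on (\<lambda>\<alpha>. restrict (Poly_Mapping.lookup \<alpha>) ?J) ?S"
  proof (rule inj_onI, rule poly_mapping_eqI)
    fix \<beta> \<gamma> x
    assume *: "\<beta> \<in> ?S" "\<gamma> \<in> ?S" "restrict (Poly_Mapping.lookup \<beta>) ?J = restrict (Poly_Mapping.lookup \<gamma>) ?J"
    show "Poly_Mapping.lookup \<beta> x = Poly_Mapping.lookup \<gamma> x"
    proof (cases "x \<in> ?J")
      case True
      then show ?thesis using fun_cong[OF *(3), of x] by simp
    next
      case False
      then have "x \<notin> Poly_Mapping.keys \<beta>" "x \<notin> Poly_Mapping.keys \<gamma>"
        using bounds[OF *(1)] bounds[OF *(2)] by blast+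
      then show ?thesis by (simp add: in_keys_iff)
    qed
  qed
  moreover have "(\<lambda>\<alpha>. restrict (Poly_Mapping.lookup \<alpha>) ?J) ` ?S \<subseteq> PiE ?J (\<lambda>x. {..?D})"
  proof (rule image_subsetI)
    fix \<alpha> assume "\<alpha> \<in> ?S"
    from bounds[OF this] show "restrict (Poly_Mapping.lookup \<alpha>) ?J \<in> PiE ?J (\<lambda>x. {..?D})"
      by (simp only: restrict_PiE_iff) auto
  qed
  moreover have "finite (PiE ?J (\<lambda>x. {..?D}))"
    by (intro finite_PiE) auto
  ultimately show ?thesis by (rule inj_on_finite)
qed

lemma supported_mdet_diff_op:
  "supported (admissible m) (op_det n m l p)"
proof -
  have "supported (\<lambda>\<beta>. twt \<beta> = int a - int b \<and> wsum (\<lambda>(i, j). if m < j then 1 else 0) \<beta> = 0)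
      (fps_nth (diff_op n m l (fps_X ^ b)) a)" for a b
    unfolding diff_op_nth op_entry_def supported_def lookup_add lookup_sum
  proof (intro allI impI)
    fix \<beta>
    assume nz: "Poly_Mapping.lookup (if a = b then of_int (\<Prod>k=1..n. int b - l k) else 0) \<beta> +
        (\<Sum>j\<le>m. Poly_Mapping.lookup (if b \<le> a + j then of_int (ffac j (int b)) * tvar (a + j - b) j else 0) \<beta>) \<noteq> 0"
    show "twt \<beta> = int a - int b \<and> wsum (\<lambda>(i, j). if m < j then 1 else 0) \<beta> = 0"
    proof (cases "a = b \<and> \<beta> = 0")
      case True
      then show ?thesis by (simp add: twt_def)
    next
      case False
      then have "Poly_Mapping.lookup (if a = b then of_int (\<Prod>k=1..n. int b - l k) else 0) \<beta> = 0"
        by (auto simp: lookup_of_int simp del: of_int_prod)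
      then obtain j where "j \<le> m"
        "Poly_Mapping.lookup (if b \<le> a + j then of_int (ffac j (int b)) * tvar (a + j - b) j else 0) \<beta> \<noteq> 0"
        using nz by (metis (no_types, lifting) add_0 atMost_iff sum.not_neutral_contains_not_neutral)
      then have "j \<le> m" "b \<le> a + j" "\<beta> = Poly_Mapping.single (a + j - b, j) 1"
        by (auto simp: tvar_def lookup_of_int_mult lookup_single when_def split: if_splits)
      then show ?thesis by (simp add: twt_def)
    qed
  qed
  then have "supported (\<lambda>\<beta>. twt \<beta> = 0 \<and> wsum (\<lambda>(i, j). if m < j then 1 else 0) \<beta> = 0)
     (op_det n m l p)"
    unfolding twt_def by (intro supported_mdet_weight)
  then show ?thesis unfolding admissible_def .
qed

text \<open>Taking the constant term is multiplicative, so only the diagonal matrix of the values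
  P(b) remains. Its entry at the residue of \<open>l 1\<close> is divisible by p.\<close>

lemma lookup_zero_mdet_diff_op:
  assumes "prime p" "1 \<le> n"
  shows "int p dvd Poly_Mapping.lookup (op_det n m l p) 0"
proof -
  let ?M = "\<lambda>a b. fps_nth (diff_op n m l (fps_X ^ b)) a"
  have zero_sum: "{(\<gamma>, \<delta>). \<gamma> + \<delta> = (0 :: nat \<times> nat \<Rightarrow>\<^sub>0 nat)} = {(0, 0)}"
  proof -
    have "\<gamma> = 0 \<and> \<delta> = 0" if "\<gamma> + \<delta> = 0" for \<gamma> \<delta> :: "nat \<times> nat \<Rightarrow>\<^sub>0 nat"
      using that by (metis add_is_0 lookup_add lookup_zero poly_mapping_eqI)
    then have "\<gamma> + \<delta> = 0 \<longleftrightarrow> \<gamma> = 0 \<and> \<delta> = 0" for \<gamma> \<delta> :: "nat \<times> nat \<Rightarrow>\<^sub>0 nat"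
      by (metis add_0)
    then show ?thesis by (simp add: set_eq_iff)
  qed
  then have mult: "Poly_Mapping.lookup (f * g) 0 = Poly_Mapping.lookup f 0 * Poly_Mapping.lookup g 0" for f g :: tpoly
    by (simp add: lookup_mult_summands)
  have prod: "Poly_Mapping.lookup (\<Prod>i\<in>S. f i) 0 = (\<Prod>i\<in>S. Poly_Mapping.lookup (f i) 0)" for S :: "nat set" and f :: "nat \<Rightarrow> tpoly"
    by (induction S rule: infinite_finite_induct) (auto simp: mult lookup_one)
  have entry: "Poly_Mapping.lookup (?M a b) 0 = (if a = b then \<Prod>k=1..n. int b - l k else 0)" for a b
  proof -
    have "Poly_Mapping.lookup (op_entry m a b) 0 = 0" by (rule lookup_op_entry_zero) auto
    then show ?thesis unfolding diff_op_nth lookup_add by (simp add: lookup_of_int del: of_int_prod)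
  qed
  have p: "0 < p" using assms(1) prime_gt_0_nat by blast
  define b where "b = nat (l 1 mod int p)"
  have b: "b < p" "int b = l 1 mod int p" using p by (auto simp: b_def nat_less_iff)
  have "int p dvd (\<Prod>i<p. Poly_Mapping.lookup (?M i (\<sigma> i)) 0)" if "\<sigma> permutes {..<p}" for \<sigma>
  proof (rule dvd_trans[OF _ dvd_prodI[of _ b]])
    have "int p dvd int b - l 1" unfolding b(2) by (simp add: mod_eq_dvd_iff[symmetric])
    then have "int p dvd (\<Prod>k=1..n. int b - l k)"
      using assms(2) by (intro dvd_trans[OF _ dvd_prodI[of _ 1]]) auto
    then show "int p dvd Poly_Mapping.lookup (?M b (\<sigma> b)) 0"
      unfolding entry by auto
  qed (use b in auto)
  then show ?thesis
    unfolding mdet_def lookup_sum lookup_of_int_mult prod by (intro dvd_sum dvd_mult) auto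
qed

lemma exists_uniform_bound:
  "\<exists>K>0. \<forall>\<alpha>. admissible m \<alpha> \<and> 1 \<le> idegree \<alpha> \<longrightarrow>
     uniform (K * nat (idegree \<alpha>)) (\<lambda>p. Poly_Mapping.lookup (op_det n m l p) \<alpha>)"
proof -
  define A where "A = (\<Sum>k=1..n. nat \<bar>l k\<bar>)"
  \<comment> \<open>With e = \<open>idegree \<alpha>\<close> the radius is A + m e, the width m e,
    and degree plus n is at most (m+1+n) e. The summands of K dominate, in turn, the bounds for
    distinct poles, power sums, division in Newton's identities and p > 2; e \<ge> 1 absorbs the
    constants.\<close>
  define K where "K = 2 * (A + 2 * m) + (m + 1 + n) * (m + n) + (m + 1 + n) + 2"
  have A: "\<bar>l k\<bar> \<le> int A" if "k \<in> {1..n}" for k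
  proof -
    have "nat \<bar>l k\<bar> \<le> A" unfolding A_def using that by (intro member_le_sum) auto
    then show ?thesis by simp
  qed
  have "uniform (K * nat (idegree \<alpha>)) (\<lambda>p. Poly_Mapping.lookup (op_det n m l p) \<alpha>)"
    if \<alpha>: "admissible m \<alpha>" "1 \<le> idegree \<alpha>" for \<alpha>
  proof (rule uniform_lookup_mdet[where W = "m * nat (idegree \<alpha>)" and r = "A + m * nat (idegree \<alpha>)"
        and K = "(m + 1 + n) * nat (idegree \<alpha>)"])
    obtain e where e: "idegree \<alpha> = int (Suc e)"
      using \<alpha>(2) that[of "nat (idegree \<alpha> - 1)"] by simp
    then have [simp]: "nat (idegree \<alpha>) = Suc e" by simp
    show "\<bar>l k\<bar> \<le> int (A + m * nat (idegree \<alpha>))" if "k \<in> {1..n}" for k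
      using A[OF that] by linarith
    show "2 * (A + m * nat (idegree \<alpha>) + m * nat (idegree \<alpha>)) \<le> K * nat (idegree \<alpha>)"
      "2 \<le> K * nat (idegree \<alpha>)"
      "(m + 1 + n) * nat (idegree \<alpha>) \<le> K * nat (idegree \<alpha>)"
      "(m + 1 + n) * nat (idegree \<alpha>) * (m + n) + 2 \<le> K * nat (idegree \<alpha>)"
      unfolding K_def by (simp_all add: algebra_simps)
    have "wsum (\<lambda>_. 1) \<alpha> + int n \<le> int ((m + 1) * Suc e) + int (n * Suc e)"
      using admissible_degree[OF \<alpha>(1)] unfolding e by (intro add_mono) (auto simp: algebra_simps)
    then show "wsum (\<lambda>_. 1) \<alpha> + int n \<le> int ((m + 1 + n) * nat (idegree \<alpha>))"
      by (simp add: algebra_simps)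
    show "narrow (m * nat (idegree \<alpha>)) \<alpha>" using \<alpha>(1) by (rule admissible_narrow)
  qed simp
  moreover have "0 < K" by (simp add: K_def)
  ultimately show ?thesis by blast
qed

subsection \<open>Quotients of rings of type class elements\<close>

lemma tring_simps [simp]:
  "carrier (ring_of_type_algebra :: 'a::comm_ring_1 ring) = UNIV"
  "x \<oplus>\<^bsub>ring_of_type_algebra\<^esub> y = x + y" "x \<otimes>\<^bsub>ring_of_type_algebra\<^esub> y = x * y"
  "\<zero>\<^bsub>ring_of_type_algebra\<^esub> = (0::'a)" "\<one>\<^bsub>ring_of_type_algebra\<^esub> = (1::'a)"
  by (simp_all add: ring_of_type_algebra_def)

interpretation type_ring: cring "ring_of_type_algebra :: 'a::comm_ring_1 ring"
  by (rule cring_from_type_algebra)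

lemma tring_a_inv [simp]: "\<ominus>\<^bsub>ring_of_type_algebra\<^esub> x = - x" for x :: "'a::comm_ring_1"
  by (rule type_ring.minus_equality) simp_all

lemma tring_minus [simp]: "x \<ominus>\<^bsub>ring_of_type_algebra\<^esub> y = x - y" for x :: "'a::comm_ring_1"
  by (simp add: a_minus_def)

lemma finsum_tring: "finsum ring_of_type_algebra f S = sum f S" for f :: "'b \<Rightarrow> 'a::comm_ring_1"
  by (induction S rule: infinite_finite_induct) (simp_all add: type_ring.finsum_insert)

lemma finprod_tring: "finprod ring_of_type_algebra f S = prod f S" for f :: "'b \<Rightarrow> 'a::comm_ring_1"
  by (induction S rule: infinite_finite_induct) (simp_all add: type_ring.finprod_insert)

lemma add_monoid_nat_pow: "x [^]\<^bsub>add_monoid ring_of_type_algebra\<^esub> (k::nat) = of_nat k * x" for x :: "'a::comm_ring_1"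
  by (induction k) (simp_all add: type_ring.add.nat_pow_Suc algebra_simps)

lemma add_monoid_int_pow: "x [^]\<^bsub>add_monoid ring_of_type_algebra\<^esub> (k::int) = of_int k * x" for x :: "'a::comm_ring_1"
  unfolding int_pow_def2 add_monoid_nat_pow a_inv_def[symmetric] tring_a_inv
  by (auto simp: of_nat_nat)

context
  fixes J :: "'a::comm_ring_1 set"
  assumes J: "ideal J ring_of_type_algebra"
begin

lemma coset_eq_iff: "J +>\<^bsub>ring_of_type_algebra\<^esub> x = J +>\<^bsub>ring_of_type_algebra\<^esub> y \<longleftrightarrow> x - y \<in> J"
  using type_ring.quotient_eq_iff_same_a_r_cos[OF J, of x y] by simp

lemma coset_add:
  "(J +>\<^bsub>ring_of_type_algebra\<^esub> x) \<oplus>\<^bsub>ring_of_type_algebra Quot J\<^esub> (J +>\<^bsub>ring_of_type_algebra\<^esub> y) =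
    J +>\<^bsub>ring_of_type_algebra\<^esub> (x + y)"
  using ring_hom_add[OF ideal.rcos_ring_hom[OF J], of x y] by simp

lemma carrier_Quot: "carrier (ring_of_type_algebra Quot J) = range (\<lambda>x. J +>\<^bsub>ring_of_type_algebra\<^esub> x)"
  by (auto simp: FactRing_def A_RCOSETS_def')

lemma coset_hom: "(\<lambda>x. J +>\<^bsub>ring_of_type_algebra\<^esub> x) \<in> hom (add_monoid ring_of_type_algebra) (add_monoid (ring_of_type_algebra Quot J))"
  by (rule homI) (simp_all add: carrier_Quot coset_add)

lemma comm_group_Quot: "comm_group (add_monoid (ring_of_type_algebra Quot J))"
  using ideal.quotient_is_ring[OF J] abelian_group.a_comm_group ring.is_abelian_group by blast

lemma coset_int_mult:
  "[k] \<cdot>\<^bsub>ring_of_type_algebra Quot J\<^esub> (J +>\<^bsub>ring_of_type_algebra\<^esub> x) = J +>\<^bsub>ring_of_type_algebra\<^esub> (of_int k * x)" for k :: int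
proof -
  have "J +>\<^bsub>ring_of_type_algebra\<^esub> (x [^]\<^bsub>add_monoid ring_of_type_algebra\<^esub> k) =
      (J +>\<^bsub>ring_of_type_algebra\<^esub> x) [^]\<^bsub>add_monoid (ring_of_type_algebra Quot J)\<^esub> k"
    by (rule hom_int_pow[OF coset_hom _ type_ring.add.group_axioms comm_group.axioms(2)[OF comm_group_Quot]]) simp
  then show ?thesis by (simp only: add_pow_def add_monoid_int_pow)
qed

lemma ideal_facts:
  "0 \<in> J" "x \<in> J \<Longrightarrow> y \<in> J \<Longrightarrow> x + y \<in> J" "x \<in> J \<Longrightarrow> z * x \<in> J" "x \<in> J \<Longrightarrow> - x \<in> J"
proof -
  interpret ideal J "ring_of_type_algebra :: 'a ring" by (rule J)
  show "0 \<in> J" using zero_closed by simp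
  show "x + y \<in> J" if "x \<in> J" "y \<in> J" using a_closed[OF that] by simp
  show "z * x \<in> J" if "x \<in> J" using I_l_closed[OF that, of z] by simp
  show "- x \<in> J" if "x \<in> J" using a_inv_closed[OF that] by simp
qed

lemma ideal_sum: "(\<And>i. i \<in> S \<Longrightarrow> f i \<in> J) \<Longrightarrow> sum f S \<in> J"
  by (induction S rule: infinite_finite_induct) (auto intro: ideal_facts)

lemma set_add_coset:
  assumes J': "ideal J' ring_of_type_algebra" "J' \<subseteq> J"
  shows "J <+>\<^bsub>ring_of_type_algebra\<^esub> (J' +>\<^bsub>ring_of_type_algebra\<^esub> x) = J +>\<^bsub>ring_of_type_algebra\<^esub> x"
proof -
  have "0 \<in> J'" using additive_subgroup.zero_closed[OF ideal.axioms(1)[OF J'(1)]] by simp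
  then show ?thesis
    unfolding set_add_def' a_r_coset_def'
    using J'(2) ideal_facts(1,2) by (auto 0 3 simp: add.assoc[symmetric] intro: exI[of _ 0])
qed

end

lemma hom_finprod:
  assumes "f \<in> hom G H" "comm_group G" "comm_group H" "g \<in> S \<rightarrow> carrier G"
  shows "f (finprod G g S) = finprod H (\<lambda>x. f (g x)) S"
proof -
  interpret G: comm_group G by fact
  interpret H: comm_group H by fact
  interpret group_hom G H f by unfold_locales fact
  show ?thesis
    using assms(4)
  proof (induction S rule: infinite_finite_induct)
    case (insert x S)
    then have "g x \<in> carrier G" "finprod G g S \<in> carrier G" "(\<lambda>x. f (g x)) \<in> S \<rightarrow> carrier H"
      by (auto intro!: G.finprod_closed hom_closed)
    then show ?case using insert by (simp add: Pi_iff)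
  qed auto
qed

subsection \<open>Tensor products\<close>

context
  fixes A :: "('a, 'm) monoid_scheme" and B :: "('b, 'n) monoid_scheme"
  assumes A: "monoid A" and B: "monoid B"
begin

lemma tensor_relators_carrier:
  "tensor_relators A B \<subseteq> carrier (free_Abelian_group (carrier A \<times> carrier B))"
proof -
  interpret A: monoid A by (rule A)
  interpret B: monoid B by (rule B)
  have "frag_of u - frag_of v - frag_of w \<in> carrier (free_Abelian_group S)"
    if "u \<in> S" "v \<in> S" "w \<in> S" for S and u v w :: "'a \<times> 'b"
  proof -
    have "Poly_Mapping.keys (frag_of u - frag_of v - frag_of w) \<subseteq> {u, v, w}"
      using keys_diff[of "frag_of u - frag_of v" "frag_of w"] keys_diff[of "frag_of u" "frag_of v"] by auto
    then show ?thesis using that by auto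
  qed
  then show ?thesis
    unfolding tensor_relators_def by (auto simp del: carrier_free_Abelian_group_iff)
qed

lemma normal_tensor_kernel: "tensor_kernel A B \<lhd> free_Abelian_group (carrier A \<times> carrier B)"
proof -
  interpret F: comm_group "free_Abelian_group (carrier A \<times> carrier B)" by (rule abelian_free_Abelian_group)
  show ?thesis
    unfolding tensor_kernel_def
    by (rule F.subgroup_imp_normal[OF F.generate_is_subgroup[OF tensor_relators_carrier]])
qed

lemma comm_group_tensor: "comm_group (tensor A B)"
proof -
  interpret F: comm_group "free_Abelian_group (carrier A \<times> carrier B)" by (rule abelian_free_Abelian_group)
  show ?thesis
    unfolding tensor_def using normal_tensor_kernel
    by (intro F.abelian_FactGroup normal_imp_subgroup)
qed

lemma pure_tensor_closed:
  assumes "a \<in> carrier A" "b \<in> carrier B"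
  shows "pure_tensor A B a b \<in> carrier (tensor A B)"
  using assms unfolding pure_tensor_def tensor_def carrier_FactGroup by (intro imageI) simp

text \<open>Both kinds of relators have the form x - y - z, so this covers additivity in either
  argument.\<close>

lemma tensor_coset_mult:
  assumes rel: "frag_of x - frag_of y - frag_of z \<in> tensor_relators A B"
    and xyz: "x \<in> carrier A \<times> carrier B" "y \<in> carrier A \<times> carrier B" "z \<in> carrier A \<times> carrier B"
  shows "tensor_kernel A B #>\<^bsub>free_Abelian_group (carrier A \<times> carrier B)\<^esub> frag_of x =
    (tensor_kernel A B #>\<^bsub>free_Abelian_group (carrier A \<times> carrier B)\<^esub> frag_of y) \<otimes>\<^bsub>tensor A B\<^esub>
    (tensor_kernel A B #>\<^bsub>free_Abelian_group (carrier A \<times> carrier B)\<^esub> frag_of z)"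
proof -
  let ?F = "free_Abelian_group (carrier A \<times> carrier B)" and ?N = "tensor_kernel A B"
  interpret F: comm_group ?F by (rule abelian_free_Abelian_group)
  interpret N: normal ?N ?F by (rule normal_tensor_kernel)
  have in_carrier: "frag_of x \<in> carrier ?F" "frag_of y \<in> carrier ?F" "frag_of z \<in> carrier ?F"
    using xyz by auto
  have "frag_of x - frag_of y - frag_of z \<in> ?N"
    unfolding tensor_kernel_def using rel by (rule generate.incl)
  then have "frag_of x \<in> ?N #>\<^bsub>?F\<^esub> (frag_of y + frag_of z)"
    unfolding r_coset_def by (auto intro!: bexI[of _ "frag_of x - frag_of y - frag_of z"])
  moreover have "frag_of y + frag_of z \<in> carrier ?F"
    using F.m_closed[OF in_carrier(2,3)] by simp
  ultimately have "?N #>\<^bsub>?F\<^esub> frag_of x = ?N #>\<^bsub>?F\<^esub> (frag_of y + frag_of z)"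
    using F.repr_independence N.subgroup_axioms by metis
  also have "\<dots> = (?N #>\<^bsub>?F\<^esub> frag_of y) <#>\<^bsub>?F\<^esub> (?N #>\<^bsub>?F\<^esub> frag_of z)"
    using N.rcos_sum[OF in_carrier(2,3)] by simp
  finally show ?thesis by (simp add: tensor_def)
qed

lemma pure_tensor_mult_left:
  assumes "a \<in> carrier A" "a' \<in> carrier A" "b \<in> carrier B"
  shows "pure_tensor A B (a \<otimes>\<^bsub>A\<^esub> a') b = pure_tensor A B a b \<otimes>\<^bsub>tensor A B\<^esub> pure_tensor A B a' b"
  unfolding pure_tensor_def
  by (rule tensor_coset_mult) (use assms monoid.m_closed[OF A] in \<open>auto simp: tensor_relators_def\<close>)

lemma pure_tensor_mult_right:
  assumes "a \<in> carrier A" "b \<in> carrier B" "b' \<in> carrier B"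
  shows "pure_tensor A B a (b \<otimes>\<^bsub>B\<^esub> b') = pure_tensor A B a b \<otimes>\<^bsub>tensor A B\<^esub> pure_tensor A B a b'"
  unfolding pure_tensor_def
  by (rule tensor_coset_mult) (use assms monoid.m_closed[OF B] in \<open>auto simp: tensor_relators_def\<close>)

lemma pure_tensor_one_left:
  assumes "b \<in> carrier B"
  shows "pure_tensor A B \<one>\<^bsub>A\<^esub> b = \<one>\<^bsub>tensor A B\<^esub>"
proof -
  interpret T: comm_group "tensor A B" by (rule comm_group_tensor)
  interpret A: monoid A by (rule A)
  have "pure_tensor A B \<one>\<^bsub>A\<^esub> b \<otimes>\<^bsub>tensor A B\<^esub> pure_tensor A B \<one>\<^bsub>A\<^esub> b = pure_tensor A B \<one>\<^bsub>A\<^esub> b"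
    using pure_tensor_mult_left[of "\<one>\<^bsub>A\<^esub>" "\<one>\<^bsub>A\<^esub>" b] assms by simp
  then show ?thesis
    using pure_tensor_closed[of "\<one>\<^bsub>A\<^esub>" b] assms by (metis A.one_closed T.l_cancel_one')
qed

end

subsection \<open>The quotients of \<open>R\<close>\<close>

lemma ideal_tideal_pow: "ideal (tideal_pow k) tring"
proof -
  have I: "ideal tideal tring"
    unfolding tideal_def by (rule type_ring.genideal_ideal) simp
  show ?thesis
  proof (induction k)
    case 0
    show ?case using type_ring.oneideal by (simp add: tideal_pow_def nat_pow_def ideals_set_def)
  next
    case (Suc k)
    have "tideal_pow (Suc k) = ideal_prod tring (tideal_pow k) tideal"
      by (simp add: tideal_pow_def nat_pow_def ideals_set_def)
    then show ?case using type_ring.ideal_prod_is_ideal[OF Suc I] by simp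
  qed
qed

lemma tideal_pow_Suc: "tideal_pow (Suc k) = ideal_prod tring (tideal_pow k) tideal"
  by (simp add: tideal_pow_def nat_pow_def ideals_set_def)

lemma tideal_pow_antimono: "j \<le> k \<Longrightarrow> tideal_pow k \<subseteq> tideal_pow j"
proof (induction k rule: dec_induct)
  case (step k)
  have "ideal tideal tring"
    unfolding tideal_def by (rule type_ring.genideal_ideal) simp
  then show ?case
    using step type_ring.ideal_prod_inter[OF ideal_tideal_pow, of tideal k] unfolding tideal_pow_Suc by blast
qed simp

text \<open>As long as the degree is positive, one generator t_ij with i \<le> j can be split
  off.\<close>

lemma monomial_in_tideal_pow:
  "int k \<le> idegree \<alpha> \<Longrightarrow> Poly_Mapping.single \<alpha> 1 \<in> tideal_pow k"
proof (induction k arbitrary: \<alpha>)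
  case 0
  then show ?case by (simp add: tideal_pow_def nat_pow_def ideals_set_def)
next
  case (Suc k)
  have "\<exists>i j. (i, j) \<in> Poly_Mapping.keys \<alpha> \<and> i \<le> j"
  proof (rule ccontr)
    assume *: "\<not> ?thesis"
    have "idegree \<alpha> = 0"
      unfolding idegree_def wsum_def by (rule sum.neutral) (use * in auto)
    then show False using Suc.prems by simp
  qed
  then obtain i j where ij: "(i, j) \<in> Poly_Mapping.keys \<alpha>" "i \<le> j" by blast
  define \<beta> where "\<beta> = \<alpha> - Poly_Mapping.single (i, j) 1"
  have \<alpha>: "\<alpha> = \<beta> + Poly_Mapping.single (i, j) 1"
    using ij(1) by (intro poly_mapping_eqI) (auto simp: \<beta>_def lookup_add lookup_minus lookup_single when_def in_keys_iff)
  have "idegree \<alpha> = idegree \<beta> + 1"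
    unfolding \<alpha> idegree_def wsum_add using ij(2) by simp
  then have "Poly_Mapping.single \<beta> 1 \<in> tideal_pow k" using Suc by simp
  moreover have "tvar i j \<in> tideal"
    unfolding tideal_def by (rule subsetD[OF type_ring.genideal_self]) (use ij(2) in auto)
  ultimately have "Poly_Mapping.single \<beta> 1 \<otimes>\<^bsub>tring\<^esub> tvar i j \<in> tideal_pow (Suc k)"
    unfolding tideal_pow_Suc by (rule ideal_prod.prod)
  then show ?case by (simp add: \<alpha> tvar_def mult_single)
qed

lemma ideal_p_ideal: "ideal (p_ideal p) tring"
  unfolding p_ideal_def by (rule type_ring.cgenideal_ideal) simp

lemma of_nat_mult_in_p_ideal: "of_nat p * x \<in> p_ideal p"
  unfolding p_ideal_def cgenideal_def by (auto simp: mult.commute)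

lemma ideal_p_tideal: "ideal (p_tideal p s) tring"
  unfolding p_tideal_def by (rule type_ring.add_ideals[OF ideal_p_ideal ideal_tideal_pow])

lemma p_ideal_subset: "p_ideal p \<subseteq> p_tideal p s"
proof
  fix x assume "x \<in> p_ideal p"
  then show "x \<in> p_tideal p s"
    using ideal_facts(1)[OF ideal_tideal_pow[of s]] unfolding p_tideal_def set_add_def' by force
qed

lemma tideal_pow_subset: "tideal_pow s \<subseteq> p_tideal p s"
proof
  fix x assume "x \<in> tideal_pow s"
  then show "x \<in> p_tideal p s"
    using ideal_facts(1)[OF ideal_p_ideal[of p]] unfolding p_tideal_def set_add_def' by force
qed

lemma quot_map_coset:
  assumes "ideal J tring" "ideal J' tring" "J \<subseteq> J'"
  shows "quot_map J' (J +>\<^bsub>tring\<^esub> x) = J' +>\<^bsub>tring\<^esub> x"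
  unfolding quot_map_def by (rule set_add_coset[OF assms(2,1,3)])

text \<open>Reduction modulo p is a ring homomorphism and commutes with the Leibniz sum. All later
  work can therefore use the integral determinant.\<close>

lemma Det_p_eq:
  "Det_p n m l p = p_ideal p +>\<^bsub>tring\<^esub> op_det n m l p"
proof -
  let ?J = "p_ideal p" and ?M = "\<lambda>a b. fps_nth (diff_op n m l (fps_X ^ b)) a"
  let ?S = "tring Quot ?J"
  interpret h: ring_hom_cring tring ?S "\<lambda>x. ?J +>\<^bsub>tring\<^esub> x"
    by (rule ideal.rcos_ring_hom_cring[OF ideal_p_ideal type_ring.is_cring])
  have summand: "[sign \<sigma>] \<cdot>\<^bsub>?S\<^esub> (\<Otimes>\<^bsub>?S\<^esub>a\<in>{..<p}. ?J +>\<^bsub>tring\<^esub> ?M a (\<sigma> a)) =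
     ?J +>\<^bsub>tring\<^esub> (of_int (sign \<sigma>) * (\<Prod>a<p. ?M a (\<sigma> a)))" for \<sigma>
  proof -
    have "(\<Otimes>\<^bsub>?S\<^esub>a\<in>{..<p}. ?J +>\<^bsub>tring\<^esub> ?M a (\<sigma> a)) = ?J +>\<^bsub>tring\<^esub> (\<Prod>a<p. ?M a (\<sigma> a))"
      using h.hom_finprod[of "\<lambda>a. ?M a (\<sigma> a)" "{..<p}"] by (simp add: finprod_tring comp_def)
    then show ?thesis by (simp add: coset_int_mult[OF ideal_p_ideal])
  qed
  show ?thesis
    unfolding Det_p_def cring_det_def mdet_def summand
    using h.hom_finsum[of "\<lambda>\<sigma>. of_int (sign \<sigma>) * (\<Prod>a<p. ?M a (\<sigma> a))" "{\<sigma>. \<sigma> permutes {..<p}}"]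
    by (simp add: finsum_tring comp_def)
qed

subsection \<open>Reduction of \<open>p\<close>-integral elements\<close>

lemma quotient_of_denom:
  "q * of_int (snd (quotient_of q)) = of_int (fst (quotient_of q))"
proof -
  obtain a b where q: "quotient_of q = (a, b)" by (cases "quotient_of q")
  then have "b > 0" "q = of_int a / of_int b"
    using quotient_of_denom_pos quotient_of_div by blast+
  then show ?thesis using q by (simp add: field_simps)
qed

lemma quotient_of_cross_mult:
  assumes "q * of_int v = of_int u"
  shows "fst (quotient_of q) * v = u * snd (quotient_of q)"
proof -
  have "of_int (fst (quotient_of q) * v) = (q * of_int v) * of_int (snd (quotient_of q))"
    by (simp flip: quotient_of_denom)
  also have "\<dots> = of_int (u * snd (quotient_of q))" by (simp add: assms)
  finally show ?thesis by (simp only: of_int_eq_iff)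
qed

text \<open>If p divided the reduced denominator, cross multiplication with u/v would make it divide
  the reduced numerator too.\<close>

lemma Zloc_memI:
  assumes "prime p" "\<not> int p dvd v" "q * of_int v = of_int u"
  shows "coprime (snd (quotient_of q)) (int p)"
proof (rule ccontr)
  assume "\<not> coprime (snd (quotient_of q)) (int p)"
  then have b: "int p dvd snd (quotient_of q)"
    using assms(1) by (metis coprime_commute prime_imp_coprime prime_nat_int_transfer)
  then have "int p dvd fst (quotient_of q) * v"
    unfolding quotient_of_cross_mult[OF assms(3)] by simp
  then have "int p dvd fst (quotient_of q)"
    using assms(1,2) by (simp add: prime_dvd_mult_iff)
  moreover have "coprime (fst (quotient_of q)) (snd (quotient_of q))"
    by (rule quotient_of_coprime) simp
  ultimately have "is_unit (int p)" using b by (meson coprime_common_divisor)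
  then show False using assms(1) by (simp add: prime_gt_1_nat)
qed

lemma Zloc_residue_cong:
  assumes "prime p" "coprime (snd (quotient_of q)) (int p)" "q * of_int v = of_int u"
  shows "[v * Zloc_residue p q = u] (mod int p)"
proof -
  let ?a = "fst (quotient_of q)" and ?b = "snd (quotient_of q)"
  have "[?b * modular_inverse (int p) ?b = 1] (mod int p)"
    using assms(2) by (rule cong_modular_inverse1)
  then have "[u * (?b * modular_inverse (int p) ?b) = u * 1] (mod int p)"
    by (intro cong_mult cong_refl)
  moreover have "u * (?b * modular_inverse (int p) ?b) = v * Zloc_residue p q"
    using quotient_of_cross_mult[OF assms(3)] by (simp add: Zloc_residue_def algebra_simps)
  ultimately show ?thesis by simp
qed

text \<open>Links the fractions u/v of \<open>uniform\<close> with the residue map: the congruence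
  for x there determines x modulo p.\<close>

lemma Zloc_residue_unique:
  assumes "prime p" "coprime (snd (quotient_of q)) (int p)" "q * of_int v = of_int u"
    and "\<not> int p dvd v" "[v * x = u] (mod int p)"
  shows "[Zloc_residue p q = x] (mod int p)"
  using cong_prime_cancel[OF assms(1,4)] Zloc_residue_cong[OF assms(1-3)] assms(5)
  by (meson cong_sym cong_trans)

lemma comm_group_QQ: "comm_group QQ"
  by (rule type_ring.a_comm_group)

context
  fixes p :: nat
  assumes p: "prime p"
begin

lemma not_dvd_denom:
  assumes "coprime (snd (quotient_of q)) (int p)"
  shows "\<not> int p dvd snd (quotient_of q)"
  using assms p by (metis coprime_common_divisor dvd_refl not_prime_unit prime_nat_int_transfer)

lemma Zloc_add:
  assumes "coprime (snd (quotient_of q)) (int p)" "coprime (snd (quotient_of q')) (int p)"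
  shows "coprime (snd (quotient_of (q + q'))) (int p)"
    and "[Zloc_residue p (q + q') = Zloc_residue p q + Zloc_residue p q'] (mod int p)"
proof -
  let ?a = "fst (quotient_of q)" and ?b = "snd (quotient_of q)"
  let ?a' = "fst (quotient_of q')" and ?b' = "snd (quotient_of q')"
  have "(q + q') * of_int (?b * ?b') = (q * of_int ?b) * of_int ?b' + (q' * of_int ?b') * of_int ?b"
    by (simp add: algebra_simps)
  also have "\<dots> = of_int (?a * ?b' + ?a' * ?b)"
    unfolding quotient_of_denom by simp
  finally have e: "(q + q') * of_int (?b * ?b') = of_int (?a * ?b' + ?a' * ?b)" .
  have nd: "\<not> int p dvd ?b * ?b'"
    using not_dvd_denom[OF assms(1)] not_dvd_denom[OF assms(2)] p by (simp add: prime_dvd_mult_iff)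
  show 1: "coprime (snd (quotient_of (q + q'))) (int p)"
    using p nd e by (rule Zloc_memI)
  have "[?b' * (?b * Zloc_residue p q) + ?b * (?b' * Zloc_residue p q') = ?b' * ?a + ?b * ?a'] (mod int p)"
    by (intro cong_add cong_mult cong_refl Zloc_residue_cong[OF p] assms quotient_of_denom)
  then show "[Zloc_residue p (q + q') = Zloc_residue p q + Zloc_residue p q'] (mod int p)"
    by (intro Zloc_residue_unique[OF p 1 e nd]) (simp add: algebra_simps)
qed

lemma comm_group_Zloc: "comm_group (Zloc p)"
proof -
  have "subgroup {q. coprime (snd (quotient_of q)) (int p)} QQ"
  proof (rule group.subgroupI[OF comm_group.axioms(2)[OF comm_group_QQ]])
    show "{q. coprime (snd (quotient_of q)) (int p)} \<noteq> {}"
      by (auto intro!: exI[of _ 0])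
    fix q :: rat assume "q \<in> {q. coprime (snd (quotient_of q)) (int p)}"
    then have q: "coprime (snd (quotient_of q)) (int p)" by simp
    have "(- q) * of_int (snd (quotient_of q)) = of_int (- fst (quotient_of q))"
      using quotient_of_denom[of q] by simp
    then have "coprime (snd (quotient_of (- q))) (int p)"
      by (rule Zloc_memI[OF p not_dvd_denom[OF q]])
    then show "inv\<^bsub>QQ\<^esub> q \<in> {q. coprime (snd (quotient_of q)) (int p)}"
      unfolding a_inv_def[symmetric] tring_a_inv by simp
  qed (auto intro: Zloc_add)
  then have "group (QQ\<lparr>carrier := {q. coprime (snd (quotient_of q)) (int p)}\<rparr>)"
    by (rule group.subgroup_imp_group[OF comm_group.axioms(2)[OF comm_group_QQ]])
  then show ?thesis
    unfolding Zloc_def by (rule group.group_comm_groupI) (simp add: add.commute)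
qed

end

section \<open>Maps induced on the tensor products\<close>

lemma comm_group_Rmod: "comm_group (Rmod k)"
  by (rule comm_group_Quot[OF ideal_tideal_pow])

lemma comm_group_imp_monoid: "comm_group G \<Longrightarrow> monoid G"
  by (simp add: comm_group.axioms(2) group.is_monoid)

lemma carrier_Rmod: "carrier (Rmod k) = range (\<lambda>x. tideal_pow k +>\<^bsub>tring\<^esub> x)"
  using carrier_Quot[OF ideal_tideal_pow] by simp

lemma mult_Rmod:
  "(tideal_pow k +>\<^bsub>tring\<^esub> x) \<otimes>\<^bsub>Rmod k\<^esub> (tideal_pow k +>\<^bsub>tring\<^esub> y) = tideal_pow k +>\<^bsub>tring\<^esub> (x + y)"
  using coset_add[OF ideal_tideal_pow] by simp

lemma finprod_coset:
  assumes J: "ideal J (tring :: tpoly ring)"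
  shows "finprod (add_monoid (tring Quot J)) (\<lambda>a. J +>\<^bsub>tring\<^esub> f a) S = J +>\<^bsub>tring\<^esub> sum f S"
proof -
  show ?thesis
    using finsum_tring[unfolded finsum_def, of f S] hom_finprod[OF coset_hom[OF J] type_ring.a_comm_group comm_group_Quot[OF J], of f S] by simp
qed

lemma poly_mapping_in_ideal:
  fixes f :: tpoly
  assumes J: "ideal J tring" and "\<And>\<beta>. Poly_Mapping.single \<beta> (Poly_Mapping.lookup f \<beta>) \<in> J"
  shows "f \<in> J"
proof -
  have "f = (\<Sum>\<beta>\<in>Poly_Mapping.keys f. Poly_Mapping.single \<beta> (Poly_Mapping.lookup f \<beta>))"
    by (rule poly_mapping_eqI) (auto simp: lookup_sum lookup_single when_def in_keys_iff)
  then show ?thesis using ideal_sum[OF J] assms(2) by metis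
qed

lemma single_eq_of_int_mult:
  "Poly_Mapping.single \<beta> k = of_int k * Poly_Mapping.single \<beta> (1::int)" for \<beta> :: "'b \<Rightarrow>\<^sub>0 nat"
  by (rule poly_mapping_eqI) (simp add: lookup_of_int_mult lookup_single when_def)

lemma tensor_lift_quot_map:
  assumes "j \<le> k"
  shows "tensor_lift (tensor (Rmod j) QQ)
      (\<lambda>U q. pure_tensor (Rmod j) QQ (quot_map (tideal_pow j) U) q) \<in> hom (tensor (Rmod k) QQ) (tensor (Rmod j) QQ)"
    and "tensor_lift (tensor (Rmod j) QQ) (\<lambda>U q. pure_tensor (Rmod j) QQ (quot_map (tideal_pow j) U) q)
      (pure_tensor (Rmod k) QQ (tideal_pow k +>\<^bsub>tring\<^esub> x) q) = pure_tensor (Rmod j) QQ (tideal_pow j +>\<^bsub>tring\<^esub> x) q"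
proof -
  let ?h = "\<lambda>U q. pure_tensor (Rmod j) QQ (quot_map (tideal_pow j) U) q"
  note mon = comm_group_imp_monoid[OF comm_group_Rmod] comm_group_imp_monoid[OF comm_group_QQ]
  have qm: "quot_map (tideal_pow j) (tideal_pow k +>\<^bsub>tring\<^esub> x) = tideal_pow j +>\<^bsub>tring\<^esub> x" for x
    by (intro quot_map_coset ideal_tideal_pow tideal_pow_antimono assms)
  have in_carrier: "tideal_pow k +>\<^bsub>tring\<^esub> x \<in> carrier (Rmod k)" for k x
    unfolding carrier_Rmod by simp
  have closed: "?h a b \<in> carrier (tensor (Rmod j) QQ)" if "a \<in> carrier (Rmod k)" "b \<in> carrier QQ" for a b
  proof -
    obtain x where a: "a = tideal_pow k +>\<^bsub>tring\<^esub> x"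
      using \<open>a \<in> carrier (Rmod k)\<close> unfolding carrier_Rmod by auto
    show ?thesis unfolding a qm by (rule pure_tensor_closed[OF mon in_carrier that(2)])
  qed
  have left: "?h (a \<otimes>\<^bsub>Rmod k\<^esub> a') b = ?h a b \<otimes>\<^bsub>tensor (Rmod j) QQ\<^esub> ?h a' b"
    if "a \<in> carrier (Rmod k)" "a' \<in> carrier (Rmod k)" "b \<in> carrier QQ" for a a' b
  proof -
    obtain x y where a: "a = tideal_pow k +>\<^bsub>tring\<^esub> x" "a' = tideal_pow k +>\<^bsub>tring\<^esub> y"
      using \<open>a \<in> carrier (Rmod k)\<close> \<open>a' \<in> carrier (Rmod k)\<close> unfolding carrier_Rmod by auto
    show ?thesis
      unfolding a mult_Rmod qm using pure_tensor_mult_left[OF mon in_carrier in_carrier \<open>b \<in> carrier QQ\<close>, of j x y]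
      unfolding mult_Rmod .
  qed
  have right: "?h a (b \<otimes>\<^bsub>QQ\<^esub> b') = ?h a b \<otimes>\<^bsub>tensor (Rmod j) QQ\<^esub> ?h a b'"
    if "a \<in> carrier (Rmod k)" "b \<in> carrier QQ" "b' \<in> carrier QQ" for a b b'
  proof -
    obtain x where a: "a = tideal_pow k +>\<^bsub>tring\<^esub> x"
      using \<open>a \<in> carrier (Rmod k)\<close> unfolding carrier_Rmod by auto
    show ?thesis unfolding a qm by (rule pure_tensor_mult_right[OF mon in_carrier that(2,3)])
  qed
  note lift = tensor_lift_hom[OF mon comm_group_tensor[OF mon], of k ?h j, OF closed left right]
  show "tensor_lift (tensor (Rmod j) QQ) ?h \<in> hom (tensor (Rmod k) QQ) (tensor (Rmod j) QQ)"
    by (rule lift(1))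
  show "tensor_lift (tensor (Rmod j) QQ) ?h
      (pure_tensor (Rmod k) QQ (tideal_pow k +>\<^bsub>tring\<^esub> x) q) = pure_tensor (Rmod j) QQ (tideal_pow j +>\<^bsub>tring\<^esub> x) q"
    unfolding qm[symmetric] by (rule lift(2)) (assumption | rule in_carrier | simp)+
qed

lemma Zloc_incl_hom:
  assumes p: "prime p"
  shows "Zloc_incl s \<in> hom (tensor (Rmod s) (Zloc p)) (tensor (Rmod s) QQ)"
    and "coprime (snd (quotient_of q)) (int p) \<Longrightarrow>
      Zloc_incl s (pure_tensor (Rmod s) (Zloc p) (tideal_pow s +>\<^bsub>tring\<^esub> x) q) =
      pure_tensor (Rmod s) QQ (tideal_pow s +>\<^bsub>tring\<^esub> x) q"
proof -
  note mon = comm_group_imp_monoid[OF comm_group_Rmod] comm_group_imp_monoid[OF comm_group_QQ]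
  note monZ = comm_group_imp_monoid[OF comm_group_Zloc[OF p]]
  have right: "pure_tensor (Rmod s) QQ a (b \<otimes>\<^bsub>Zloc p\<^esub> b') =
      pure_tensor (Rmod s) QQ a b \<otimes>\<^bsub>tensor (Rmod s) QQ\<^esub> pure_tensor (Rmod s) QQ a b'"
    if "a \<in> carrier (Rmod s)" for a b b'
    using pure_tensor_mult_right[OF mon that, of b b'] by (simp add: Zloc_def)
  note lift = tensor_lift_hom[OF mon(1) monZ comm_group_tensor[OF mon],
      of s "pure_tensor (Rmod s) QQ" s,
      OF pure_tensor_closed[OF mon] pure_tensor_mult_left[OF mon] right]
  show "Zloc_incl s \<in> hom (tensor (Rmod s) (Zloc p)) (tensor (Rmod s) QQ)"
    unfolding Zloc_incl_def by (rule lift(1)) simp_all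
  show "Zloc_incl s (pure_tensor (Rmod s) (Zloc p) (tideal_pow s +>\<^bsub>tring\<^esub> x) q) =
      pure_tensor (Rmod s) QQ (tideal_pow s +>\<^bsub>tring\<^esub> x) q" if "coprime (snd (quotient_of q)) (int p)"
    unfolding Zloc_incl_def by (rule lift(2)) (use that in \<open>auto simp: Zloc_def carrier_Quot[OF ideal_tideal_pow]\<close>)
qed

lemma reduce_mod_p_hom:
  assumes p: "prime p"
  shows "reduce_mod_p p s \<in> hom (tensor (Rmod s) (Zloc p)) (add_monoid (tring Quot p_tideal p s))"
    and "coprime (snd (quotient_of q)) (int p) \<Longrightarrow>
      reduce_mod_p p s (pure_tensor (Rmod s) (Zloc p) (tideal_pow s +>\<^bsub>tring\<^esub> x) q) =
      p_tideal p s +>\<^bsub>tring\<^esub> (of_int (Zloc_residue p q) * x)"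
proof -
  let ?J = "p_tideal p s"
  let ?h = "\<lambda>U q. [Zloc_residue p q] \<cdot>\<^bsub>tring Quot ?J\<^esub> quot_map ?J U"
  note J = ideal_p_tideal[of p s]
  have h: "?h (tideal_pow s +>\<^bsub>tring\<^esub> x) q = ?J +>\<^bsub>tring\<^esub> (of_int (Zloc_residue p q) * x)" for x q
    using quot_map_coset[OF ideal_tideal_pow J tideal_pow_subset] by (simp add: coset_int_mult[OF J])
  have cosets: "\<exists>x. a = tideal_pow s +>\<^bsub>tring\<^esub> x" if "a \<in> carrier (Rmod s)" for a
    using that unfolding carrier_Rmod by auto
  have closed: "?h a b \<in> carrier (add_monoid (tring Quot ?J))" if "a \<in> carrier (Rmod s)" for a b
    using cosets[OF that] by (auto simp: h carrier_Quot[OF J])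
  have left: "?h (a \<otimes>\<^bsub>Rmod s\<^esub> a') b = ?h a b \<otimes>\<^bsub>add_monoid (tring Quot ?J)\<^esub> ?h a' b"
    if a: "a \<in> carrier (Rmod s)" "a' \<in> carrier (Rmod s)" for a a' b
  proof -
    obtain x y where "a = tideal_pow s +>\<^bsub>tring\<^esub> x" "a' = tideal_pow s +>\<^bsub>tring\<^esub> y"
      using cosets[OF a(1)] cosets[OF a(2)] by auto
    then show ?thesis
      by (simp only: mult_Rmod h) (simp add: coset_add[OF J] distrib_left)
  qed
  have right: "?h a (b \<otimes>\<^bsub>Zloc p\<^esub> b') = ?h a b \<otimes>\<^bsub>add_monoid (tring Quot ?J)\<^esub> ?h a b'"
    if a: "a \<in> carrier (Rmod s)" and b: "b \<in> carrier (Zloc p)" "b' \<in> carrier (Zloc p)" for a b b'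
  proof -
    obtain x where x: "a = tideal_pow s +>\<^bsub>tring\<^esub> x" using cosets[OF a] by auto
    \<comment> \<open>\<open>Zloc_residue\<close> picks integer representatives and is additive only
      up to multiples of p, which lie in the ideal divided out.\<close>
    let ?k = "Zloc_residue p (b + b') - (Zloc_residue p b + Zloc_residue p b')"
    have "int p dvd ?k"
      using Zloc_add(2)[OF p, of b b'] b by (simp add: Zloc_def cong_iff_dvd_diff)
    then obtain k where k: "?k = int p * k" by (elim dvdE)
    have "of_int (Zloc_residue p (b + b')) * x - of_int (Zloc_residue p b + Zloc_residue p b') * x = of_int ?k * x"
      by (simp add: algebra_simps)
    also have "\<dots> = of_nat p * (of_int k * x)"
      unfolding k by (simp add: mult.assoc)
    finally have "?J +>\<^bsub>tring\<^esub> (of_int (Zloc_residue p (b + b')) * x) =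
        ?J +>\<^bsub>tring\<^esub> (of_int (Zloc_residue p b + Zloc_residue p b') * x)"
      unfolding coset_eq_iff[OF J] by (auto intro: subsetD[OF p_ideal_subset] of_nat_mult_in_p_ideal)
    moreover have "b \<otimes>\<^bsub>Zloc p\<^esub> b' = b + b'" by (simp add: Zloc_def)
    ultimately show ?thesis
      unfolding x by (simp only: h) (simp add: coset_add[OF J] distrib_right)
  qed
  note lift = tensor_lift_hom[OF comm_group_imp_monoid[OF comm_group_Rmod] comm_group_imp_monoid[OF comm_group_Zloc[OF p]]
      comm_group_Quot[OF J], of s ?h, OF closed left right]
  show "reduce_mod_p p s \<in> hom (tensor (Rmod s) (Zloc p)) (add_monoid (tring Quot p_tideal p s))"
    unfolding reduce_mod_p_def by (rule lift(1))
  show "reduce_mod_p p s (pure_tensor (Rmod s) (Zloc p) (tideal_pow s +>\<^bsub>tring\<^esub> x) q) =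
      p_tideal p s +>\<^bsub>tring\<^esub> (of_int (Zloc_residue p q) * x)" if "coprime (snd (quotient_of q)) (int p)"
    unfolding reduce_mod_p_def h[symmetric]
    by (rule lift(2)) (use that in \<open>auto simp: Zloc_def carrier_Quot[OF ideal_tideal_pow]\<close>)
qed

section \<open>Construction of L and comparison with the determinant\<close>

theorem theorem3:
  fixes n m :: nat and l :: "nat \<Rightarrow> int"
  assumes "n \<ge> 1" and "m \<ge> 1"
    and "\<And>i j. 1 \<le> i \<Longrightarrow> i \<le> j \<Longrightarrow> j \<le> n \<Longrightarrow> l i \<le> l j"
  shows "\<exists>L \<in> completion_Q. \<exists>C::real. C > 0 \<and>
    (\<forall>p::nat. prime p \<longrightarrow>
      (let s = nat \<lceil>C * real p\<rceil> in
        \<exists>z \<in> carrier (tensor (Rmod s) (Zloc p)).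
          Zloc_incl s z = L s \<and>
          reduce_mod_p p s z = quot_map (p_tideal p s) (Det_p n m l p)))"
proof -
  define \<Delta> where "\<Delta> p = op_det n m l p" for p
  obtain K where K: "K > 0" and
    unif: "\<And>\<alpha>. admissible m \<alpha> \<Longrightarrow> 1 \<le> idegree \<alpha> \<Longrightarrow>
      uniform (K * nat (idegree \<alpha>)) (\<lambda>p. Poly_Mapping.lookup (\<Delta> p) \<alpha>)"
    using exists_uniform_bound[of m n l] unfolding \<Delta>_def by blast
  have "\<exists>u v. admissible m \<alpha> \<longrightarrow> 1 \<le> idegree \<alpha> \<longrightarrow> v \<noteq> 0 \<and> (\<forall>p. prime p \<longrightarrow> K * nat (idegree \<alpha>) < p \<longrightarrow>
      \<not> int p dvd v \<and> [v * Poly_Mapping.lookup (\<Delta> p) \<alpha> = u] (mod int p))" for \<alpha>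
    using unif[of \<alpha>] unfolding uniform_def by blast
  \<comment> \<open>The fraction is chosen for each monomial before any prime is fixed, which makes
    L independent of p.\<close>
  then obtain u v where uv: "\<And>\<alpha>. admissible m \<alpha> \<Longrightarrow> 1 \<le> idegree \<alpha> \<Longrightarrow> v \<alpha> \<noteq> 0"
    "\<And>\<alpha> p. admissible m \<alpha> \<Longrightarrow> 1 \<le> idegree \<alpha> \<Longrightarrow> prime p \<Longrightarrow> K * nat (idegree \<alpha>) < p \<Longrightarrow>
      \<not> int p dvd v \<alpha> \<and> [v \<alpha> * Poly_Mapping.lookup (\<Delta> p) \<alpha> = u \<alpha>] (mod int p)"
    by metis
  define c :: "_ \<Rightarrow> rat" where "c \<alpha> = of_int (u \<alpha>) / of_int (v \<alpha>)" for \<alpha>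
  have c: "c \<alpha> * of_int (v \<alpha>) = of_int (u \<alpha>)" if "admissible m \<alpha>" "1 \<le> idegree \<alpha>" for \<alpha>
    using uv(1)[OF that] by (simp add: c_def)
  \<comment> \<open>The monomials that can survive modulo I^k. The condition
    \<open>1 \<le> idegree \<alpha>\<close> leaves out the monomial 1, whose coefficient vanishes
    modulo every p.\<close>
  define A where "A k = {\<alpha>. admissible m \<alpha> \<and> 1 \<le> idegree \<alpha> \<and> idegree \<alpha> < int k}" for k
  have fin: "finite (A k)" for k
    by (rule finite_subset[OF _ finite_admissible[of m k]]) (auto simp: A_def)
  define t :: "_ \<Rightarrow> tpoly" where "t \<alpha> = Poly_Mapping.single \<alpha> 1" for \<alpha>
  define L where "L k = finprod (tensor (Rmod k) QQ)
    (\<lambda>\<alpha>. pure_tensor (Rmod k) QQ (tideal_pow k +>\<^bsub>tring\<^esub> t \<alpha>) (c \<alpha>)) (A k)" for k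
  note mon = comm_group_imp_monoid[OF comm_group_Rmod] comm_group_imp_monoid[OF comm_group_QQ]
  note T = comm_group_tensor[OF mon]
  have in_carrier: "tideal_pow k +>\<^bsub>tring\<^esub> x \<in> carrier (Rmod k)" for k x
    unfolding carrier_Rmod by simp
  have pure: "pure_tensor (Rmod k) QQ (tideal_pow k +>\<^bsub>tring\<^esub> x) q \<in> carrier (tensor (Rmod k) QQ)" for k x q
    by (rule pure_tensor_closed[OF mon in_carrier]) simp
  have "L \<in> completion_Q"
    unfolding completion_Q_def
  proof (intro CollectI conjI allI impI)
    show "L k \<in> carrier (tensor (Rmod k) QQ)" for k
      unfolding L_def using pure by (intro comm_monoid.finprod_closed comm_group.axioms(1) T) auto
    fix j k :: nat assume jk: "j \<le> k"
    interpret Tj: comm_group "tensor (Rmod j) QQ" by (rule T)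
    let ?h = "tensor_lift (tensor (Rmod j) QQ) (\<lambda>U q. pure_tensor (Rmod j) QQ (quot_map (tideal_pow j) U) q)"
    have "?h (L k) = finprod (tensor (Rmod j) QQ)
        (\<lambda>\<alpha>. ?h (pure_tensor (Rmod k) QQ (tideal_pow k +>\<^bsub>tring\<^esub> t \<alpha>) (c \<alpha>))) (A k)"
      unfolding L_def using pure by (intro hom_finprod[OF tensor_lift_quot_map(1)[OF jk] T T]) auto
    also have "\<dots> = finprod (tensor (Rmod j) QQ)
        (\<lambda>\<alpha>. pure_tensor (Rmod j) QQ (tideal_pow j +>\<^bsub>tring\<^esub> t \<alpha>) (c \<alpha>)) (A k)"
      by (simp only: tensor_lift_quot_map(2)[OF jk])
    also have "\<dots> = L j"
      unfolding L_def
    proof (rule Tj.finprod_mono_neutral_cong_right[OF fin])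
      show "A j \<subseteq> A k" using jk by (auto simp: A_def)
      show "pure_tensor (Rmod j) QQ (tideal_pow j +>\<^bsub>tring\<^esub> t \<alpha>) (c \<alpha>) = \<one>\<^bsub>tensor (Rmod j) QQ\<^esub>"
        if "\<alpha> \<in> A k - A j" for \<alpha>
      proof -
        have "t \<alpha> \<in> tideal_pow j"
          unfolding t_def using that by (intro monomial_in_tideal_pow) (auto simp: A_def)
        then have "tideal_pow j +>\<^bsub>tring\<^esub> t \<alpha> = tideal_pow j +>\<^bsub>tring\<^esub> 0"
          by (simp add: coset_eq_iff[OF ideal_tideal_pow])
        also have "\<dots> = \<one>\<^bsub>Rmod j\<^esub>"
          using ring_hom_zero[OF ideal.rcos_ring_hom[OF ideal_tideal_pow[of j]] type_ring.ring_axioms ideal.quotient_is_ring[OF ideal_tideal_pow]]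
          by simp
        finally show ?thesis using pure_tensor_one_left[OF mon, of "c \<alpha>" j] by simp
      qed
    qed (use pure in auto)
    finally show "?h (L k) = L j" .
  qed
  moreover have "\<exists>z \<in> carrier (tensor (Rmod s) (Zloc p)). Zloc_incl s z = L s \<and>
      reduce_mod_p p s z = quot_map (p_tideal p s) (Det_p n m l p)"
    if p: "prime p" and s: "s = nat \<lceil>1 / real K * real p\<rceil>" for p s
  proof -
    let ?J = "p_tideal p s"
    note J = ideal_p_tideal[of p s]
    note monZ = comm_group_imp_monoid[OF comm_group_Zloc[OF p]]
    note TZ = comm_group_tensor[OF mon(1) monZ]
    \<comment> \<open>This fixes C = 1/K: an integer is below ceil(p/K) exactly if it is below
      p/K.\<close>
    have bound: "K * nat (idegree \<alpha>) < p" if "\<alpha> \<in> A s" for \<alpha>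
    proof -
      have \<alpha>: "1 \<le> idegree \<alpha>" "idegree \<alpha> < int s" using that by (auto simp: A_def)
      then have "idegree \<alpha> < \<lceil>1 / real K * real p\<rceil>" unfolding s by linarith
      then have "of_int (idegree \<alpha>) < 1 / real K * real p" by (simp add: less_ceiling_iff)
      then have "real K * of_int (idegree \<alpha>) < real p" using K by (simp add: field_simps)
      moreover have "real K * of_int (idegree \<alpha>) = real (K * nat (idegree \<alpha>))" using \<alpha> by simp
      ultimately show ?thesis by (simp only: of_nat_less_iff)
    qed
    have cop: "coprime (snd (quotient_of (c \<alpha>))) (int p)" if "\<alpha> \<in> A s" for \<alpha>
      using uv(2)[of \<alpha> p] bound[OF that] that p c[of \<alpha>] by (intro Zloc_memI[of p "v \<alpha>" _ "u \<alpha>"]) (auto simp: A_def)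
    have res: "[Zloc_residue p (c \<alpha>) = Poly_Mapping.lookup (\<Delta> p) \<alpha>] (mod int p)" if "\<alpha> \<in> A s" for \<alpha>
      using uv(2)[of \<alpha> p] bound[OF that] that p c[of \<alpha>] cop[OF that]
      by (intro Zloc_residue_unique[of p _ "v \<alpha>" "u \<alpha>"]) (auto simp: A_def)
    define z where "z = finprod (tensor (Rmod s) (Zloc p))
      (\<lambda>\<alpha>. pure_tensor (Rmod s) (Zloc p) (tideal_pow s +>\<^bsub>tring\<^esub> t \<alpha>) (c \<alpha>)) (A s)"
    have pureZ: "pure_tensor (Rmod s) (Zloc p) (tideal_pow s +>\<^bsub>tring\<^esub> t \<alpha>) (c \<alpha>) \<in> carrier (tensor (Rmod s) (Zloc p))"
      if "\<alpha> \<in> A s" for \<alpha>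
      using cop[OF that] by (intro pure_tensor_closed[OF mon(1) monZ in_carrier]) (simp add: Zloc_def)
    have "z \<in> carrier (tensor (Rmod s) (Zloc p))"
      unfolding z_def using pureZ by (intro comm_monoid.finprod_closed comm_group.axioms(1) TZ) auto
    moreover have "Zloc_incl s z = L s"
    proof -
      interpret Ts: comm_group "tensor (Rmod s) QQ" by (rule T)
      have "Zloc_incl s z = finprod (tensor (Rmod s) QQ)
        (\<lambda>\<alpha>. Zloc_incl s (pure_tensor (Rmod s) (Zloc p) (tideal_pow s +>\<^bsub>tring\<^esub> t \<alpha>) (c \<alpha>))) (A s)"
        unfolding z_def using pureZ by (intro hom_finprod[OF Zloc_incl_hom(1)[OF p] TZ T]) auto
      also have "\<dots> = L s"
        unfolding L_def
        by (rule Ts.finprod_cong'[OF refl]) (rule Pi_I pure Zloc_incl_hom(2)[OF p] cop | assumption)+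
      finally show ?thesis .
    qed
    moreover have "reduce_mod_p p s z = quot_map ?J (Det_p n m l p)"
    proof -
      interpret Q: comm_group "add_monoid (tring Quot ?J)" by (rule comm_group_Quot[OF J])
      let ?r = "\<lambda>\<alpha>. of_int (Zloc_residue p (c \<alpha>)) * t \<alpha>"
      have "reduce_mod_p p s z = finprod (add_monoid (tring Quot ?J))
        (\<lambda>\<alpha>. reduce_mod_p p s (pure_tensor (Rmod s) (Zloc p) (tideal_pow s +>\<^bsub>tring\<^esub> t \<alpha>) (c \<alpha>))) (A s)"
        unfolding z_def using pureZ by (intro hom_finprod[OF reduce_mod_p_hom(1)[OF p] TZ comm_group_Quot[OF J]]) auto
      also have "\<dots> = finprod (add_monoid (tring Quot ?J)) (\<lambda>\<alpha>. ?J +>\<^bsub>tring\<^esub> ?r \<alpha>) (A s)"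
      proof (rule Q.finprod_cong'[OF refl])
        show "(\<lambda>\<alpha>. ?J +>\<^bsub>tring\<^esub> ?r \<alpha>) \<in> A s \<rightarrow> carrier (add_monoid (tring Quot ?J))"
          by (simp add: carrier_Quot[OF J])
      qed (rule reduce_mod_p_hom(2)[OF p cop])
      also have "\<dots> = ?J +>\<^bsub>tring\<^esub> (\<Sum>\<alpha>\<in>A s. ?r \<alpha>)" by (rule finprod_coset[OF J])
      also have "\<dots> = ?J +>\<^bsub>tring\<^esub> \<Delta> p"
        unfolding coset_eq_iff[OF J]
      proof (rule poly_mapping_in_ideal[OF J])
        fix \<beta>
        have k: "Poly_Mapping.lookup ((\<Sum>\<alpha>\<in>A s. ?r \<alpha>) - \<Delta> p) \<beta> =
            (if \<beta> \<in> A s then Zloc_residue p (c \<beta>) else 0) - Poly_Mapping.lookup (\<Delta> p) \<beta>" (is "_ = ?k")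
          using fin[of s] by (simp add: lookup_minus lookup_sum lookup_of_int_mult t_def lookup_single when_def mult_delta_right)
        have p_multiple: "Poly_Mapping.single \<beta> ?k \<in> ?J" if dvd: "int p dvd ?k"
        proof -
          obtain q where "?k = int p * q" using dvd by (elim dvdE)
          then have "Poly_Mapping.single \<beta> ?k = of_nat p * (of_int q * Poly_Mapping.single \<beta> 1)"
            by (subst single_eq_of_int_mult) (simp add: mult.assoc)
          then show ?thesis by (auto intro: subsetD[OF p_ideal_subset] of_nat_mult_in_p_ideal)
        qed
        \<comment> \<open>For \<beta> in \<open>A s\<close> the two coefficients agree modulo p by
          the choice of c. For \<beta> = 1 the determinant contributes a multiple of p. Any other
          monomial of the determinant has degree at least s in the generators and lies in
          I^s.\<close>
        have "Poly_Mapping.single \<beta> ?k \<in> ?J"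
        proof (cases "\<beta> \<in> A s \<or> \<beta> = 0 \<or> Poly_Mapping.lookup (\<Delta> p) \<beta> = 0")
          case True
          have "0 \<notin> A s" by (simp add: A_def idegree_def)
          then have "int p dvd ?k"
            using True res[of \<beta>] lookup_zero_mdet_diff_op[OF p assms(1), of m l] unfolding \<Delta>_def
            by (auto simp: cong_iff_dvd_diff)
          then show ?thesis by (rule p_multiple)
        next
          case False
          have "supported (admissible m) (\<Delta> p)" unfolding \<Delta>_def by (rule supported_mdet_diff_op)
          then have adm: "admissible m \<beta>" using False by (simp add: supported_def)
          then have "idegree \<beta> \<noteq> 0" using False admissible_idegree_zero by blast
          then have "int s \<le> idegree \<beta>" using False adm idegree_nonneg[of \<beta>] by (auto simp: A_def)
          then have "Poly_Mapping.single \<beta> 1 \<in> ?J" using monomial_in_tideal_pow tideal_pow_subset by blast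
          then show ?thesis using ideal_facts(3)[OF J] by (subst single_eq_of_int_mult)
        qed
        then show "Poly_Mapping.single \<beta> (Poly_Mapping.lookup ((\<Sum>\<alpha>\<in>A s. ?r \<alpha>) - \<Delta> p) \<beta>) \<in> ?J"
          unfolding k .
      qed
      also have "\<dots> = quot_map ?J (Det_p n m l p)"
        unfolding Det_p_eq \<Delta>_def by (rule quot_map_coset[OF ideal_p_ideal J p_ideal_subset, symmetric])
      finally show ?thesis .
    qed
    ultimately show ?thesis by blast
  qed
  ultimately show ?thesis
    using K by (intro bexI[of _ L] exI[of _ "1 / real K"]) (auto simp: Let_def)
qed

end
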